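(* Let $d\geq5$. There is a finite constant $C_d$, depending only on $d$, such that the following holds. Let $\lambda$ be a positive integer and let $p$ be an odd prime with $p\nmid\lambda$. If $\lambda\geq p^8$, then for every $a\in\mathbb{Z}_p^d$, $$\left|\nu_{\lambda,p}(a)-\rho_\lambda\,\mathfrak{c}_d\,p^{1-d}\,\mathbf{1}_{\{|a|^2\equiv\lambda\ (\mathrm{mod}\ p)\}}\sum_{\substack{r\geq1\\(p,r)=1}}\mathfrak{QR}_r(\lambda)\right|\leq C_d\,\lambda^{-1/8}.$$
   Context: $\mathbb{Z}_q=\mathbb{Z}/q\mathbb{Z}$ and $\mathbb{Z}_q^\times$ is its group of units (for $q=1$ both consist of the single element $0$); $e_q(t)=e^{2\pi i t/q}$. For $\lambda\in\mathbb{N}$, $s_\lambda=\#\{n\in\mathbb{Z}^d:|n|^2=\lambda\}$ ($>0$ since $d\ge 5$) and $\rho_\lambda=\lambda^{d/2-1}/s_\lambda$. The constant $\mathfrak{c}_d=\pi^{d/2}/\Gamma(d/2)$. For a prime $p$ and $a\in\mathbb{Z}_p^d$, $$\nu_{\lambda,p}(a)=\frac{1}{s_\lambda}\#\{n\in\mathbb{Z}^d:|n|^2=\lambda,\ n\equiv a\ (\mathrm{mod}\ p)\}.$$ The normalized Gauss sum is $G(a,\ell,r)=r^{-d}\sum_{n\in\mathbb{Z}_r^d}e_r(a|n|^2+n\cdot\ell)$, and $$\mathfrak{QR}_r(\lambda)=\sum_{a\in\mathbb{Z}_r^\times}e_r(-a\lambda)\,G(a,0,r),$$ where $|n|^2=n_1^2+\dots+n_d^2$.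 The series over $r$ converges absolutely. *)

theory Defs
  imports "HOL-Analysis.Analysis" "HOL-Number_Theory.Cong"
begin

text \<open>
  A vector of dimension \<open>d\<close> is a function on the index set \<open>{..<d}\<close>, extensional in the sense of
  \<open>PiE\<close>, so that sets of vectors are counted correctly. The ring of integers modulo \<open>r\<close> is
  represented by the residues \<open>{0..<int r}\<close>; for \<open>r = 1\<close> both \<open>residue_set 1\<close> and
  \<open>unit_residues 1\<close> are \<open>{0}\<close>.
\<close>

definition int_vectors :: "nat \<Rightarrow> (nat \<Rightarrow> int) set" where
  "int_vectors d = ({..<d} \<rightarrow>\<^sub>E UNIV)"

definition residue_set :: "nat \<Rightarrow> int set" where
  "residue_set r = {0..<int r}"

definition residue_vectors :: "nat \<Rightarrow> nat \<Rightarrow> (nat \<Rightarrow> int) set" where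
  "residue_vectors d r = ({..<d} \<rightarrow>\<^sub>E residue_set r)"

definition unit_residues :: "nat \<Rightarrow> int set" where
  "unit_residues r = {a \<in> residue_set r. coprime a (int r)}"

definition norm_sq :: "nat \<Rightarrow> (nat \<Rightarrow> int) \<Rightarrow> int" where
  "norm_sq d n = (\<Sum>i<d. (n i)\<^sup>2)"

definition dot :: "nat \<Rightarrow> (nat \<Rightarrow> int) \<Rightarrow> (nat \<Rightarrow> int) \<Rightarrow> int" where
  "dot d m n = (\<Sum>i<d. m i * n i)"

definition add_char :: "nat \<Rightarrow> int \<Rightarrow> complex" where
  "add_char q t = exp (2 * complex_of_real pi * \<i> * of_int t / of_nat q)"

definition sphere_points :: "nat \<Rightarrow> nat \<Rightarrow> (nat \<Rightarrow> int) set" where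
  "sphere_points d lam = {n \<in> int_vectors d. norm_sq d n = int lam}"

definition sphere_count :: "nat \<Rightarrow> nat \<Rightarrow> nat" where
  "sphere_count d lam = card (sphere_points d lam)"

definition rho :: "nat \<Rightarrow> nat \<Rightarrow> real" where
  "rho d lam = real lam powr (real d / 2 - 1) / real (sphere_count d lam)"

definition sphere_const :: "nat \<Rightarrow> real" where
  "sphere_const d = pi powr (real d / 2) / Gamma (real d / 2)"

definition nu :: "nat \<Rightarrow> nat \<Rightarrow> nat \<Rightarrow> (nat \<Rightarrow> int) \<Rightarrow> real" where
  "nu d lam p a =
     real (card {n \<in> sphere_points d lam. \<forall>i<d. [n i = a i] (mod int p)})
       / real (sphere_count d lam)"

definition gauss_sum :: "nat \<Rightarrow> int \<Rightarrow> (nat \<Rightarrow> int) \<Rightarrow> nat \<Rightarrow> complex" where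
  "gauss_sum d a l r =
     (\<Sum>n\<in>residue_vectors d r. add_char r (a * norm_sq d n + dot d n l)) / of_nat r ^ d"

definition QR :: "nat \<Rightarrow> nat \<Rightarrow> nat \<Rightarrow> complex" where
  "QR d r lam =
     (\<Sum>a\<in>unit_residues r. add_char r (- a * int lam) * gauss_sum d a (\<lambda>_. 0) r)"

end

theory Submission
  imports Defs "HOL-Probability.Probability" "HOL-Complex_Analysis.Complex_Analysis"
begin

text \<open>
  The points of the sphere congruent to \<open>a\<close> modulo \<open>p\<close> are counted by integrating the product of the
  theta series of the classes \<open>a\<^sub>i + p\<int>\<close> over a unit interval at height \<open>1/\<lambda>\<close>. Near \<open>h/q\<close> with
  \<open>q \<le> \<surd>\<lambda>\<close>, Poisson summation modulo \<open>lcm p q\<close> replaces every theta series by a single Gauss sum term up to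
  \<open>O(\<lambda>\<^sup>1\<^sup>/\<^sup>4)\<close>; this is uniform in \<open>p\<close> because the Gauss sums restricted to a class modulo \<open>p\<close> are at most
  \<open>\<surd>(2q)\<close> whatever \<open>gcd p q\<close> is. The arcs of radius \<open>1/(2q\<surd>\<lambda>)\<close> are disjoint, and by Dirichlet's theorem every factor is
  \<open>O(\<lambda>\<^sup>1\<^sup>/\<^sup>4)\<close> off them.

  In the main term, a denominator \<open>q\<close> prime to \<open>p\<close> contributes \<open>p\<^sup>-\<^sup>d QR q\<close>, a denominator \<open>q = p r\<close> with
  \<open>r\<close> prime to \<open>p\<close> contributes \<open>(p - 1) p\<^sup>-\<^sup>d QR r\<close>, and a multiple of \<open>p\<^sup>2\<close> contributes nothing, since
  \<open>p\<close> does not divide \<open>\<lambda>\<close> and so some \<open>a\<^sub>i\<close> is a unit. Dividing by the number of points on the sphere needs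
  a lower bound of order \<open>\<lambda>\<^sup>d\<^sup>/\<^sup>2\<^sup>-\<^sup>1\<close>, which is the case \<open>p = 1\<close> together with an Euler product
  bounded away from zero. If the sphere is empty, both sides vanish because \<open>x / 0 = 0\<close>.
\<close>

section \<open>Gaussian and Gamma integrals with complex parameters\<close>

text \<open>The obstacle is uniformity in p: since p may grow with lam, no error term may carry a
  positive power of p. The analysis near h/q therefore never uses the size of p. What a class modulo
  p lacks in residues it regains in a greatest common divisor, and the modulus lcm p q cancels from
  the Poisson error. Put R = lam^(1/4). The major arcs reproduce the main term, of order R^(2d-4),
  up to a relative error 1/R times a sum of 1/q over q up to R^2; that sum is bounded by a multiple
  of sqrt R, which leaves lam^(-1/8). The minor arcs give R^d, relatively at most 1/R once d is at
  least 5. The condition lam >= p^8 enters once. Denominators q = p r occur only for r up to sqrt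
  lam / p, and the condition makes the omitted tail of the singular series begin no earlier than
  lam^(3/8), so that it is O(lam^(-1/8)). The denominators r and p r carry the weights 1 and p - 1,
  whose sum p, divided by p^d, is the factor p^(1-d).\<close>

lemma exp_mult_bound: "(t::real) * exp (- c * t) \<le> 1 / c" if "c > 0"
proof -
  have "c * t \<le> exp (c * t)" using exp_ge_add_one_self[of "c*t"] by linarith
  then show ?thesis using that by (simp add: exp_minus field_simps)
qed

lemma exp_minus_one_bound:
  fixes z :: complex
  shows "norm (exp z - 1) \<le> norm z * exp (norm z)"
proof -
  have "norm (exp z - exp 0) \<le> exp (norm z) * norm (z - 0)"
  proof (rule field_differentiable_bound[of "cball 0 (norm z)" exp exp])
    fix w :: complex assume "w \<in> cball 0 (norm z)"
    then have "norm w \<le> norm z" by simp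
    have "norm (exp w) = exp (Re w)" by simp
    also have "\<dots> \<le> exp (norm z)" using complex_Re_le_cmod[of w] \<open>norm w \<le> norm z\<close> by simp
    finally show "norm (exp w) \<le> exp (norm z)" .
  qed (auto intro!: DERIV_exp[THEN has_field_derivative_at_within])
  then show ?thesis by (simp add: mult.commute)
qed

text \<open>Differentiation under the integral sign: dominated convergence is applied to the
  difference quotients along an arbitrary sequence tending to \<open>s\<close>. Together with
  \<open>holomorphic_halfplane_eqI\<close> it extends integral formulas from positive real
  parameters to complex ones, which is how the Gaussian and the Gamma integral are obtained
  below.\<close>

lemma integral_exp_holomorphic:
  fixes w :: "'a \<Rightarrow> complex" and T :: "'a \<Rightarrow> real"
  assumes [measurable]: "w \<in> borel_measurable M" "T \<in> borel_measurable M"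
    and T: "\<And>x. T x \<ge> 0"
    and int: "\<And>c::real. c > 0 \<Longrightarrow> integrable M (\<lambda>x. norm (w x) * exp (- c * T x))"
  shows "(\<lambda>s. LINT x|M. w x * exp (- s * of_real (T x))) holomorphic_on {s. Re s > 0}"
proof -
  define F where "F = (\<lambda>s. LINT x|M. w x * exp (- s * complex_of_real (T x)))"
  have intF: "integrable M (\<lambda>x. w x * exp (- s * complex_of_real (T x)))" if "Re s > 0" for s
    by (rule Bochner_Integration.integrable_bound[OF int[OF that]]) (auto simp: norm_mult)
  have "(F has_field_derivative
          (LINT x|M. w x * (- of_real (T x)) * exp (- s * of_real (T x)))) (at s)"
    if s: "Re s > 0" for s :: complex
    unfolding has_field_derivative_iff tendsto_at_iff_sequentially
  proof (intro allI impI)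
    fix X :: "nat \<Rightarrow> complex"
    assume X: "\<forall>i. X i \<in> UNIV - {s}" "X \<longlonglongrightarrow> s"
    define c where "c = Re s"
    have c: "c > 0" using s by (simp add: c_def)
    have "eventually (\<lambda>i. dist (X i) s < c / 4) sequentially"
      using X(2) c tendstoD[of X s sequentially "c/4"] by simp
    then obtain N where N: "\<And>i. i \<ge> N \<Longrightarrow> norm (X i - s) < c / 4"
      by (auto simp: eventually_sequentially dist_norm)
    \<comment> \<open>Only a tail of the sequence is used: there \<open>norm (h i)\<close> is below
      \<open>c / 4\<close>, so that \<open>X (i + N)\<close> stays in the half-plane.\<close>
    define h where "h = (\<lambda>i. X (i + N) - s)"
    have h: "norm (h i) < c / 4" "h i \<noteq> 0" for i
      using N[of "i+N"] X(1) by (auto simp: h_def)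
    have hlim: "h \<longlonglongrightarrow> 0"
      unfolding h_def using LIM_zero[OF LIMSEQ_ignore_initial_segment[OF X(2), of N]] by simp
    define G where "G = (\<lambda>i x. w x * exp (- s * complex_of_real (T x)) * ((exp (- h i * of_real (T x)) - 1) / h i))"
    have eq: "(F (X (i + N)) - F s) / (X (i + N) - s) = (LINT x|M. G i x)" for i
    proof -
      have "\<bar>Re (h i)\<bar> < c / 4" using h(1)[of i] abs_Re_le_cmod[of "h i"] by linarith
      moreover have "Re (X (i+N)) = Re (h i) + c" by (simp add: h_def c_def)
      ultimately have re: "Re (X (i+N)) > 0" using c by linarith
      have "F (X (i+N)) - F s = (LINT x|M. w x * exp (- X (i+N) * complex_of_real (T x)) - w x * exp (- s * complex_of_real (T x)))"
        unfolding F_def using intF[OF re] intF[OF s] by simp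
      also have "\<dots> = (LINT x|M. h i * G i x)"
      proof (rule Bochner_Integration.integral_cong[OF refl])
        fix x
        have "- X (i + N) * complex_of_real (T x) = - s * of_real (T x) + - h i * of_real (T x)"
          by (simp add: h_def algebra_simps)
        then have "exp (- X (i + N) * complex_of_real (T x)) = exp (- s * of_real (T x)) * exp (- h i * of_real (T x))"
          by (metis exp_add)
        then show "w x * exp (- X (i + N) * complex_of_real (T x)) - w x * exp (- s * complex_of_real (T x)) = h i * G i x"
          using h(2)[of i] by (simp add: G_def field_simps)
      qed
      finally show ?thesis using h(2)[of i] by (simp add: h_def)
    qed
    have "(\<lambda>i. LINT x|M. G i x) \<longlonglongrightarrow> (LINT x|M. w x * (- of_real (T x)) * exp (- s * of_real (T x)))"
    proof (rule integral_dominated_convergence[where w = "\<lambda>x. (4 / c) * (norm (w x) * exp (- (c/2) * T x))"])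
      show "integrable M (\<lambda>x. (4 / c) * (norm (w x) * exp (- (c/2) * T x)))"
        using int[of "c/2"] c by simp
      show "G i \<in> borel_measurable M" for i unfolding G_def by measurable
      show "AE x in M. (\<lambda>i. G i x) \<longlonglongrightarrow> w x * - complex_of_real (T x) * exp (- s * complex_of_real (T x))"
      proof (rule AE_I2)
        fix x
        have "((\<lambda>z. (exp (- z * of_real (T x)) - 1) / z) \<longlongrightarrow> - complex_of_real (T x)) (at 0)"
        proof -
          have "((\<lambda>z. exp (- z * complex_of_real (T x))) has_field_derivative - of_real (T x)) (at 0)"
            by (auto intro!: derivative_eq_intros)
          then show ?thesis by (simp add: has_field_derivative_iff)
        qed
        moreover have "filterlim h (at 0) sequentially"
          using hlim h(2) by (auto simp: filterlim_at)
        ultimately have "(\<lambda>i. (exp (- h i * of_real (T x)) - 1) / h i) \<longlonglongrightarrow> - complex_of_real (T x)"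
          by (rule filterlim_compose)
        from tendsto_mult[OF tendsto_const[of "w x * exp (- s * complex_of_real (T x))"] this]
        show "(\<lambda>i. G i x) \<longlonglongrightarrow> w x * - complex_of_real (T x) * exp (- s * complex_of_real (T x))"
          unfolding G_def by (simp add: mult_ac)
      qed
      \<comment> \<open>The decay \<open>exp (- c * T x)\<close> is shared out: one quarter pays for
        \<open>exp (norm (h i) * T x)\<close>, one quarter for the factor \<open>T x\<close>, and
        the remaining half is integrable by assumption.\<close>
      show "AE x in M. norm (G i x) \<le> (4 / c) * (norm (w x) * exp (- (c/2) * T x))" for i
      proof (rule AE_I2)
        fix x
        have "norm ((exp (- h i * of_real (T x)) - 1) / h i) \<le> norm (- h i * complex_of_real (T x)) * exp (norm (- h i * complex_of_real (T x))) / norm (h i)"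
          unfolding norm_divide by (intro divide_right_mono exp_minus_one_bound) auto
        also have "\<dots> = T x * exp (norm (h i) * T x)" using h(2)[of i] T[of x] by (simp add: norm_mult)
        also have "\<dots> \<le> T x * exp (c / 4 * T x)"
          using mult_right_mono[OF less_imp_le[OF h(1)[of i]] T[of x]] T[of x] by (intro mult_left_mono) auto
        finally have 1: "norm ((exp (- h i * of_real (T x)) - 1) / h i) \<le> T x * exp (c / 4 * T x)" .
        have "norm (G i x) \<le> norm (w x) * exp (- c * T x) * (T x * exp (c / 4 * T x))"
          unfolding G_def norm_mult using 1 by (intro mult_mono) (auto simp: c_def)
        also have "\<dots> = norm (w x) * exp (- (c/2) * T x) * (T x * exp (- (c/4) * T x))"
          by (simp add: mult_ac flip: exp_add)
        also have "\<dots> \<le> norm (w x) * exp (- (c/2) * T x) * (4 / c)"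
          using exp_mult_bound[of "c/4" "T x"] c by (intro mult_left_mono) auto
        finally show "norm (G i x) \<le> (4 / c) * (norm (w x) * exp (- (c/2) * T x))" by (simp add: mult_ac)
      qed
    qed measurable
    then have "(\<lambda>i. (F (X (i + N)) - F s) / (X (i + N) - s)) \<longlonglongrightarrow> (LINT x|M. w x * (- of_real (T x)) * exp (- s * of_real (T x)))"
      by (simp add: eq)
    then show "((\<lambda>y. (F y - F s) / (y - s)) \<circ> X) \<longlonglongrightarrow> (LINT x|M. w x * (- of_real (T x)) * exp (- s * of_real (T x)))"
      unfolding o_def by (rule LIMSEQ_offset)
  qed
  then have "F holomorphic_on {s. Re s > 0}"
    by (intro holomorphic_onI) (auto simp: field_differentiable_def intro: has_field_derivative_at_within)
  then show ?thesis by (simp add: F_def)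
qed

text \<open>Identity theorem: the positive reals have the limit point 1 inside the connected
  half-plane.\<close>

lemma holomorphic_halfplane_eqI:
  assumes "f holomorphic_on {s. Re s > 0}" "g holomorphic_on {s. Re s > 0}"
    and "\<And>c::real. c > 0 \<Longrightarrow> f (of_real c) = g (of_real c)" and "Re s > 0"
  shows "f s = g s"
proof -
  have "f s - g s = 0"
  proof (rule analytic_continuation[where f = "\<lambda>s. f s - g s" and S = "{s. Re s > 0}" and U = "of_real ` {0<..}" and \<xi> = 1])
    show "open {s. 0 < Re s}" by (rule open_halfspace_Re_gt)
    show "connected {s. 0 < Re s}" by (intro convex_connected convex_halfspace_Re_gt)
    have "(\<lambda>n. complex_of_real (1 + 1 / real (Suc n))) \<longlonglongrightarrow> complex_of_real (1 + 0)"
      by (intro tendsto_intros LIMSEQ_Suc[OF lim_1_over_n])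
    moreover have "complex_of_real (1 + 1 / real (Suc n)) \<in> of_real ` {0<..} - {1}" for n
    proof -
      have "1 + 1 / real (Suc n) > 0" "1 + 1 / real (Suc n) \<noteq> 1"
        by (auto intro: add_pos_nonneg)
      then show ?thesis using of_real_eq_1_iff by blast
    qed
    ultimately show "(1::complex) islimpt of_real ` {0<..}"
      unfolding islimpt_sequential by (intro exI[of _ "\<lambda>n. complex_of_real (1 + 1 / real (Suc n))"]) simp
  qed (use assms in \<open>auto intro!: holomorphic_intros\<close>)
  then show ?thesis by simp
qed

text \<open>A rescaling of the characteristic function of the standard normal distribution. The
  factor \<open>a = sqrt (2 * pi * c)\<close> turns \<open>x^2 / 2\<close> into
  \<open>c * pi * x^2\<close>, and the frequency \<open>\<xi>\<close> corresponds to
  \<open>t = - 2 * pi * \<xi> / a\<close>.\<close>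

lemma gaussian_fourier_real:
  fixes c \<xi> :: real
  assumes c: "c > 0"
  shows "integrable lborel (\<lambda>x. exp (- c * (pi * x\<^sup>2)))"
    and "(LINT x|lborel. exp (- 2 * pi * \<i> * \<xi> * of_real x) * exp (- complex_of_real c * of_real (pi * x\<^sup>2)))
           = of_real (exp (- pi * \<xi>\<^sup>2 / c) / sqrt c)"
proof -
  define a where "a = sqrt (2 * pi * c)"
  have a: "a > 0" "a\<^sup>2 = 2 * pi * c" using c by (auto simp: a_def)
  have dens: "std_normal_density (0 + a * x) = exp (- c * (pi * x\<^sup>2)) / sqrt (2 * pi)" for x
    unfolding std_normal_density_def using a(2) by (simp add: power_mult_distrib field_simps)
  have "integrable lborel (\<lambda>x. std_normal_density (0 + a * x))"
    using a(1) by (intro lborel_integrable_real_affine integrable_normal_density) auto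
  then have "integrable lborel (\<lambda>x. sqrt (2 * pi) * (exp (- c * (pi * x\<^sup>2)) / sqrt (2 * pi)))"
    unfolding dens by (rule integrable_mult_right)
  then show "integrable lborel (\<lambda>x. exp (- c * (pi * x\<^sup>2)))" by simp
  define t where "t = - 2 * pi * \<xi> / a"
  have t2: "t\<^sup>2 / 2 = pi * \<xi>\<^sup>2 / c"
    using a c by (simp add: t_def power_divide power_mult_distrib) (simp add: field_simps power2_eq_square)
  have "complex_of_real (exp (- (t\<^sup>2) / 2)) = char std_normal_distribution t"
    by (simp add: char_std_normal_distribution)
  also have "\<dots> = (LINT x|lborel. std_normal_density x *\<^sub>R iexp (t * x))"
    unfolding char_def by (subst integral_density) (auto simp: normal_density_nonneg)
  also have "\<dots> = a *\<^sub>R (LINT x|lborel. std_normal_density (0 + a * x) *\<^sub>R iexp (t * (0 + a * x)))"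
    using a(1) by (subst lborel_integral_real_affine[where c=a and t=0]) auto
  also have "(\<lambda>x. std_normal_density (0 + a * x) *\<^sub>R iexp (t * (0 + a * x))) =
     (\<lambda>x. complex_of_real (1 / sqrt (2 * pi)) * (exp (- 2 * pi * \<i> * \<xi> * of_real x) * exp (- complex_of_real c * of_real (pi * x\<^sup>2))))"
  proof
    fix x
    have "t * (0 + a * x) = - 2 * pi * \<xi> * x" using a(1) by (simp add: t_def)
    then have "iexp (t * (0 + a * x)) = exp (- 2 * pi * \<i> * \<xi> * of_real x)"
      by (simp add: mult_ac)
    moreover have "complex_of_real (exp (- c * (pi * x\<^sup>2))) = exp (- complex_of_real c * of_real (pi * x\<^sup>2))"
      by (simp add: exp_of_real[symmetric])
    ultimately show "std_normal_density (0 + a * x) *\<^sub>R iexp (t * (0 + a * x)) = complex_of_real (1 / sqrt (2 * pi)) * (exp (- 2 * pi * \<i> * \<xi> * of_real x) * exp (- complex_of_real c * of_real (pi * x\<^sup>2)))"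
      unfolding dens scaleR_conv_of_real of_real_divide by simp
  qed
  also have "a *\<^sub>R (LINT x|lborel. complex_of_real (1 / sqrt (2 * pi)) * (exp (- 2 * pi * \<i> * \<xi> * of_real x) * exp (- complex_of_real c * of_real (pi * x\<^sup>2))))
    = of_real (sqrt c) * (LINT x|lborel. exp (- 2 * pi * \<i> * \<xi> * of_real x) * exp (- complex_of_real c * of_real (pi * x\<^sup>2)))"
    by (simp add: a_def real_sqrt_mult scaleR_conv_of_real field_simps)
  finally show "(LINT x|lborel. exp (- 2 * pi * \<i> * \<xi> * of_real x) * exp (- complex_of_real c * of_real (pi * x\<^sup>2)))
           = of_real (exp (- pi * \<xi>\<^sup>2 / c) / sqrt c)"
    using c t2 by (simp add: field_simps)
qed

text \<open>Analytic continuation in \<open>s\<close>. The half-plane avoids the cut of the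
  logarithm, so the principal branch of \<open>s powr (-1/2)\<close> is holomorphic there and agrees
  with the real square root on the positive axis.\<close>

lemma gaussian_fourier:
  fixes s :: complex and \<xi> :: real
  assumes s: "Re s > 0"
  shows "(LINT x|lborel. exp (- 2 * pi * \<i> * \<xi> * of_real x) * exp (- s * of_real (pi * x\<^sup>2)))
           = s powr (-1/2) * exp (- pi * \<xi>\<^sup>2 / s)"
proof (rule holomorphic_halfplane_eqI[OF _ _ _ s, where f = "\<lambda>s. LINT x|lborel. exp (- 2 * pi * \<i> * \<xi> * of_real x) * exp (- s * of_real (pi * x\<^sup>2))"])
  show "(\<lambda>s. CLBINT x. exp (- 2 * pi * \<i> * \<xi> * of_real x) * exp (- s * of_real (pi * x\<^sup>2))) holomorphic_on {s. 0 < Re s}"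
  proof (rule integral_exp_holomorphic)
    fix c :: real assume c: "c > 0"
    show "integrable lborel (\<lambda>x. cmod (exp (- 2 * pi * \<i> * \<xi> * of_real x)) * exp (- c * (pi * x\<^sup>2)))"
      using gaussian_fourier_real(1)[OF c] by simp
  qed auto
  show "(\<lambda>s. s powr (-1/2) * exp (- pi * \<xi>\<^sup>2 / s)) holomorphic_on {s. 0 < Re s}"
    by (auto intro!: holomorphic_intros simp: complex_nonpos_Reals_iff)
  fix c :: real assume c: "c > 0"
  have "complex_of_real c powr (-1/2) = of_real (c powr (-1/2))"
    using c powr_of_real[of c "-1/2"] by simp
  also have "c powr (-1/2) = 1 / sqrt c" using c by (simp add: powr_minus_divide powr_half_sqrt)
  finally have "complex_of_real c powr (-1/2) = of_real (1 / sqrt c)" .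
  then show "(CLBINT x. exp (- 2 * pi * \<i> * \<xi> * of_real x) * exp (- complex_of_real c * of_real (pi * x\<^sup>2))) =
      complex_of_real c powr (-1/2) * exp (- pi * \<xi>\<^sup>2 / complex_of_real c)"
    unfolding gaussian_fourier_real(2)[OF c] by (simp add: exp_of_real[symmetric])
qed

section \<open>The Gamma density and its Laplace transform\<close>

lemma powr_exp_integrable:
  fixes k c :: real
  assumes k: "k > 0" and c: "c > 0"
  shows "integrable lborel (\<lambda>t. indicator {0<..} t * (t powr (k - 1)) * exp (- c * t))"
    and "(LINT t|lborel. indicator {0<..} t * (t powr (k - 1)) * exp (- c * t)) = Gamma k * c powr (-k)"
proof -
  define f where "f = (\<lambda>t::real. t powr (k - 1) / exp t)"
  have hi: "(f has_integral Gamma k) {0<..}"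
  proof -
    have "(f has_integral Gamma k) {0..}" unfolding f_def by (rule Gamma_integral_real[OF k])
    then show ?thesis
      by (rule has_integral_spike_set_eq[THEN iffD1, rotated 2]) (auto simp: f_def intro: negligible_subset[of "{}"])
  qed
  have int: "integrable lborel (\<lambda>t. indicator {0<..} t * f t)"
    and val: "(LINT t|lborel. indicator {0<..} t * f t) = Gamma k"
  proof -
    have "set_integrable lebesgue {0<..} f"
      by (rule nonnegative_absolutely_integrable_1) (use hi in \<open>auto simp: f_def has_integral_iff\<close>)
    moreover have m: "(\<lambda>t. indicator {0<..} t * f t) \<in> borel_measurable lborel" unfolding f_def by measurable
    ultimately show "integrable lborel (\<lambda>t. indicator {0<..} t * f t)"
      by (simp add: set_integrable_def integrable_completion)
    then have "set_integrable lborel {0<..} f" by (simp add: set_integrable_def)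
    from set_borel_integral_eq_integral(2)[OF this] hi
    show "(LINT t|lborel. indicator {0<..} t * f t) = Gamma k"
      by (simp add: set_lebesgue_integral_def has_integral_iff)
  qed
  have eq: "indicator {0<..} (0 + c * t) * f (0 + c * t) = c powr (k - 1) * (indicator {0<..} t * (t powr (k - 1)) * exp (- c * t))" for t
    using c by (auto simp: f_def indicator_def zero_less_mult_iff powr_mult exp_minus field_simps)
  have "integrable lborel (\<lambda>t. indicator {0<..} (0 + c * t) * f (0 + c * t))"
    using c by (intro lborel_integrable_real_affine[OF int]) auto
  then show "integrable lborel (\<lambda>t. indicator {0<..} t * (t powr (k - 1)) * exp (- c * t))"
    unfolding eq using c by simp
  have "Gamma k = c * (LINT t|lborel. indicator {0<..} (0 + c * t) * f (0 + c * t))"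
    unfolding val[symmetric] using c by (subst lborel_integral_real_affine[where c=c and t=0]) auto
  also have "\<dots> = (c * c powr (k - 1)) * (LINT t|lborel. indicator {0<..} t * (t powr (k - 1)) * exp (- c * t))"
    unfolding eq integral_mult_right_zero by (simp only: mult.assoc)
  also have "c * c powr (k - 1) = c powr k" using c by (simp add: powr_diff)
  finally have "Gamma k = c powr k * (LINT t|lborel. indicator {0<..} t * (t powr (k - 1)) * exp (- c * t))" .
  then have "Gamma k * c powr (-k) = (c powr k * c powr (-k)) * (LINT t|lborel. indicator {0<..} t * (t powr (k - 1)) * exp (- c * t))"
    by (simp only: mult_ac)
  moreover have "c powr k * c powr (-k) = 1" using c by (simp add: powr_minus)
  ultimately show "(LINT t|lborel. indicator {0<..} t * (t powr (k - 1)) * exp (- c * t)) = Gamma k * c powr (-k)"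
    by (simp only: mult_1_left)
qed

lemma gamma_laplace:
  fixes s :: complex and k :: real
  assumes s: "Re s > 0" and k: "k > 0"
  shows "(LINT t|lborel. of_real (indicator {0<..} t * t powr (k - 1)) * exp (- s * of_real t)) = of_real (Gamma k) * s powr (- of_real k)"
proof -
  \<comment> \<open>\<open>integral_exp_holomorphic\<close> wants an exponent that is nonnegative
    everywhere, hence \<open>max 0 t\<close>; this changes nothing, because the weight vanishes for
    \<open>t \<le> 0\<close>.\<close>
  have "(LINT t|lborel. of_real (indicator {0<..} t * t powr (k - 1)) * exp (- s * of_real (max 0 t))) = of_real (Gamma k) * s powr (- of_real k)"
  proof (rule holomorphic_halfplane_eqI[OF _ _ _ s, where f = "\<lambda>s. LINT t|lborel. of_real (indicator {0<..} t * t powr (k - 1)) * exp (- s * of_real (max 0 t))"])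
    show "(\<lambda>s. CLBINT t. complex_of_real (indicator {0<..} t * t powr (k - 1)) * exp (- s * of_real (max 0 t))) holomorphic_on {s. 0 < Re s}"
    proof (rule integral_exp_holomorphic)
      fix c :: real assume c: "c > 0"
      show "integrable lborel (\<lambda>t. cmod (complex_of_real (indicator {0<..} t * t powr (k - 1))) * exp (- c * max 0 t))"
      proof -
        have "(\<lambda>t. cmod (complex_of_real (indicator {0<..} t * t powr (k - 1))) * exp (- c * max 0 t))
                = (\<lambda>t. indicator {0<..} t * (t powr (k - 1)) * exp (- c * t))"
          by (auto simp: fun_eq_iff indicator_def)
        then show ?thesis using powr_exp_integrable(1)[OF k c] by simp
      qed
    qed auto
    show "(\<lambda>s. complex_of_real (Gamma k) * s powr - complex_of_real k) holomorphic_on {s. 0 < Re s}"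
      by (auto intro!: holomorphic_intros simp: complex_nonpos_Reals_iff)
    fix c :: real assume c: "c > 0"
    have "(CLBINT t. complex_of_real (indicator {0<..} t * t powr (k - 1)) * exp (- complex_of_real c * of_real (max 0 t)))
       = (CLBINT t. complex_of_real (indicator {0<..} t * (t powr (k - 1)) * exp (- c * t)))"
      by (rule Bochner_Integration.integral_cong) (auto simp: indicator_def exp_of_real[symmetric])
    also have "\<dots> = of_real (Gamma k * c powr (-k))"
      unfolding integral_complex_of_real powr_exp_integrable(2)[OF k c] ..
    also have "\<dots> = complex_of_real (Gamma k) * complex_of_real c powr - complex_of_real k"
      using c powr_of_real[of c "-k"] by simp
    finally show "(CLBINT t. complex_of_real (indicator {0<..} t * t powr (k - 1)) * exp (- complex_of_real c * of_real (max 0 t))) = complex_of_real (Gamma k) * complex_of_real c powr - complex_of_real k" .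
  qed
  also have "(LINT t|lborel. complex_of_real (indicator {0<..} t * t powr (k - 1)) * exp (- s * of_real (max 0 t))) = (LINT t|lborel. of_real (indicator {0<..} t * t powr (k - 1)) * exp (- s * of_real t))"
    by (rule Bochner_Integration.integral_cong) (auto simp: indicator_def)
  finally show ?thesis .
qed

lemma integrable_inverse_1_plus_sq: "integrable lborel (\<lambda>x::real. 1 / (1 + x\<^sup>2))"
  using integrable_inverse_1_plus_square by (simp add: set_integrable_def inverse_eq_divide)

text \<open>Boundedness of the Gamma density, which gives the dominating function in
  \<open>inverse_laplace_gamma\<close>. It is the inequality \<open>t / c \<le> exp (t / c)\<close>
  raised to the power \<open>k - 1\<close>; the choice \<open>c \<ge> k - 1\<close> keeps the
  resulting exponent at most \<open>t\<close>.\<close>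

lemma powr_mult_exp_le:
  assumes "k \<ge> 1" "t \<ge> (0::real)"
  shows "t powr (k - 1) * exp (- t) \<le> max 1 (k - 1) powr (k - 1)"
proof -
  define c where "c = max 1 (k - 1)"
  have c: "c \<ge> 1" "c \<ge> k - 1" by (auto simp: c_def)
  have "t / c \<le> exp (t / c)" using exp_ge_add_one_self[of "t/c"] by linarith
  then have "t \<le> c * exp (t / c)" using c by (simp add: field_simps)
  then have "t powr (k - 1) \<le> (c * exp (t / c)) powr (k - 1)"
    using assms by (intro powr_mono2) auto
  also have "\<dots> = c powr (k - 1) * exp (t / c * (k - 1))"
    using c by (simp add: powr_mult exp_powr_real)
  also have "t / c * (k - 1) \<le> t"
    using c assms mult_right_mono[of "k - 1" c t] by (simp add: field_simps)
  then have "c powr (k - 1) * exp (t / c * (k - 1)) \<le> c powr (k - 1) * exp t" by (intro mult_left_mono) auto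
  finally have "t powr (k - 1) * exp (- t) \<le> (c powr (k - 1) * exp t) * exp (- t)" by simp
  then show ?thesis by (simp add: c_def exp_minus field_simps)
qed

lemma norm_one_plus_i: "norm (1 + \<i> * complex_of_real u) = sqrt (1 + u\<^sup>2)"
  by (simp add: cmod_def)

text \<open>Integrability of the kernel along the vertical line; the condition on \<open>k\<close>
  amounts to \<open>d \<ge> 4\<close>, since \<open>k\<close> will be \<open>d / 2\<close>.\<close>

lemma norm_inverse_laplace_kernel:
  assumes "k \<ge> 2"
  shows "norm ((1 + \<i> * complex_of_real u) powr (- complex_of_real k)) \<le> 1 / (1 + u\<^sup>2)"
proof -
  have "norm ((1 + \<i> * complex_of_real u) powr (- complex_of_real k)) = sqrt (1 + u\<^sup>2) powr (-k)"
    by (subst norm_powr_real_powr') (auto simp: norm_one_plus_i)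
  also have "\<dots> \<le> sqrt (1 + u\<^sup>2) powr (-2)"
    using assms by (intro powr_mono) auto
  also have "\<dots> = 1 / (1 + u\<^sup>2)"
    by (simp add: powr_minus_divide powr_numeral)
  finally show ?thesis .
qed

lemma inverse_laplace_kernel_measurable [measurable]:
  "(\<lambda>u. (1 + \<i> * complex_of_real u) powr (- complex_of_real k)) \<in> borel_measurable borel"
  by (intro borel_measurable_continuous_onI continuous_intros) (auto simp: complex_nonpos_Reals_iff complex_eq_iff)

lemma gaussian_dual:
  fixes \<epsilon> z :: real
  assumes "\<epsilon> > 0"
  shows "(LINT u|lborel. exp (\<i> * of_real (z * u)) * of_real (exp (- ((\<epsilon> * u)\<^sup>2 / 2))))
     = of_real (sqrt (2 * pi) / \<epsilon> * exp (- ((z / \<epsilon>)\<^sup>2 / 2)))"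
    and "integrable lborel (\<lambda>u. exp (- ((\<epsilon> * u)\<^sup>2 / 2)))"
proof -
  define c where "c = \<epsilon>\<^sup>2 / (2 * pi)"
  have c: "c > 0" "c * pi = \<epsilon>\<^sup>2 / 2" using assms by (auto simp: c_def)
  have cx: "c * (pi * u\<^sup>2) = (\<epsilon> * u)\<^sup>2 / 2" for u
    using c(2) by (simp add: power_mult_distrib flip: mult.assoc)
  show "integrable lborel (\<lambda>u. exp (- ((\<epsilon> * u)\<^sup>2 / 2)))"
    using gaussian_fourier_real(1)[OF c(1)] cx by simp
  define \<xi> where "\<xi> = - z / (2 * pi)"
  have "exp (\<i> * of_real (z * u)) * of_real (exp (- ((\<epsilon> * u)\<^sup>2 / 2))) =
      exp (- 2 * pi * \<i> * \<xi> * of_real u) * exp (- complex_of_real c * of_real (pi * u\<^sup>2))" for u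
  proof -
    have "complex_of_real (exp (- ((\<epsilon> * u)\<^sup>2 / 2))) = exp (- complex_of_real c * of_real (pi * u\<^sup>2))"
      unfolding exp_of_real[symmetric] cx[symmetric] by simp
    moreover have "\<i> * complex_of_real (z * u) = - 2 * pi * \<i> * \<xi> * of_real u"
      by (simp add: \<xi>_def)
    ultimately show ?thesis by simp
  qed
  then have "(LINT u|lborel. exp (\<i> * of_real (z * u)) * of_real (exp (- ((\<epsilon> * u)\<^sup>2 / 2))))
     = of_real (exp (- pi * \<xi>\<^sup>2 / c) / sqrt c)"
    using gaussian_fourier_real(2)[OF c(1), of \<xi>] by simp
  also have "- pi * \<xi>\<^sup>2 / c = - ((z / \<epsilon>)\<^sup>2 / 2)"
    using assms by (simp add: \<xi>_def c_def power2_eq_square field_simps)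
  also have "exp (- ((z / \<epsilon>)\<^sup>2 / 2)) / sqrt c = sqrt (2 * pi) / \<epsilon> * exp (- ((z / \<epsilon>)\<^sup>2 / 2))"
    using assms by (simp add: c_def real_sqrt_divide)
  finally show "(LINT u|lborel. exp (\<i> * of_real (z * u)) * of_real (exp (- ((\<epsilon> * u)\<^sup>2 / 2))))
     = of_real (sqrt (2 * pi) / \<epsilon> * exp (- ((z / \<epsilon>)\<^sup>2 / 2)))" .
qed

text \<open>Fourier inversion for the Gamma density, by Gaussian regularisation.\<close>

lemma inverse_laplace_gamma:
  fixes k x :: real
  assumes k: "k \<ge> 2" and x: "x > 0"
  shows "(LINT u|lborel. (1 + \<i> * of_real u) powr (- of_real k) * exp (of_real x * (1 + \<i> * of_real u)))
     = of_real (2 * pi * x powr (k - 1) / Gamma k)"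
proof -
  define \<phi> where "\<phi> = (\<lambda>u. (1 + \<i> * complex_of_real u) powr (- complex_of_real k))"
  define g where "g = (\<lambda>t::real. indicator {0<..} t * t powr (k - 1) * exp (- t))"
  have [measurable]: "\<phi> \<in> borel_measurable borel" unfolding \<phi>_def by measurable
  have [measurable]: "g \<in> borel_measurable borel" unfolding g_def by measurable
  have Gk: "Gamma k > 0" using k by (intro Gamma_real_pos) auto
  have g_int: "integrable lborel g"
    using powr_exp_integrable(1)[of k 1] k by (simp add: g_def)
  have g_nonneg: "g t \<ge> 0" for t by (simp add: g_def)
  have g_bound: "\<bar>g t\<bar> \<le> max 1 (k - 1) powr (k - 1)" for t
    using powr_mult_exp_le[of k t] k by (auto simp: g_def indicator_def)
  have g_cont: "isCont g x"
  proof -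
    have "isCont (\<lambda>t. t powr (k - 1) * exp (- t)) x" using x by (intro continuous_intros) auto
    moreover have "eventually (\<lambda>t. t powr (k - 1) * exp (- t) = g t) (nhds x)"
      using eventually_nhds_in_open[of "{0<..}" x] x
      by (auto simp: g_def elim!: eventually_mono)
    ultimately show ?thesis by (simp add: isCont_cong)
  qed
  have phi_int: "integrable lborel (\<lambda>u. norm (\<phi> u))"
    by (rule Bochner_Integration.integrable_bound[OF integrable_inverse_1_plus_sq])
       (use norm_inverse_laplace_kernel[OF k] in \<open>auto simp: \<phi>_def\<close>)
  have laplace: "of_real (Gamma k) * \<phi> u = (LINT t|lborel. of_real (g t) * exp (- \<i> * of_real (u * t)))" for u
  proof -
    have "of_real (Gamma k) * \<phi> u = (LINT t|lborel. of_real (indicator {0<..} t * t powr (k - 1)) * exp (- (1 + \<i> * of_real u) * of_real t))"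
      unfolding \<phi>_def using k by (subst gamma_laplace) auto
    also have "\<dots> = (LINT t|lborel. of_real (g t) * exp (- \<i> * of_real (u * t)))"
    proof (rule Bochner_Integration.integral_cong[OF refl])
      fix t
      have "- (1 + \<i> * complex_of_real u) * of_real t = of_real (- t) + - \<i> * of_real (u * t)"
        by (simp add: algebra_simps)
      then show "of_real (indicator {0<..} t * t powr (k - 1)) * exp (- (1 + \<i> * of_real u) * of_real t) = of_real (g t) * exp (- \<i> * of_real (u * t))"
        by (simp only: exp_add exp_of_real g_def of_real_mult mult.assoc)
    qed
    finally show ?thesis .
  qed
  define I where "I = (\<lambda>\<epsilon>. LINT u|lborel. \<phi> u * exp (\<i> * of_real (x * u)) * of_real (exp (- ((\<epsilon> * u)\<^sup>2 / 2))))"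
  \<comment> \<open>Without the damping the double integral over \<open>t\<close> and
    \<open>u\<close> does not converge absolutely. With it Fubini applies, and the integral over
    \<open>u\<close> becomes a Gaussian in \<open>t\<close> of width \<open>\<epsilon>\<close>
    centred at \<open>x\<close>, an approximate identity acting on \<open>g\<close>.\<close>
  have I_eq: "of_real (Gamma k) * I \<epsilon> = of_real (2 * pi * (LINT v|lborel. g (x + \<epsilon> * v) * std_normal_density v))"
    if \<epsilon>: "\<epsilon> > 0" for \<epsilon> :: real
  proof -
    define h where "h = (\<lambda>u t. complex_of_real (g t) * exp (- \<i> * of_real (u * t)) * (exp (\<i> * of_real (x * u)) * of_real (exp (- ((\<epsilon> * u)\<^sup>2 / 2)))))"
    have nh: "norm (h u t) = g t * exp (- ((\<epsilon> * u)\<^sup>2 / 2))" for u t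
      using g_nonneg[of t] by (simp add: h_def norm_mult)
    have [measurable]: "case_prod h \<in> borel_measurable (lborel \<Otimes>\<^sub>M lborel)"
      unfolding h_def by measurable
    have hint: "integrable (lborel \<Otimes>\<^sub>M lborel) (case_prod h)"
    proof (rule lborel_pair.Fubini_integrable)
      show "integrable lborel (\<lambda>u. LINT t|lborel. norm (case_prod h (u, t)))"
        using gaussian_dual(2)[OF \<epsilon>] by (simp add: nh)
      show "AE u in lborel. integrable lborel (\<lambda>t. case_prod h (u, t))"
      proof (rule AE_I2)
        fix u
        show "integrable lborel (\<lambda>t. case_prod h (u, t))"
          by (rule Bochner_Integration.integrable_bound[OF integrable_mult_left[OF g_int, of "exp (- ((\<epsilon> * u)\<^sup>2 / 2))"]])
             (use g_nonneg in \<open>auto simp: nh h_def[symmetric] intro!: AE_I2\<close>)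
      qed
    qed measurable
    have "of_real (Gamma k) * I \<epsilon> = (LINT u|lborel. (of_real (Gamma k) * \<phi> u) * (exp (\<i> * of_real (x * u)) * of_real (exp (- ((\<epsilon> * u)\<^sup>2 / 2)))))"
      unfolding I_def integral_mult_right_zero[symmetric] by (simp only: mult.assoc)
    also have "\<dots> = (LINT u|lborel. LINT t|lborel. h u t)"
      unfolding laplace h_def by simp
    also have "\<dots> = (LINT t|lborel. LINT u|lborel. h u t)"
      by (rule lborel_pair.Fubini_integral[symmetric, OF hint])
    also have "\<dots> = (LINT t|lborel. of_real (g t * (sqrt (2 * pi) / \<epsilon> * exp (- (((x - t) / \<epsilon>)\<^sup>2 / 2)))))"
    proof (rule Bochner_Integration.integral_cong[OF refl])
      fix t
      have "(LINT u|lborel. h u t) = (LINT u|lborel. of_real (g t) * (exp (\<i> * of_real ((x - t) * u)) * of_real (exp (- ((\<epsilon> * u)\<^sup>2 / 2)))))"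
      proof (rule Bochner_Integration.integral_cong[OF refl])
        fix u
        have "\<i> * complex_of_real ((x - t) * u) = - \<i> * of_real (u * t) + \<i> * of_real (x * u)"
          by (simp add: algebra_simps)
        then show "h u t = of_real (g t) * (exp (\<i> * of_real ((x - t) * u)) * of_real (exp (- ((\<epsilon> * u)\<^sup>2 / 2))))"
          unfolding h_def by (simp only: exp_add mult.assoc)
      qed
      then show "(LINT u|lborel. h u t) = of_real (g t * (sqrt (2 * pi) / \<epsilon> * exp (- (((x - t) / \<epsilon>)\<^sup>2 / 2))))"
        unfolding integral_mult_right_zero gaussian_dual(1)[OF \<epsilon>] by simp
    qed
    also have "\<dots> = of_real (LINT t|lborel. g t * (sqrt (2 * pi) / \<epsilon> * exp (- (((x - t) / \<epsilon>)\<^sup>2 / 2))))"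
      by (rule integral_complex_of_real)
    also have "(LINT t|lborel. g t * (sqrt (2 * pi) / \<epsilon> * exp (- (((x - t) / \<epsilon>)\<^sup>2 / 2)))) =
       \<epsilon> * (LINT v|lborel. g (x + \<epsilon> * v) * (sqrt (2 * pi) / \<epsilon> * exp (- (((x - (x + \<epsilon> * v)) / \<epsilon>)\<^sup>2 / 2))))"
      using \<epsilon> by (subst lborel_integral_real_affine[where c=\<epsilon> and t=x]) auto
    also have "\<dots> = (LINT v|lborel. 2 * pi * (g (x + \<epsilon> * v) * std_normal_density v))"
    proof -
      define S where "S = sqrt (2 * pi)"
      have S: "S > 0" "2 * pi = S * S" by (simp_all add: S_def)
      have "\<epsilon> * (G * (S / \<epsilon> * E)) = S * S * (G * (1 / S * E))" for G E
        using \<epsilon> S(1) by simp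
      then have "\<epsilon> * (g (x + \<epsilon> * v) * (sqrt (2 * pi) / \<epsilon> * exp (- (((x - (x + \<epsilon> * v)) / \<epsilon>)\<^sup>2 / 2)))) = 2 * pi * (g (x + \<epsilon> * v) * std_normal_density v)" for v
        using \<epsilon> S(1) unfolding std_normal_density_def S(2) S_def[symmetric] by simp
      then show ?thesis unfolding integral_mult_right_zero[symmetric] by simp
    qed
    also have "\<dots> = 2 * pi * (LINT v|lborel. g (x + \<epsilon> * v) * std_normal_density v)"
      by (rule integral_mult_right_zero)
    finally show ?thesis .
  qed
  define e where "e = (\<lambda>n. 1 / real (Suc n))"
  have e: "e \<longlonglongrightarrow> 0" "e n > 0" for n
    unfolding e_def using LIMSEQ_Suc[OF lim_1_over_n[where ?'a=real]] by auto
  have 1: "(\<lambda>n. I (e n)) \<longlonglongrightarrow> (LINT u|lborel. \<phi> u * exp (\<i> * of_real (x * u)))"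
    unfolding I_def
  proof (rule integral_dominated_convergence[where w="\<lambda>u. norm (\<phi> u)"])
    show "AE u in lborel. (\<lambda>n. \<phi> u * exp (\<i> * of_real (x * u)) * of_real (exp (- ((e n * u)\<^sup>2 / 2)))) \<longlonglongrightarrow> \<phi> u * exp (\<i> * of_real (x * u))"
    proof (rule AE_I2)
      fix u
      have "(\<lambda>n. \<phi> u * exp (\<i> * of_real (x * u)) * of_real (exp (- ((e n * u)\<^sup>2 / 2)))) \<longlonglongrightarrow> \<phi> u * exp (\<i> * of_real (x * u)) * of_real (exp (- ((0 * u)\<^sup>2 / 2)))"
        by (intro tendsto_intros e) auto
      then show "(\<lambda>n. \<phi> u * exp (\<i> * of_real (x * u)) * of_real (exp (- ((e n * u)\<^sup>2 / 2)))) \<longlonglongrightarrow> \<phi> u * exp (\<i> * of_real (x * u))" by simp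
    qed
    show "AE u in lborel. norm (\<phi> u * exp (\<i> * of_real (x * u)) * of_real (exp (- ((e n * u)\<^sup>2 / 2)))) \<le> norm (\<phi> u)" for n
      by (rule AE_I2) (simp add: norm_mult mult_left_le)
  qed (use phi_int in auto)
  \<comment> \<open>After the substitution \<open>t = x + \<epsilon> * v\<close> the Gaussian is
    fixed and only the argument of \<open>g\<close> moves, so continuity at the single point
    \<open>x\<close> and boundedness suffice.\<close>
  have 2: "(\<lambda>n. LINT v|lborel. g (x + e n * v) * std_normal_density v) \<longlonglongrightarrow> (LINT v|lborel. g x * std_normal_density v)"
  proof (rule integral_dominated_convergence[where w="\<lambda>v. max 1 (k - 1) powr (k - 1) * std_normal_density v"])
    show "AE v in lborel. (\<lambda>n. g (x + e n * v) * std_normal_density v) \<longlonglongrightarrow> g x * std_normal_density v"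
    proof (rule AE_I2)
      fix v
      have "(\<lambda>n. x + e n * v) \<longlonglongrightarrow> x + 0 * v" by (intro tendsto_intros e)
      then have "(\<lambda>n. g (x + e n * v)) \<longlonglongrightarrow> g x" by (intro isCont_tendsto_compose[OF g_cont]) simp
      then show "(\<lambda>n. g (x + e n * v) * std_normal_density v) \<longlonglongrightarrow> g x * std_normal_density v"
        by (intro tendsto_intros)
    qed
    show "AE v in lborel. norm (g (x + e n * v) * std_normal_density v) \<le> max 1 (k - 1) powr (k - 1) * std_normal_density v" for n
      using g_bound by (intro AE_I2) (auto simp: abs_mult normal_density_nonneg intro!: mult_right_mono)
  qed (auto intro!: integrable_normal_density)
  have "(LINT v|lborel. std_normal_density v) = 1" by (intro integral_normal_density) auto
  then have "(LINT v|lborel. g x * std_normal_density v) = g x" by simp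
  with 2 have "(\<lambda>n. LINT v|lborel. g (x + e n * v) * std_normal_density v) \<longlonglongrightarrow> g x" by simp
  then have "(\<lambda>n. complex_of_real (2 * pi * (LINT v|lborel. g (x + e n * v) * std_normal_density v))) \<longlonglongrightarrow> of_real (2 * pi * g x)"
    by (intro tendsto_intros)
  then have "(\<lambda>n. of_real (Gamma k) * I (e n)) \<longlonglongrightarrow> of_real (2 * pi * g x)"
    by (simp only: I_eq[OF e(2)])
  moreover have "(\<lambda>n. of_real (Gamma k) * I (e n)) \<longlonglongrightarrow> of_real (Gamma k) * (LINT u|lborel. \<phi> u * exp (\<i> * of_real (x * u)))"
    by (intro tendsto_intros 1)
  ultimately have eq: "of_real (Gamma k) * (LINT u|lborel. \<phi> u * exp (\<i> * of_real (x * u))) = of_real (2 * pi * g x)"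
    by (metis LIMSEQ_unique)
  have "(LINT u|lborel. \<phi> u * exp (of_real x * (1 + \<i> * of_real u))) = (LINT u|lborel. of_real (exp x) * (\<phi> u * exp (\<i> * of_real (x * u))))"
    by (rule Bochner_Integration.integral_cong) (auto simp: distrib_left exp_add exp_of_real[symmetric] mult_ac)
  also have "\<dots> = of_real (exp x) * (LINT u|lborel. \<phi> u * exp (\<i> * of_real (x * u)))"
    by (rule integral_mult_right_zero)
  also have "\<dots> = of_real (exp x) * of_real (2 * pi * g x) / of_real (Gamma k)"
    using eq Gk by (simp add: field_simps)
  also have "\<dots> = of_real (2 * pi * x powr (k - 1) / Gamma k)"
    using x by (simp add: g_def exp_minus field_simps flip: exp_of_real)
  finally show ?thesis by (simp add: \<phi>_def)
qed

section \<open>Fourier uniqueness and theta inversion\<close>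

text \<open>By \<open>exp (- t) \<le> 1 / (1 + t)\<close> each term is at most the least value, on
  the unit interval ending in \<open>k\<close>, of the derivative of
  \<open>arctan (sqrt \<alpha> * x) / sqrt \<alpha>\<close>; hence the sum telescopes. The bound has
  no additive constant: it is of order \<open>1 / sqrt \<alpha>\<close> for large
  \<open>\<alpha>\<close> as well as for small, which the theta error relies on.\<close>

lemma gauss_sum_le:
  fixes \<alpha> :: real
  assumes \<alpha>: "\<alpha> > 0"
  shows "(\<Sum>k=1..N. exp (- \<alpha> * (real k)\<^sup>2)) \<le> arctan (sqrt \<alpha> * real N) / sqrt \<alpha>"
proof (induction N)
  case (Suc N)
  define b where "b = sqrt \<alpha>"
  have b: "b > 0" "b\<^sup>2 = \<alpha>" using \<alpha> by (auto simp: b_def)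
  have step: "exp (- \<alpha> * (real (Suc N))\<^sup>2) \<le> arctan (b * real (Suc N)) / b - arctan (b * real N) / b"
  proof -
    have "\<exists>z>real N. z < real (Suc N) \<and> arctan (b * real (Suc N)) - arctan (b * real N) = (real (Suc N) - real N) * (b / (1 + (b * z)\<^sup>2))"
      by (rule MVT2) (auto intro!: derivative_eq_intros simp: field_simps)
    then obtain z where z: "z > real N" "z < real (Suc N)" "arctan (b * real (Suc N)) - arctan (b * real N) = b / (1 + (b * z)\<^sup>2)"
      by auto
    have "(b * z)\<^sup>2 \<le> (b * real (Suc N))\<^sup>2"
      using z b by (intro power_mono mult_left_mono) auto
    then have le: "(b * z)\<^sup>2 \<le> \<alpha> * (real (Suc N))\<^sup>2" by (simp add: power_mult_distrib b(2))
    have "exp (- \<alpha> * (real (Suc N))\<^sup>2) = 1 / exp (\<alpha> * (real (Suc N))\<^sup>2)" by (simp add: exp_minus field_simps)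
    also have "\<dots> \<le> 1 / (1 + (b * z)\<^sup>2)"
    proof (rule divide_left_mono)
      show "1 + (b * z)\<^sup>2 \<le> exp (\<alpha> * (real (Suc N))\<^sup>2)"
        using le exp_ge_add_one_self[of "\<alpha> * (real (Suc N))\<^sup>2"] by linarith
    qed (auto intro!: mult_pos_pos add_pos_nonneg)
    also have "\<dots> = (arctan (b * real (Suc N)) - arctan (b * real N)) / b" using b z by simp
    finally show ?thesis by (simp add: diff_divide_distrib)
  qed
  have "(\<Sum>k=1..Suc N. exp (- \<alpha> * (real k)\<^sup>2)) = (\<Sum>k=1..N. exp (- \<alpha> * (real k)\<^sup>2)) + exp (- \<alpha> * (real (Suc N))\<^sup>2)"
    by simp
  also have "\<dots> \<le> arctan (b * real N) / b + (arctan (b * real (Suc N)) / b - arctan (b * real N) / b)"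
    using Suc step unfolding b_def by (rule add_mono)
  finally show ?case by (simp add: b_def)
qed simp

lemma gauss_sum_int_le:
  fixes \<alpha> :: real
  assumes \<alpha>: "\<alpha> > 0" and A: "finite A" "0 \<notin> A"
  shows "(\<Sum>k\<in>A. exp (- \<alpha> * (real_of_int k)\<^sup>2)) \<le> pi / sqrt \<alpha>"
proof -
  define N where "N = nat (Max (insert 0 (abs ` A)))"
  have "\<bar>k\<bar> \<le> int N" if "k \<in> A" for k
    using A that by (auto simp: N_def intro!: Max_ge)
  then have "A \<subseteq> int ` {1..N} \<union> (\<lambda>k. - int k) ` {1..N}"
  proof (intro subsetI)
    fix k assume k: "k \<in> A" and *: "\<And>k. k \<in> A \<Longrightarrow> \<bar>k\<bar> \<le> int N"
    have "k \<noteq> 0" using A k by auto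
    show "k \<in> int ` {1..N} \<union> (\<lambda>k. - int k) ` {1..N}"
    proof (cases "k > 0")
      case True
      then have "k = int (nat k)" "nat k \<in> {1..N}" using *[OF k] by auto
      then show ?thesis by blast
    next
      case False
      then have "k = - int (nat (-k))" "nat (-k) \<in> {1..N}" using *[OF k] \<open>k \<noteq> 0\<close> by auto
      then show ?thesis by blast
    qed
  qed
  then have "(\<Sum>k\<in>A. exp (- \<alpha> * (real_of_int k)\<^sup>2)) \<le> (\<Sum>k\<in>int ` {1..N} \<union> (\<lambda>k. - int k) ` {1..N}. exp (- \<alpha> * (real_of_int k)\<^sup>2))"
    by (intro sum_mono2) auto
  also have "\<dots> \<le> (\<Sum>k\<in>int ` {1..N}. exp (- \<alpha> * (real_of_int k)\<^sup>2)) + (\<Sum>k\<in>(\<lambda>k. - int k) ` {1..N}. exp (- \<alpha> * (real_of_int k)\<^sup>2))"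
    by (subst sum.union_disjoint) auto
  also have "(\<Sum>k\<in>int ` {1..N}. exp (- \<alpha> * (real_of_int k)\<^sup>2)) = (\<Sum>k=1..N. exp (- \<alpha> * (real k)\<^sup>2))"
    by (subst sum.reindex) (auto simp: inj_on_def)
  also have "(\<Sum>k\<in>(\<lambda>k. - int k) ` {1..N}. exp (- \<alpha> * (real_of_int k)\<^sup>2)) = (\<Sum>k=1..N. exp (- \<alpha> * (real k)\<^sup>2))"
    by (subst sum.reindex) (auto simp: inj_on_def)
  also have "(\<Sum>k=1..N. exp (- \<alpha> * (real k)\<^sup>2)) + (\<Sum>k=1..N. exp (- \<alpha> * (real k)\<^sup>2)) \<le> pi / sqrt \<alpha>"
  proof -
    have "(\<Sum>k=1..N. exp (- \<alpha> * (real k)\<^sup>2)) \<le> arctan (sqrt \<alpha> * real N) / sqrt \<alpha>" by (rule gauss_sum_le[OF \<alpha>])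
    also have "\<dots> \<le> (pi / 2) / sqrt \<alpha>"
      using arctan_ubound[of "sqrt \<alpha> * real N"] \<alpha> by (intro divide_right_mono) auto
    finally show ?thesis using \<alpha> by (simp add: field_simps)
  qed
  finally show ?thesis .
qed

lemma gauss_summable_nonzero:
  fixes \<alpha> :: real
  assumes "\<alpha> > 0"
  shows "(\<lambda>k::int. exp (- \<alpha> * (real_of_int k)\<^sup>2)) summable_on (UNIV - {0})"
    and "(\<Sum>\<^sub>\<infinity>k\<in>UNIV - {0::int}. exp (- \<alpha> * (real_of_int k)\<^sup>2)) \<le> pi / sqrt \<alpha>"
proof -
  show s: "(\<lambda>k::int. exp (- \<alpha> * (real_of_int k)\<^sup>2)) summable_on (UNIV - {0})"
    by (rule nonneg_bdd_above_summable_on) (use gauss_sum_int_le[OF assms] in \<open>auto intro!: bdd_aboveI2\<close>)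
  show "(\<Sum>\<^sub>\<infinity>k\<in>UNIV - {0::int}. exp (- \<alpha> * (real_of_int k)\<^sup>2)) \<le> pi / sqrt \<alpha>"
    by (rule infsum_le_finite_sums[OF s]) (use gauss_sum_int_le[OF assms] in auto)
qed

lemma gauss_summable:
  fixes \<alpha> :: real
  assumes "\<alpha> > 0"
  shows "(\<lambda>k::int. exp (- \<alpha> * (real_of_int k)\<^sup>2)) summable_on UNIV"
proof -
  have "(\<lambda>k::int. exp (- \<alpha> * (real_of_int k)\<^sup>2)) summable_on insert 0 (UNIV - {0})"
    using gauss_summable_nonzero(1)[OF assms] by (simp only: summable_on_insert_iff)
  then show ?thesis by (simp add: insert_Diff_if)
qed

lemma gauss_shift_bound:
  fixes c x n :: real
  assumes "c \<ge> 0"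
  shows "exp (- c * (x + n)\<^sup>2) \<le> exp (c * x\<^sup>2) * exp (- (c / 2) * n\<^sup>2)"
proof -
  have "n\<^sup>2 \<le> 2 * (x + n)\<^sup>2 + 2 * x\<^sup>2"
    using zero_le_power2[of "2 * x + n"] by (simp add: power2_eq_square algebra_simps)
  then have "c * n\<^sup>2 \<le> c * (2 * (x + n)\<^sup>2 + 2 * x\<^sup>2)" using assms by (rule mult_left_mono)
  then show ?thesis by (simp add: algebra_simps flip: exp_add)
qed

lemma gauss_shift_summable:
  fixes c x :: real
  assumes "c > 0"
  shows "(\<lambda>n::int. exp (- c * (x + of_int n)\<^sup>2)) summable_on UNIV"
  using gauss_shift_bound[of c x] assms
  by (intro summable_on_comparison_test[OF summable_on_cmult_right[OF gauss_summable[of "c/2"]], of _ "exp (c * x\<^sup>2)"]) auto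

text \<open>Turns unconditional sums over the integers into limits over growing intervals: the
  half-open ones tile the line by unit intervals, the closed ones truncate theta series.\<close>

lemma filterlim_int_intervals:
  "filterlim (\<lambda>N. {- int N..<int N}) (finite_subsets_at_top UNIV) sequentially"
  "filterlim (\<lambda>N. {- int N..int N}) (finite_subsets_at_top UNIV) sequentially"
proof -
  have "eventually (\<lambda>N. X \<subseteq> {- int N..<int N}) sequentially" if X: "finite X" for X :: "int set"
  proof (rule eventually_sequentiallyI)
    fix N assume N: "N \<ge> nat (Max (insert 0 (abs ` X))) + 1"
    have "\<bar>k\<bar> \<le> Max (insert 0 (abs ` X))" if "k \<in> X" for k using X that by (intro Max_ge) auto
    then show "X \<subseteq> {- int N..<int N}" using N by fastforce
  qed
  then have ev: "eventually (\<lambda>N. X \<subseteq> {- int N..<int N}) sequentially" if "finite X" for X :: "int set" using that .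
  then show "filterlim (\<lambda>N. {- int N..<int N}) (finite_subsets_at_top UNIV) sequentially"
    unfolding filterlim_finite_subsets_at_top by auto
  have "eventually (\<lambda>N. X \<subseteq> {- int N..int N}) sequentially" if "finite X" for X :: "int set"
    using ev[OF that] by eventually_elim auto
  then show "filterlim (\<lambda>N. {- int N..int N}) (finite_subsets_at_top UNIV) sequentially"
    unfolding filterlim_finite_subsets_at_top by auto
qed

section \<open>Fourier coefficients determine a continuous periodic function\<close>

definition cis2pi :: "real \<Rightarrow> complex" where "cis2pi x = exp (2 * pi * \<i> * of_real x)"

lemma cis2pi_add: "cis2pi (x + y) = cis2pi x * cis2pi y"
  by (simp add: cis2pi_def distrib_left exp_add)

lemma norm_cis2pi [simp]: "norm (cis2pi x) = 1"
  by (simp add: cis2pi_def)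

lemma cis2pi_int [simp]: "cis2pi (of_int n) = 1"
  using exp_integer_2pi[of "of_int n"] by (simp add: cis2pi_def mult_ac)

lemma cis2pi_0 [simp]: "cis2pi 0 = 1" by (simp add: cis2pi_def)

lemma continuous_on_cis2pi [continuous_intros]:
  "continuous_on A f \<Longrightarrow> continuous_on A (\<lambda>x. cis2pi (f x))"
  unfolding cis2pi_def by (intro continuous_intros)

lemma cis2pi_conv_cis: "cis2pi x = cis (2 * pi * x)"
  by (simp add: cis2pi_def cis_conv_exp mult_ac)

lemma cis2pi_eq_iff: "cis2pi x = cis2pi y \<longleftrightarrow> (\<exists>n::int. x = y + of_int n)"
proof
  assume "cis2pi x = cis2pi y"
  then obtain n :: int where "2 * pi * \<i> * of_real x = 2 * pi * \<i> * of_real y + (of_int (2 * n) * pi) * \<i>"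
    unfolding cis2pi_def exp_eq by blast
  then have "2 * pi * x = 2 * pi * y + of_int (2 * n) * pi" by (auto simp: complex_eq_iff)
  then have "pi * (2 * (x - y - of_int n)) = 0" by (simp add: algebra_simps)
  then have "x = y + of_int n" by simp
  then show "\<exists>n::int. x = y + of_int n" ..
next
  assume "\<exists>n::int. x = y + of_int n"
  then show "cis2pi x = cis2pi y" by (auto simp: cis2pi_add)
qed

lemma integral_cis2pi: "integral {0..1} (\<lambda>x. cis2pi (of_int k * x)) = (if k = 0 then 1 else 0)"
proof (cases "k = 0")
  case False
  have "((\<lambda>x. cis2pi (of_int k * x)) has_integral (cis2pi (of_int k * 1) / (2 * pi * \<i> * of_int k) - cis2pi (of_int k * 0) / (2 * pi * \<i> * of_int k))) {0..1}"
    by (rule fundamental_theorem_of_calculus)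
       (use False in \<open>auto simp: cis2pi_def has_real_derivative_iff_has_vector_derivative[symmetric] intro!: derivative_eq_intros has_vector_derivative_real_field\<close>)
  then show ?thesis using False cis2pi_int[of k] by (simp add: has_integral_iff)
qed simp

lemma periodic_int:
  fixes H :: "real \<Rightarrow> 'a"
  assumes "\<And>x. H (x + 1) = H x"
  shows "H (x + of_int n) = H x"
proof -
  have nat: "H (x + real n) = H x" for x n
  proof (induction n)
    case (Suc n)
    have "H (x + real (Suc n)) = H ((x + real n) + 1)" by (simp add: add_ac)
    then show ?case using assms Suc by simp
  qed simp
  show ?thesis
  proof (cases n)
    case (nonneg m) then show ?thesis using nat[of x m] by simp
  next
    case (neg m)
    have "H (x + of_int n + real (Suc m)) = H (x + of_int n)" by (rule nat)
    then show ?thesis using neg by simp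
  qed
qed

text \<open>All integers \<open>k\<close> are tested, so the sign in the exponent is immaterial.
  Periodicity of \<open>h\<close> is left out, since it plays no part in stability under products;
  it is added where the property is exploited.\<close>

definition fourier_null :: "(real \<Rightarrow> complex) \<Rightarrow> bool" where
  "fourier_null h \<longleftrightarrow> continuous_on UNIV h \<and> (\<forall>k::int. integral {0..1} (\<lambda>x. h x * cis2pi (of_int k * x)) = 0)"

text \<open>On the unit circle a real-linear functional is
  \<open>a * cis2pi x + b * cis2pi (- x)\<close>, so multiplying by it merely shifts frequencies by
  one in both directions; products are handled by iteration, for which \<open>h\<close> must stay
  arbitrary. Real polynomial functions are the class in which the Stone-Weierstrass theorem supplies
  approximations.\<close>

lemma fourier_null_mult_polynomial:
  fixes g :: "complex \<Rightarrow> real"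
  assumes "real_polynomial_function g" "fourier_null h"
  shows "fourier_null (\<lambda>x. h x * of_real (g (cis2pi x)))"
  using assms
proof (induction arbitrary: h rule: real_polynomial_function.induct)
  case (linear g)
  then interpret g: bounded_linear g by simp
  have cont: "continuous_on UNIV h" and zero: "\<And>k::int. integral {0..1} (\<lambda>x. h x * cis2pi (of_int k * x)) = 0"
    using linear by (auto simp: fourier_null_def)
  define a where "a = (complex_of_real (g 1) - \<i> * of_real (g \<i>)) / 2"
  define b where "b = (complex_of_real (g 1) + \<i> * of_real (g \<i>)) / 2"
  have gz: "g z = Re z * g 1 + Im z * g \<i>" for z
  proof -
    have "z = Re z *\<^sub>R 1 + Im z *\<^sub>R \<i>" by (simp add: complex_eq_iff)
    then have "g z = g (Re z *\<^sub>R 1 + Im z *\<^sub>R \<i>)" by simp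
    then show ?thesis by (simp only: g.add g.scaleR) simp
  qed
  have gE: "of_real (g (cis2pi x)) = a * cis2pi x + b * cis2pi (- x)" for x
    unfolding gz[of "cis2pi x"] by (simp add: cis2pi_conv_cis a_def b_def complex_eq_iff field_simps)
  have cts: "continuous_on UNIV (\<lambda>x. complex_of_real (g (cis2pi x)))"
    unfolding gE by (intro continuous_intros)
  show ?case unfolding fourier_null_def
  proof (intro conjI allI)
    show "continuous_on UNIV (\<lambda>x. h x * of_real (g (cis2pi x)))" by (rule continuous_on_mult[OF cont cts])
    fix k :: int
    have "(\<lambda>x. h x * of_real (g (cis2pi x)) * cis2pi (of_int k * x)) =
       (\<lambda>x. a * (h x * cis2pi (of_int (k + 1) * x)) + b * (h x * cis2pi (of_int (k - 1) * x)))"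
    proof
      fix x
      have "cis2pi (of_int (k + 1) * x) = cis2pi (of_int k * x) * cis2pi x" "cis2pi (of_int (k - 1) * x) = cis2pi (of_int k * x) * cis2pi (- x)"
        by (simp_all add: algebra_simps flip: cis2pi_add)
      then show "h x * of_real (g (cis2pi x)) * cis2pi (of_int k * x) = a * (h x * cis2pi (of_int (k + 1) * x)) + b * (h x * cis2pi (of_int (k - 1) * x))"
        by (simp add: gE algebra_simps)
    qed
    moreover have "(\<lambda>x. h x * cis2pi (of_int m * x)) integrable_on {0..1}" for m :: int
      by (intro integrable_continuous_interval continuous_intros continuous_on_subset[OF cont]) auto
    ultimately show "integral {0..1} (\<lambda>x. h x * of_real (g (cis2pi x)) * cis2pi (of_int k * x)) = 0"
      by (simp add: integral_add integrable_on_cmult_left integrable_on_mult_right zero del: of_int_add of_int_diff)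
  qed
next
  case (const c)
  show ?case using const unfolding fourier_null_def
    by (auto intro!: continuous_intros simp: mult.assoc mult.left_commute[of _ "of_real c"])
next
  case (add f g)
  have f: "fourier_null (\<lambda>x. h x * of_real (f (cis2pi x)))" and g: "fourier_null (\<lambda>x. h x * of_real (g (cis2pi x)))"
    using add by auto
  have int: "(\<lambda>x. k x * cis2pi (of_int m * x)) integrable_on {0..1}" if "fourier_null k" for k and m :: int
    using that unfolding fourier_null_def
    by (intro integrable_continuous_interval continuous_intros) (auto intro: continuous_on_subset)
  have eq: "(\<lambda>x. h x * of_real (f (cis2pi x) + g (cis2pi x))) = (\<lambda>x. h x * of_real (f (cis2pi x)) + h x * of_real (g (cis2pi x)))"
    by (simp add: distrib_left)
  show ?case unfolding eq using f g int[OF f] int[OF g]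
    unfolding fourier_null_def by (auto intro!: continuous_intros simp: distrib_right integral_add)
next
  case (mult f g)
  then have "fourier_null (\<lambda>x. h x * of_real (f (cis2pi x)) * of_real (g (cis2pi x)))" by auto
  then show ?case by (simp add: mult.assoc)
qed

text \<open>The obstacle is the jump of the argument on the negative axis. There the lift is
  rewritten through \<open>Ln (- z)\<close>, which is continuous, and the half turn
  \<open>1 / 2\<close> makes both formulas agree by periodicity.\<close>

lemma periodic_circle_lift:
  fixes H :: "real \<Rightarrow> 'a::topological_space"
  assumes cont: "continuous_on UNIV H" and per: "\<And>x. H (x + 1) = H x"
  obtains f where "continuous_on (sphere 0 1) f" "\<And>x. f (cis2pi x) = H x"
proof -
  have H_eq: "H x = H y" if "cis2pi x = cis2pi y" for x y
    using that periodic_int[of H, OF per] by (auto simp: cis2pi_eq_iff)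
  define f where "f = (\<lambda>z. H (Im (Ln z) / (2 * pi)))"
  have arg: "cis2pi (Im (Ln z) / (2 * pi)) = sgn z" if "z \<noteq> 0" for z
    using that cis_Arg[of z] by (simp add: cis2pi_conv_cis Arg_def)
  have f1: "f (cis2pi x) = H x" for x
  proof -
    have "cis2pi x \<noteq> 0" by (simp add: cis2pi_def)
    moreover have "sgn (cis2pi x) = cis2pi x" by (simp add: sgn_eq)
    ultimately show ?thesis unfolding f_def by (intro H_eq) (simp add: arg)
  qed
  have half: "cis2pi (1 / 2) = -1" by (simp add: cis2pi_conv_cis)
  have f2: "f z = H (Im (Ln (- z)) / (2 * pi) + 1 / 2)" if "z \<noteq> 0" for z
    unfolding f_def by (intro H_eq) (use that in \<open>simp add: cis2pi_add half arg sgn_minus\<close>)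
  have "isCont f z" if "z \<noteq> 0" for z
  proof (cases "z \<in> \<real>\<^sub>\<le>\<^sub>0")
    case False
    have "continuous_on (- \<real>\<^sub>\<le>\<^sub>0) (\<lambda>z. H (Im (Ln z) / (2 * pi)))"
      by (rule continuous_on_compose2[OF cont]) (auto intro!: continuous_intros)
    then have "isCont (\<lambda>z. H (Im (Ln z) / (2 * pi))) z"
      using False by (subst (asm) continuous_on_eq_continuous_at) (auto simp: open_Compl)
    then show ?thesis by (simp add: f_def)
  next
    case True
    then have nz: "- z \<notin> \<real>\<^sub>\<le>\<^sub>0" using that by (auto simp: complex_nonpos_Reals_iff complex_eq_iff)
    have "continuous_on {z. - z \<notin> \<real>\<^sub>\<le>\<^sub>0} (\<lambda>z. H (Im (Ln (- z)) / (2 * pi) + 1 / 2))"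
      by (rule continuous_on_compose2[OF cont]) (auto intro!: continuous_intros)
    moreover have op: "open {z::complex. - z \<notin> \<real>\<^sub>\<le>\<^sub>0}"
    proof -
      have "open (uminus -` (- \<real>\<^sub>\<le>\<^sub>0 :: complex set))"
        by (rule open_vimage) (auto simp: open_Compl intro!: continuous_intros)
      then show ?thesis by (simp add: vimage_def)
    qed
    ultimately have "isCont (\<lambda>z. H (Im (Ln (- z)) / (2 * pi) + 1 / 2)) z"
      using nz by (subst (asm) continuous_on_eq_continuous_at) auto
    moreover have "eventually (\<lambda>w. H (Im (Ln (- w)) / (2 * pi) + 1 / 2) = f w) (nhds z)"
    proof (rule eventually_mono[OF eventually_nhds_in_open[OF op]])
      show "z \<in> {z. - z \<notin> \<real>\<^sub>\<le>\<^sub>0}" using nz by simp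
      fix w :: complex assume "w \<in> {z. - z \<notin> \<real>\<^sub>\<le>\<^sub>0}"
      then have "w \<noteq> 0" by auto
      then show "H (Im (Ln (- w)) / (2 * pi) + 1 / 2) = f w" using f2 by simp
    qed
    ultimately show ?thesis by (simp add: isCont_cong)
  qed
  moreover have "z \<noteq> 0" if "z \<in> sphere 0 1" for z :: complex using that by auto
  ultimately have "continuous_on (sphere 0 1) f"
    by (intro continuous_at_imp_continuous_on ballI) blast
  then show ?thesis using f1 that by blast
qed

text \<open>
  The product of \<open>H\<close> with a trigonometric polynomial again has vanishing mean, so \<open>H\<close> is orthogonal to
  uniform approximations of its own conjugate.
\<close>

lemma fourier_null_periodic_eq_0:
  fixes H :: "real \<Rightarrow> complex"
  assumes null: "fourier_null H" and per: "\<And>x. H (x + 1) = H x"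
  shows "H x = 0"
proof -
  have cont: "continuous_on UNIV H" using null by (simp add: fourier_null_def)
  then have cH: "continuous_on {0..1} H" by (rule continuous_on_subset) auto
  obtain f where f: "continuous_on (sphere 0 1) f" "\<And>x. f (cis2pi x) = H x"
    using periodic_circle_lift[OF cont per] by metis
  define M where "M = integral {0..1} (\<lambda>x. norm (H x))"
  define K where "K = integral {0..1} (\<lambda>x. (norm (H x))\<^sup>2)"
  have "M \<ge> 0" unfolding M_def by (intro integral_nonneg integrable_continuous_interval continuous_intros cH) auto
  have bound: "K \<le> 2 * e * M" if e: "e > 0" for e
  proof -
    obtain g1 where g1: "real_polynomial_function g1" "\<And>z. z \<in> sphere 0 1 \<Longrightarrow> \<bar>Re (f z) - g1 z\<bar> < e"
      using Stone_Weierstrass_real_polynomial_function[of "sphere 0 1" "\<lambda>z. Re (f z)" e] e f(1)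
      by (auto intro: continuous_intros)
    obtain g2 where g2: "real_polynomial_function g2" "\<And>z. z \<in> sphere 0 1 \<Longrightarrow> \<bar>Im (f z) - g2 z\<bar> < e"
      using Stone_Weierstrass_real_polynomial_function[of "sphere 0 1" "\<lambda>z. Im (f z)" e] e f(1)
      by (auto intro: continuous_intros)
    have n1: "fourier_null (\<lambda>x. H x * of_real (g1 (cis2pi x)))" by (rule fourier_null_mult_polynomial[OF g1(1) null])
    have n2: "fourier_null (\<lambda>x. H x * of_real (g2 (cis2pi x)))" by (rule fourier_null_mult_polynomial[OF g2(1) null])
    \<comment> \<open>\<open>P\<close> approximates the conjugate of \<open>H\<close>, whence the
      minus sign; the real and the imaginary part cost \<open>e\<close> each.\<close>
    define P where "P = (\<lambda>x. complex_of_real (g1 (cis2pi x)) - \<i> * of_real (g2 (cis2pi x)))"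
    have i1: "integral {0..1} (\<lambda>x. H x * of_real (g1 (cis2pi x))) = 0" and c1: "continuous_on {0..1} (\<lambda>x. H x * of_real (g1 (cis2pi x)))"
    proof -
      have "continuous_on UNIV (\<lambda>x. H x * of_real (g1 (cis2pi x)))" "integral {0..1} (\<lambda>x. H x * of_real (g1 (cis2pi x)) * cis2pi (of_int 0 * x)) = 0"
        using n1 unfolding fourier_null_def by blast+
      then show "integral {0..1} (\<lambda>x. H x * of_real (g1 (cis2pi x))) = 0" "continuous_on {0..1} (\<lambda>x. H x * of_real (g1 (cis2pi x)))"
        by (auto intro: continuous_on_subset)
    qed
    have i2: "integral {0..1} (\<lambda>x. H x * of_real (g2 (cis2pi x))) = 0" and c2: "continuous_on {0..1} (\<lambda>x. H x * of_real (g2 (cis2pi x)))"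
    proof -
      have "continuous_on UNIV (\<lambda>x. H x * of_real (g2 (cis2pi x)))" "integral {0..1} (\<lambda>x. H x * of_real (g2 (cis2pi x)) * cis2pi (of_int 0 * x)) = 0"
        using n2 unfolding fourier_null_def by blast+
      then show "integral {0..1} (\<lambda>x. H x * of_real (g2 (cis2pi x))) = 0" "continuous_on {0..1} (\<lambda>x. H x * of_real (g2 (cis2pi x)))"
        by (auto intro: continuous_on_subset)
    qed
    have HP: "(\<lambda>x. H x * P x) = (\<lambda>x. H x * of_real (g1 (cis2pi x)) - \<i> * (H x * of_real (g2 (cis2pi x))))"
      by (simp add: P_def algebra_simps)
    have cP: "continuous_on {0..1} (\<lambda>x. H x * P x)" unfolding HP by (intro continuous_intros c1 c2)
    have iP: "integral {0..1} (\<lambda>x. H x * P x) = 0"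
      unfolding HP using i1 i2 by (subst integral_diff) (auto intro!: integrable_continuous_interval c1 c2 continuous_intros)
    have close: "norm (cnj (H x) - P x) \<le> 2 * e" for x
    proof -
      have s: "cis2pi x \<in> sphere 0 1" by simp
      have "norm (cnj (H x) - P x) \<le> \<bar>Re (cnj (H x) - P x)\<bar> + \<bar>Im (cnj (H x) - P x)\<bar>" by (rule cmod_le)
      also have "\<dots> \<le> e + e"
        using g1(2)[OF s] g2(2)[OF s] by (intro add_mono) (auto simp: P_def f(2))
      finally show ?thesis by simp
    qed
    have "complex_of_real K = integral {0..1} (\<lambda>x. complex_of_real ((norm (H x))\<^sup>2))"
      unfolding K_def
      using integral_linear[of "\<lambda>x. (norm (H x))\<^sup>2" "{0..1}" complex_of_real, symmetric]
      by (simp add: o_def bounded_linear_of_real integrable_continuous_interval continuous_intros cH del: of_real_power)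
    also have "\<dots> = integral {0..1} (\<lambda>x. H x * cnj (H x) - H x * P x)"
      unfolding complex_norm_square using iP
      by (subst integral_diff) (auto intro!: integrable_continuous_interval cP continuous_intros cH)
    finally have "K \<le> norm (integral {0..1} (\<lambda>x. H x * cnj (H x) - H x * P x))"
      by (metis abs_ge_self norm_of_real)
    also have "\<dots> \<le> integral {0..1} (\<lambda>x. 2 * e * norm (H x))"
    proof (rule integral_norm_bound_integral)
      show "norm (H x * cnj (H x) - H x * P x) \<le> 2 * e * norm (H x)" for x
        using mult_right_mono[OF close[of x], of "norm (H x)"]
        by (simp add: norm_mult mult.commute flip: right_diff_distrib)
    qed (auto intro!: integrable_continuous_interval cP continuous_intros cH)
    also have "\<dots> = 2 * e * M" by (simp add: M_def)
    finally show ?thesis .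
  qed
  have "K \<le> 0"
  proof (rule field_le_epsilon)
    fix d :: real assume d: "d > 0"
    have "K \<le> 2 * (d / (2 * (M + 1))) * M" using bound[of "d / (2 * (M + 1))"] d \<open>M \<ge> 0\<close> by simp
    also have "\<dots> \<le> d" using d \<open>M \<ge> 0\<close> by (simp add: field_simps)
    finally show "K \<le> 0 + d" by simp
  qed
  moreover have "K \<ge> 0" unfolding K_def by (intro integral_nonneg integrable_continuous_interval continuous_intros cH) auto
  ultimately have "K = 0" by simp
  then have "\<forall>x\<in>{0..1}. (norm (H x))\<^sup>2 = 0"
    unfolding K_def by (subst (asm) integral_eq_0_iff) (auto intro!: continuous_intros cH)
  then have "H (frac x) = 0" using frac_lt_1[of x] by (simp add: less_imp_le)
  moreover have "H (frac x + of_int \<lfloor>x\<rfloor>) = H (frac x)" by (rule periodic_int[of H, OF per])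
  ultimately show ?thesis by (simp add: frac_def)
qed

section \<open>Poisson summation for the complex Gaussian\<close>

lemma norm_gauss_complex: "norm (exp (- s * of_real (pi * t\<^sup>2))) = exp (- (Re s * pi) * t\<^sup>2)"
  by (simp add: norm_exp_eq_Re)

lemma integral_symmetric_intervals_tendsto:
  fixes g :: "real \<Rightarrow> complex"
  assumes g: "integrable lborel g"
  shows "(\<lambda>N. integral {- real N..real N} g) \<longlonglongrightarrow> (LINT x|lborel. g x)"
proof -
  have "(\<lambda>N. LINT x|lborel. indicator {- real N..real N} x *\<^sub>R g x) \<longlonglongrightarrow> (LINT x|lborel. g x)"
  proof (rule integral_dominated_convergence[where w="\<lambda>x. norm (g x)"])
    show "AE x in lborel. (\<lambda>N. indicator {- real N..real N} x *\<^sub>R g x) \<longlonglongrightarrow> g x"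
    proof (rule AE_I2)
      fix x
      have "eventually (\<lambda>N. indicator {- real N..real N} x *\<^sub>R g x = g x) sequentially"
      proof (rule eventually_sequentiallyI)
        fix N assume "N \<ge> nat \<lceil>\<bar>x\<bar>\<rceil>"
        then have "\<bar>x\<bar> \<le> real N" by linarith
        then show "indicator {- real N..real N} x *\<^sub>R g x = g x" by (auto simp: indicator_def)
      qed
      then show "(\<lambda>N. indicator {- real N..real N} x *\<^sub>R g x) \<longlonglongrightarrow> g x" by (rule tendsto_eventually)
    qed
    show "AE x in lborel. norm (indicator {- real N..real N} x *\<^sub>R g x) \<le> norm (g x)" for N
      by (rule AE_I2) (auto simp: indicator_def)
  qed (use g in auto)
  moreover have "(LINT x|lborel. indicator {- real N..real N} x *\<^sub>R g x) = integral {- real N..real N} g" for N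
  proof -
    have "set_integrable lborel {- real N..real N} g"
      unfolding set_integrable_def using g by (intro integrable_mult_indicator) auto
    from set_borel_integral_eq_integral(2)[OF this] show ?thesis by (simp add: set_lebesgue_integral_def)
  qed
  ultimately show ?thesis by simp
qed

lemma sum_integral_unit_intervals:
  fixes g :: "real \<Rightarrow> complex"
  assumes "continuous_on UNIV g"
  shows "(\<Sum>n\<in>{- int N..<int N}. integral {of_int n..of_int n + 1} g) = integral {- real N..real N} g"
proof (induction N)
  case (Suc N)
  have int: "g integrable_on {a..b}" for a b
    by (intro integrable_continuous_interval continuous_on_subset[OF assms]) auto
  have "{- int (Suc N)..<int (Suc N)} = insert (- int (Suc N)) (insert (int N) {- int N..<int N})" by auto
  then have "(\<Sum>n\<in>{- int (Suc N)..<int (Suc N)}. integral {of_int n..of_int n + 1} g) =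
     integral {- real (Suc N)..- real N} g + (integral {real N..real (Suc N)} g + integral {- real N..real N} g)"
    using Suc by (simp add: add_ac)
  also have "integral {real N..real (Suc N)} g + integral {- real N..real N} g = integral {- real N..real (Suc N)} g"
    using Henstock_Kurzweil_Integration.integral_combine[of "- real N" "real N" "real (Suc N)" g] int by (simp add: add.commute)
  also have "integral {- real (Suc N)..- real N} g + \<dots> = integral {- real (Suc N)..real (Suc N)} g"
    using Henstock_Kurzweil_Integration.integral_combine[of "- real (Suc N)" "- real N" "real (Suc N)" g] int by simp
  finally show ?case .
qed simp

text \<open>Both parts follow from uniform convergence of the finite partial sums (Weierstrass
  test), taken along the filter of finite index sets.\<close>

lemma integral_infsum_unit_interval:
  fixes f :: "int \<Rightarrow> real \<Rightarrow> complex"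
  assumes cont: "\<And>n. continuous_on {0..1} (f n)"
    and bound: "\<And>n x. x \<in> {0..1} \<Longrightarrow> norm (f n x) \<le> M n" and M: "M summable_on UNIV"
  shows "continuous_on {0..1} (\<lambda>x. \<Sum>\<^sub>\<infinity>n. f n x)"
    and "((\<lambda>n. integral {0..1} (f n)) has_sum integral {0..1} (\<lambda>x. \<Sum>\<^sub>\<infinity>n. f n x)) UNIV"
proof -
  have u: "uniform_limit {0..1} (\<lambda>X x. \<Sum>n\<in>X. f n x) (\<lambda>x. \<Sum>\<^sub>\<infinity>n. f n x) (finite_subsets_at_top UNIV)"
    by (rule Weierstrass_m_test_general[OF bound M])
  show "continuous_on {0..1} (\<lambda>x. \<Sum>\<^sub>\<infinity>n. f n x)"
    by (rule uniform_limit_theorem[OF _ u]) (auto intro!: always_eventually continuous_intros cont)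
  obtain I J where I: "\<And>X. ((\<lambda>x. \<Sum>n\<in>X. f n x) has_integral I X) {0..1}"
    and J: "((\<lambda>x. \<Sum>\<^sub>\<infinity>n. f n x) has_integral J) {0..1}" and lim: "(I \<longlongrightarrow> J) (finite_subsets_at_top UNIV)"
    using uniform_limit_integral_cbox[where a=0 and b=1 and f="\<lambda>X x. \<Sum>n\<in>X. f n x" and g="\<lambda>x. \<Sum>\<^sub>\<infinity>n. f n x" and F="finite_subsets_at_top UNIV"] u cont
    by (auto intro!: continuous_on_sum)
  have "eventually (\<lambda>X. I X = (\<Sum>n\<in>X. integral {0..1} (f n))) (finite_subsets_at_top UNIV)"
  proof (rule eventually_finite_subsets_at_top_weakI)
    fix X :: "int set" assume "finite X"
    then have "integral {0..1} (\<lambda>x. \<Sum>n\<in>X. f n x) = (\<Sum>n\<in>X. integral {0..1} (f n))"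
      by (intro Henstock_Kurzweil_Integration.integral_sum integrable_continuous_interval cont)
    then show "I X = (\<Sum>n\<in>X. integral {0..1} (f n))" using integral_unique[OF I, of X] by simp
  qed
  then have "((\<lambda>X. \<Sum>n\<in>X. integral {0..1} (f n)) \<longlongrightarrow> J) (finite_subsets_at_top UNIV)"
    using lim tendsto_cong by blast
  then show "((\<lambda>n. integral {0..1} (f n)) has_sum integral {0..1} (\<lambda>x. \<Sum>\<^sub>\<infinity>n. f n x)) UNIV"
    using integral_unique[OF J] by (simp add: has_sum_def)
qed

lemma continuous_on_periodic:
  fixes H :: "real \<Rightarrow> 'a::topological_space"
  assumes c: "continuous_on {0..1} H" and per: "\<And>x. H (x + 1) = H x"
  shows "continuous_on UNIV H"
proof -
  have 1: "continuous_on {of_int n..of_int n + 1} H" for n :: int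
  proof -
    have "continuous_on {of_int n..of_int n + 1} (\<lambda>x. H (x - of_int n))"
      by (rule continuous_on_compose2[OF c]) (auto intro!: continuous_intros)
    moreover have "H (x - of_int n) = H x" for x using periodic_int[of H "x - of_int n" n, OF per] by simp
    ultimately show ?thesis by simp
  qed
  have "isCont H x" for x
  proof -
    define n where "n = \<lfloor>x\<rfloor>"
    have "continuous_on ({of_int (n-1)..of_int (n-1) + 1} \<union> {of_int n..of_int n + 1}) H"
      by (rule continuous_on_closed_Un[OF _ _ 1 1]) auto
    then have "continuous_on {of_int n - 1<..<of_int n + 1} H"
      by (rule continuous_on_subset) auto
    moreover have "x \<in> {of_int n - 1<..<of_int n + 1}" unfolding n_def by (simp add: floor_less_iff) linarith
    ultimately show ?thesis by (subst (asm) continuous_on_eq_continuous_at) auto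
  qed
  then show ?thesis by (simp add: continuous_at_imp_continuous_on)
qed

lemma infsum_int_shift:
  fixes f :: "int \<Rightarrow> complex"
  shows "(\<Sum>\<^sub>\<infinity>n. f (n + m)) = (\<Sum>\<^sub>\<infinity>n. f n)"
  by (rule infsum_reindex_bij_witness[of _ "\<lambda>n. n - m" "\<lambda>n. n + m"]) auto

text \<open>Poisson summation. Both sides are continuous with period 1 in \<open>x\<close>, so it is
  enough to compare Fourier coefficients. Those of the series on the left are integrals over the
  unit intervals that tile the line, hence the Fourier transform of one Gaussian; those of the
  series on the right can be read off by orthogonality.\<close>

theorem theta_inversion:
  fixes s :: complex and x :: real
  assumes s: "Re s > 0"
  shows "(\<Sum>\<^sub>\<infinity>n::int. exp (- s * of_real (pi * (x + of_int n)\<^sup>2))) =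
     s powr (-1/2) * (\<Sum>\<^sub>\<infinity>k::int. cis2pi (of_int k * x) * exp (- of_real (pi * (of_int k)\<^sup>2) / s))"
proof -
  define f where "f = (\<lambda>x. exp (- s * complex_of_real (pi * x\<^sup>2)))"
  define F where "F = (\<lambda>x. \<Sum>\<^sub>\<infinity>n::int. f (x + of_int n))"
  define b where "b = (\<lambda>k::int. exp (- of_real (pi * (of_int k)\<^sup>2) / s))"
  define G where "G = (\<lambda>x. \<Sum>\<^sub>\<infinity>k::int. cis2pi (of_int k * x) * b k)"
  define c where "c = Re s * pi"
  have c: "c > 0" using s by (simp add: c_def)
  have nf: "norm (f x) = exp (- c * x\<^sup>2)" for x
    unfolding f_def norm_gauss_complex c_def by simp
  define M where "M = (\<lambda>n::int. exp c * exp (- (c / 2) * (of_int n)\<^sup>2))"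
  have M: "M summable_on UNIV" unfolding M_def by (intro summable_on_cmult_right gauss_summable) (use c in auto)
  have fM: "norm (f (x + of_int n)) \<le> M n" if "x \<in> {0..1}" for x n
  proof -
    have "x\<^sup>2 \<le> 1" using that by (auto simp: power2_eq_square mult_le_one)
    then have "exp (c * x\<^sup>2) \<le> exp c" using c by simp
    moreover have "norm (f (x + of_int n)) \<le> exp (c * x\<^sup>2) * exp (- (c / 2) * (of_int n)\<^sup>2)"
      unfolding nf using c by (intro gauss_shift_bound) auto
    ultimately show ?thesis unfolding M_def by (meson exp_ge_zero mult_right_mono order_trans)
  qed
  have cont_f: "continuous_on A f" for A unfolding f_def by (intro continuous_intros)
  have cont_fn: "continuous_on A (\<lambda>x. f (x + of_int n))" for A and n :: int
    by (rule continuous_on_compose2[OF cont_f]) (auto intro!: continuous_intros)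
  define \<beta> where "\<beta> = pi * Re (1 / s)"
  have "Re (1 / s) > 0" using s by (simp add: Re_divide)
     (metis add_pos_nonneg divide_pos_pos zero_less_power2 zero_le_power2 less_irrefl)
  then have \<beta>: "\<beta> > 0" by (simp add: \<beta>_def)
  have nb: "norm (b k) = exp (- \<beta> * (of_int k)\<^sup>2)" for k
  proof -
    have "- of_real (pi * (of_int k)\<^sup>2) / s = of_real (- (pi * (of_int k)\<^sup>2)) * (1 / s)" by simp
    moreover have "Re (of_real t * z) = t * Re z" for t z by simp
    ultimately show ?thesis unfolding b_def norm_exp_eq_Re by (simp only: \<beta>_def) (simp add: mult_ac)
  qed
  have b_sum: "(\<lambda>k. norm (b k)) summable_on UNIV" unfolding nb by (rule gauss_summable[OF \<beta>])
  have contF: "continuous_on {0..1} F"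
    unfolding F_def by (rule integral_infsum_unit_interval(1)[OF cont_fn fM M])
  have contG: "continuous_on {0..1} G"
    unfolding G_def by (rule integral_infsum_unit_interval(1)[OF _ _ b_sum]) (auto intro!: continuous_intros simp: norm_mult)
  have perF: "F (x + 1) = F x" for x
    using infsum_int_shift[of "\<lambda>n. f (x + of_int n)" 1] by (simp add: F_def add_ac)
  have perG: "G (x + 1) = G x" for x
    using cis2pi_int by (simp add: G_def distrib_left cis2pi_add)
  have FcoefF: "integral {0..1} (\<lambda>x. F x * cis2pi (of_int k * x)) = s powr (-1/2) * b k" for k :: int
  proof -
    define g where "g = (\<lambda>x. f x * cis2pi (of_int k * x))"
    have cont_g: "continuous_on A g" for A unfolding g_def by (intro continuous_intros cont_f)
    \<comment> \<open>\<open>cis2pi (of_int k * x)\<close> has period 1, so translating summand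
      \<open>n\<close> back moves the interval of integration instead.\<close>
    have shift: "integral {0..1} (\<lambda>x. f (x + of_int n) * cis2pi (of_int k * x)) = integral {of_int n..of_int n + 1} g" for n :: int
    proof -
      have "cis2pi (of_int k * x) = cis2pi (of_int k * (x + of_int n))" for x
        using cis2pi_int[of "k * n"] by (simp add: distrib_left cis2pi_add)
      then have "(\<lambda>x. f (x + of_int n) * cis2pi (of_int k * x)) = (\<lambda>x. g (x + of_int n))" by (simp add: g_def)
      moreover have "integral {0..1} (\<lambda>x. g (x + of_int n)) = integral {of_int n..of_int n + 1} g"
        using integral_shift_Icc_real[of 0 1 g "of_int n"] by (simp add: o_def add.commute)
      ultimately show ?thesis by simp
    qed
    have "((\<lambda>n. integral {0..1} (\<lambda>x. f (x + of_int n) * cis2pi (of_int k * x))) has_sum integral {0..1} (\<lambda>x. \<Sum>\<^sub>\<infinity>n. f (x + of_int n) * cis2pi (of_int k * x))) UNIV"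
      by (rule integral_infsum_unit_interval(2)[OF _ _ M]) (auto intro!: continuous_intros cont_fn fM simp: norm_mult)
    then have "((\<lambda>n::int. integral {of_int n..of_int n + 1} g) has_sum integral {0..1} (\<lambda>x. F x * cis2pi (of_int k * x))) UNIV"
      by (simp add: shift F_def infsum_cmult_left')
    then have "(\<lambda>N. \<Sum>n\<in>{- int N..<int N}. integral {of_int n..of_int n + 1} g) \<longlonglongrightarrow> integral {0..1} (\<lambda>x. F x * cis2pi (of_int k * x))"
      unfolding has_sum_def by (rule filterlim_compose[OF _ filterlim_int_intervals(1)])
    then have "(\<lambda>N. integral {- real N..real N} g) \<longlonglongrightarrow> integral {0..1} (\<lambda>x. F x * cis2pi (of_int k * x))"
      by (simp add: sum_integral_unit_intervals[OF cont_g])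
    moreover have "(\<lambda>N. integral {- real N..real N} g) \<longlonglongrightarrow> (LINT x|lborel. g x)"
    proof (rule integral_symmetric_intervals_tendsto)
      show "integrable lborel g"
      proof (rule Bochner_Integration.integrable_bound[OF gaussian_fourier_real(1)[OF s]])
        show "g \<in> borel_measurable lborel" using borel_measurable_continuous_onI[OF cont_g] by simp
        show "AE x in lborel. norm (g x) \<le> norm (exp (- Re s * (pi * x\<^sup>2)))"
          by (rule AE_I2) (simp add: g_def norm_mult nf c_def mult_ac)
      qed
    qed
    ultimately have "integral {0..1} (\<lambda>x. F x * cis2pi (of_int k * x)) = (LINT x|lborel. g x)"
      by (rule LIMSEQ_unique)
    also have "\<dots> = (LINT x|lborel. exp (- 2 * pi * \<i> * of_real (- of_int k) * of_real x) * exp (- s * of_real (pi * x\<^sup>2)))"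
      by (rule Bochner_Integration.integral_cong) (auto simp: g_def f_def cis2pi_def mult_ac)
    also have "\<dots> = s powr (-1/2) * b k"
      unfolding gaussian_fourier[OF s] b_def by simp
    finally show ?thesis .
  qed
  have FcoefG: "integral {0..1} (\<lambda>x. G x * cis2pi (of_int k * x)) = b k" for k :: int
  proof -
    have "((\<lambda>n. integral {0..1} (\<lambda>x. cis2pi (of_int n * x) * b n * cis2pi (of_int k * x))) has_sum integral {0..1} (\<lambda>x. \<Sum>\<^sub>\<infinity>n. cis2pi (of_int n * x) * b n * cis2pi (of_int k * x))) UNIV"
      by (rule integral_infsum_unit_interval(2)[OF _ _ b_sum]) (auto intro!: continuous_intros simp: norm_mult)
    \<comment> \<open>Testing against frequency \<open>k\<close> picks out the index
      \<open>- k\<close>; the sign disappears in the end because \<open>b\<close> is even.\<close>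
    moreover have "integral {0..1} (\<lambda>x. cis2pi (of_int n * x) * b n * cis2pi (of_int k * x)) = (if n = - k then b n else 0)" for n
    proof -
      have "(\<lambda>x. cis2pi (of_int n * x) * b n * cis2pi (of_int k * x)) = (\<lambda>x. b n * cis2pi (of_int (n + k) * x))"
      proof
        fix x
        have "cis2pi (of_int (n + k) * x) = cis2pi (of_int n * x) * cis2pi (of_int k * x)"
          by (simp add: distrib_right flip: cis2pi_add)
        then show "cis2pi (of_int n * x) * b n * cis2pi (of_int k * x) = b n * cis2pi (of_int (n + k) * x)"
          by (simp only: mult_ac)
      qed
      then show ?thesis using integral_cis2pi[of "n + k"] by auto
    qed
    ultimately have "((\<lambda>n. if n = - k then b n else 0) has_sum integral {0..1} (\<lambda>x. G x * cis2pi (of_int k * x))) UNIV"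
      by (simp add: G_def infsum_cmult_left')
    moreover have "((\<lambda>n. if n = - k then b n else 0) has_sum b (- k)) UNIV"
      by (rule has_sum_finite_neutralI[of "{- k}"]) auto
    ultimately have "integral {0..1} (\<lambda>x. G x * cis2pi (of_int k * x)) = b (- k)" by (rule has_sum_unique)
    then show ?thesis by (simp add: b_def)
  qed
  define H where "H = (\<lambda>x. F x - s powr (-1/2) * G x)"
  have "H x = 0"
  proof (rule fourier_null_periodic_eq_0)
    have "continuous_on {0..1} H" unfolding H_def by (intro continuous_intros contF contG)
    moreover have perH: "H (x + 1) = H x" for x by (simp add: H_def perF perG)
    ultimately have cH: "continuous_on UNIV H" by (rule continuous_on_periodic)
    show "fourier_null H" unfolding fourier_null_def
    proof (intro conjI allI cH)
      fix k :: int
      have "(\<lambda>x. H x * cis2pi (of_int k * x)) = (\<lambda>x. F x * cis2pi (of_int k * x) - s powr (-1/2) * (G x * cis2pi (of_int k * x)))"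
        by (simp add: H_def algebra_simps)
      moreover have "integral {0..1} \<dots> = integral {0..1} (\<lambda>x. F x * cis2pi (of_int k * x)) - integral {0..1} (\<lambda>x. s powr (-1/2) * (G x * cis2pi (of_int k * x)))"
        by (rule Henstock_Kurzweil_Integration.integral_diff) (intro integrable_continuous_interval continuous_intros contF contG)+
      ultimately show "integral {0..1} (\<lambda>x. H x * cis2pi (of_int k * x)) = 0"
        using FcoefF[of k] FcoefG[of k] by simp
    qed
  qed (simp add: H_def perF perG)
  then show ?thesis by (simp add: H_def F_def G_def f_def b_def)
qed

section \<open>Quadratic Gauss sums\<close>

lemma finite_residue_set [simp]: "finite (residue_set N)"
  by (simp add: residue_set_def)

lemma card_residue_set [simp]: "card (residue_set N) = N"
  by (simp add: residue_set_def)

lemma finite_unit_residues [simp]: "finite (unit_residues N)"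
  by (simp add: unit_residues_def)

lemma add_char_conv_cis2pi: "add_char q t = cis2pi (of_int t / of_nat q)"
  by (simp add: add_char_def cis2pi_def)

lemma cis2pi_cong:
  assumes "[u = v] (mod int N)" "N > 0"
  shows "cis2pi (of_int u / of_nat N) = cis2pi (of_int v / of_nat N)"
proof -
  obtain k where "u = v + int N * k" using assms(1) by (metis cong_iff_lin mult.commute cong_sym)
  then have "of_int u / of_nat N = of_int v / of_nat N + (of_int k :: real)"
    using assms(2) by (simp add: field_simps)
  then show ?thesis unfolding cis2pi_eq_iff by blast
qed

lemma sum_residue_affine:
  fixes f :: "int \<Rightarrow> complex"
  assumes N: "N > 0" and per: "\<And>x. f (x mod int N) = f x" and c: "coprime c (int N)"
  shows "(\<Sum>x\<in>residue_set N. f (c * x + b)) = (\<Sum>x\<in>residue_set N. f x)"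
proof -
  define g where "g = (\<lambda>x. (c * x + b) mod int N)"
  have sub: "g ` residue_set N \<subseteq> residue_set N" using N by (auto simp: g_def residue_set_def)
  have inj: "inj_on g (residue_set N)"
  proof (rule inj_onI)
    fix x y assume xy: "x \<in> residue_set N" "y \<in> residue_set N" "g x = g y"
    then have "[c * x + b = c * y + b] (mod int N)" by (simp add: g_def cong_def)
    then have "[x = y] (mod int N)" using c by (simp add: cong_add_rcancel cong_mult_lcancel)
    then show "x = y" using xy cong_less_imp_eq_int by (auto simp: residue_set_def)
  qed
  have "bij_betw g (residue_set N) (residue_set N)"
    unfolding bij_betw_def using inj endo_inj_surj[OF _ sub inj] by simp
  then have "(\<Sum>x\<in>residue_set N. f (g x)) = (\<Sum>x\<in>residue_set N. f x)"
    by (rule sum.reindex_bij_betw)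
  then show ?thesis by (simp add: g_def per)
qed

lemma sum_cis2pi_residues:
  assumes N: "N > 0"
  shows "(\<Sum>x\<in>residue_set N. cis2pi (of_int (m * x) / of_nat N)) = (if int N dvd m then of_nat N else 0)"
proof (cases "int N dvd m")
  case True
  then have "cis2pi (of_int (m * x) / of_nat N) = 1" for x
    using cis2pi_cong[of "m * x" 0 N] N by (simp add: cong_0_iff)
  then show ?thesis using True by simp
next
  case False
  define f where "f = (\<lambda>x. cis2pi (of_int (m * x) / of_nat N))"
  define w where "w = cis2pi (of_int m / of_nat N)"
  have per: "f (x mod int N) = f x" for x
    unfolding f_def using N by (intro cis2pi_cong) (auto simp: cong_def mod_mult_right_eq)
  have "w \<noteq> 1"
  proof
    assume "w = 1"
    then have "cis2pi (of_int m / of_nat N) = cis2pi 0" by (simp add: w_def)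
    then obtain n :: int where "of_int m / of_nat N = (of_int n :: real)" unfolding cis2pi_eq_iff by auto
    then have "real_of_int m = real_of_int (n * int N)" using N by (simp add: field_simps)
    then have "m = n * int N" by (simp only: of_int_eq_iff)
    then show False using False by simp
  qed
  have "(\<Sum>x\<in>residue_set N. f (1 * x + 1)) = (\<Sum>x\<in>residue_set N. f x)"
    by (rule sum_residue_affine) (use N per in auto)
  moreover have "f (1 * x + 1) = f x * w" for x
    by (simp add: f_def w_def distrib_left add_divide_distrib cis2pi_add)
  ultimately have "(\<Sum>x\<in>residue_set N. f x) * w = (\<Sum>x\<in>residue_set N. f x)"
    by (simp add: sum_distrib_right)
  then have "(\<Sum>x\<in>residue_set N. f x) = 0" using \<open>w \<noteq> 1\<close> by simp
  then show ?thesis using False by (simp add: f_def)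
qed

text \<open>With \<open>g = gcd m N\<close> the condition says that \<open>j\<close> is a multiple
  of \<open>N / g\<close>.\<close>

lemma card_dvd_residues_le:
  assumes N: "N > 0"
  shows "card {j \<in> residue_set N. int N dvd m * j} \<le> nat (gcd m (int N))"
proof -
  define g where "g = gcd m (int N)"
  have g: "g > 0" using N by (simp add: g_def)
  define M where "M = int N div g"
  have M: "int N = g * M" by (simp add: M_def g_def)
  have "M > 0" using M g N by (metis of_nat_0_less_iff zero_less_mult_pos)
  have cop: "coprime M (m div g)"
    unfolding M_def g_def using N div_gcd_coprime[of m "int N"] by (simp add: coprime_commute)
  have "{j \<in> residue_set N. int N dvd m * j} \<subseteq> (\<lambda>i. M * i) ` {0..<g}"
  proof
    fix j assume "j \<in> {j \<in> residue_set N. int N dvd m * j}"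
    then have j: "0 \<le> j" "j < int N" "int N dvd m * j" by (auto simp: residue_set_def)
    have "m = g * (m div g)" by (simp add: g_def)
    then have "g * M dvd g * ((m div g) * j)" using j(3) M by (metis mult.assoc)
    then have "M dvd (m div g) * j" using g by simp
    then have "M dvd j" using cop by (simp add: coprime_dvd_mult_right_iff)
    then obtain i where i: "j = M * i" by blast
    have "i \<ge> 0" using j(1) i \<open>M > 0\<close> by (simp add: zero_le_mult_iff)
    moreover have "i < g" using j(2) i M \<open>M > 0\<close> by (simp add: mult.commute)
    ultimately show "j \<in> (\<lambda>i. M * i) ` {0..<g}" using i by auto
  qed
  then have "card {j \<in> residue_set N. int N dvd m * j} \<le> card ((\<lambda>i. M * i) ` {0..<g})"
    by (intro card_mono) auto
  also have "\<dots> \<le> card {0..<g}" by (rule card_image_le) simp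
  finally show ?thesis by (simp add: g_def)
qed

text \<open>Weyl differencing: after a shift in the squared modulus the sum over \<open>y\<close> is
  a complete geometric sum, which vanishes unless \<open>N\<close> divides \<open>2 * A * j\<close>.
  No coprimality is assumed, because for sums over a residue class modulo \<open>p\<close> the
  leading coefficient may share factors with the modulus.\<close>

lemma quadratic_exp_sum_bound:
  fixes A B :: int
  assumes N: "N > 0"
  shows "(norm (\<Sum>x\<in>residue_set N. cis2pi (of_int (A * x\<^sup>2 + B * x) / of_nat N)))\<^sup>2 \<le> real N * real_of_int (gcd (2 * A) (int N))"
proof -
  define f where "f = (\<lambda>x. cis2pi (of_int (A * x\<^sup>2 + B * x) / of_nat N))"
  have per: "f (x mod int N) = f x" for x
    unfolding f_def using N by (intro cis2pi_cong cong_add cong_mult cong_pow cong_refl) (auto simp: cong_def)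
  have cnj: "cnj (f x) = cis2pi (- (of_int (A * x\<^sup>2 + B * x) / of_nat N))" for x
    by (simp add: f_def cis2pi_conv_cis cis_cnj)
  have shift: "f (1 * j + y) * cnj (f y) = f j * cis2pi (of_int ((2 * A * j) * y) / of_nat N)" for j y
  proof -
    have "of_int (A * (1 * j + y)\<^sup>2 + B * (1 * j + y)) / of_nat N + - (of_int (A * y\<^sup>2 + B * y) / of_nat N) =
        of_int (A * j\<^sup>2 + B * j) / of_nat N + (of_int ((2 * A * j) * y) / of_nat N :: real)"
      using N by (simp add: field_simps power2_eq_square)
    then show ?thesis unfolding cnj unfolding f_def by (metis cis2pi_add)
  qed
  define S where "S = (\<Sum>x\<in>residue_set N. f x)"
  have "complex_of_real ((norm S)\<^sup>2) = S * cnj S" by (rule complex_norm_square)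
  also have "\<dots> = (\<Sum>y\<in>residue_set N. S * cnj (f y))"
    unfolding S_def by (simp add: sum_distrib_left)
  also have "\<dots> = (\<Sum>y\<in>residue_set N. \<Sum>j\<in>residue_set N. f (1 * j + y) * cnj (f y))"
  proof (rule sum.cong[OF refl])
    fix y
    have "S = (\<Sum>j\<in>residue_set N. f (1 * j + y))"
      unfolding S_def by (rule sum_residue_affine[symmetric]) (use N per in auto)
    then show "S * cnj (f y) = (\<Sum>j\<in>residue_set N. f (1 * j + y) * cnj (f y))"
      by (simp add: sum_distrib_right)
  qed
  also have "\<dots> = (\<Sum>j\<in>residue_set N. \<Sum>y\<in>residue_set N. f j * cis2pi (of_int ((2 * A * j) * y) / of_nat N))"
    unfolding shift by (rule sum.swap)
  also have "\<dots> = (\<Sum>j\<in>residue_set N. f j * (if int N dvd 2 * A * j then of_nat N else 0))"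
    by (simp only: sum_distrib_left[symmetric] sum_cis2pi_residues[OF N])
  finally have "(norm S)\<^sup>2 = norm (\<Sum>j\<in>residue_set N. f j * (if int N dvd 2 * A * j then of_nat N else 0))"
    by (metis norm_of_real abs_power2)
  also have "\<dots> \<le> (\<Sum>j\<in>residue_set N. norm (f j * (if int N dvd 2 * A * j then of_nat N else 0)))"
    by (rule norm_sum)
  also have "\<dots> = (\<Sum>j\<in>residue_set N. if int N dvd 2 * A * j then real N else 0)"
    by (intro sum.cong) (auto simp: norm_mult f_def)
  also have "\<dots> = real N * real (card {j \<in> residue_set N. int N dvd 2 * A * j})"
    by (simp add: sum.If_cases Int_def mult.commute)
  also have "\<dots> \<le> real N * real_of_int (gcd (2 * A) (int N))"
  proof (rule mult_left_mono)
    have "int (card {j \<in> residue_set N. int N dvd 2 * A * j}) \<le> gcd (2 * A) (int N)"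
      using card_dvd_residues_le[OF N, of "2 * A"] gcd_ge_0_int[of "2 * A" "int N"] by linarith
    then show "real (card {j \<in> residue_set N. int N dvd 2 * A * j}) \<le> real_of_int (gcd (2 * A) (int N))" by linarith
  qed simp
  finally show ?thesis by (simp add: S_def f_def)
qed

definition quad_gauss :: "int \<Rightarrow> nat \<Rightarrow> complex" where
  "quad_gauss a r = (\<Sum>n\<in>residue_set r. cis2pi (of_int (a * n\<^sup>2) / of_nat r))"

lemma quad_gauss_affine:
  assumes "r > 0" "coprime c (int r)"
  shows "(\<Sum>x\<in>residue_set r. cis2pi (of_int (a * (c * x + b)\<^sup>2) / of_nat r)) = quad_gauss a r"
  unfolding quad_gauss_def
proof (rule sum_residue_affine)
  show "cis2pi (of_int (a * (x mod int r)\<^sup>2) / of_nat r) = cis2pi (of_int (a * x\<^sup>2) / of_nat r)" for x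
    using assms(1) by (intro cis2pi_cong cong_mult cong_pow cong_refl) (auto simp: cong_def)
qed (use assms in auto)

text \<open>The factor 2 bounds \<open>gcd 2 r\<close>. The sharper form for odd \<open>r\<close>
  matters in the Euler product: the general estimate \<open>norm_QR_bound\<close> exceeds 1 already
  at the prime 3.\<close>

lemma norm_quad_gauss:
  assumes "r > 0" "coprime a (int r)"
  shows "norm (quad_gauss a r) \<le> sqrt (2 * real r)"
    and "odd r \<Longrightarrow> norm (quad_gauss a r) \<le> sqrt (real r)"
proof -
  have b: "(norm (quad_gauss a r))\<^sup>2 \<le> real r * real_of_int (gcd (2 * a) (int r))"
    using quadratic_exp_sum_bound[OF assms(1), of a 0] by (simp add: quad_gauss_def)
  have g: "gcd (2 * a) (int r) = gcd 2 (int r)"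
    using assms(2) by (simp add: gcd_mult_right_right_cancel coprime_commute gcd.commute)
  have "gcd 2 (int r) \<le> 2" by (rule gcd_le1_int) simp
  then have "real_of_int (gcd (2 * a) (int r)) \<le> 2" unfolding g by linarith
  then have "real r * real_of_int (gcd (2 * a) (int r)) \<le> real r * 2" by (intro mult_left_mono) auto
  then show "norm (quad_gauss a r) \<le> sqrt (2 * real r)" using b by (intro real_le_rsqrt) (simp add: mult.commute)
  assume "odd r"
  then have "gcd 2 (int r) = 1" by (simp add: coprime_iff_gcd_eq_1[symmetric])
  then show "norm (quad_gauss a r) \<le> sqrt (real r)" using b unfolding g by (intro real_le_rsqrt) simp
qed

section \<open>Factorisation of \<open>gauss_sum\<close> over coordinates and multiplicativity of
  \<open>QR\<close>\<close>

lemma prod_cis2pi: "finite A \<Longrightarrow> (\<Prod>i\<in>A. cis2pi (f i)) = cis2pi (\<Sum>i\<in>A. f i)"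
  by (induction A rule: finite_induct) (auto simp: cis2pi_add)

lemma gauss_sum_conv_quad_gauss: "gauss_sum d a (\<lambda>_. 0) r = (quad_gauss a r / of_nat r) ^ d"
proof -
  have "quad_gauss a r ^ d = (\<Prod>i<d. \<Sum>n\<in>residue_set r. cis2pi (of_int (a * n\<^sup>2) / of_nat r))"
    by (simp add: quad_gauss_def)
  also have "\<dots> = (\<Sum>n\<in>residue_vectors d r. \<Prod>i<d. cis2pi (of_int (a * (n i)\<^sup>2) / of_nat r))"
    unfolding residue_vectors_def by (rule prod_sum_PiE) auto
  also have "\<dots> = (\<Sum>n\<in>residue_vectors d r. add_char r (a * norm_sq d n + dot d n (\<lambda>_. 0)))"
    by (intro sum.cong refl)
       (simp add: prod_cis2pi add_char_conv_cis2pi norm_sq_def dot_def sum_distrib_left sum_divide_distrib)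
  finally show ?thesis by (simp add: gauss_sum_def power_divide)
qed

lemma QR_conv_quad_gauss:
  "QR d r lam = (\<Sum>a\<in>unit_residues r. cis2pi (of_int (- a * int lam) / of_nat r) * (quad_gauss a r / of_nat r) ^ d)"
  by (simp add: QR_def gauss_sum_conv_quad_gauss add_char_conv_cis2pi)

text \<open>The Chinese remainder map is written as \<open>x * s + y * r\<close> because then the
  fraction with denominator \<open>r * s\<close> splits as \<open>x / r + y / s\<close>, and
  characters factor without inverses modulo \<open>r\<close> or \<open>s\<close>.\<close>

lemma crt_inj:
  assumes "r > 0" "s > 0" "coprime r s"
  shows "inj_on (\<lambda>(x, y). (x * int s + y * int r) mod int (r * s)) (residue_set r \<times> residue_set s)"
proof (rule inj_onI, clarify)
  fix x y x' y'
  assume x: "x \<in> residue_set r" "x' \<in> residue_set r" and y: "y \<in> residue_set s" "y' \<in> residue_set s"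
    and eq: "(x * int s + y * int r) mod int (r * s) = (x' * int s + y' * int r) mod int (r * s)"
  have c: "[x * int s + y * int r = x' * int s + y' * int r] (mod int r * int s)"
    using eq by (simp add: cong_def)
  have "[x * int s + y * int r = x' * int s + y' * int r] (mod int r)"
    using c by (rule cong_modulus_mult)
  moreover have "[u * int s + v * int r = u * int s] (mod int r)" for u v by (simp add: cong_def)
  ultimately have "[x * int s = x' * int s] (mod int r)" by (meson cong_trans cong_sym)
  then have "[x = x'] (mod int r)" using assms(3) by (subst (asm) cong_mult_rcancel) (auto simp: coprime_commute)
  then have 1: "x = x'" using x cong_less_imp_eq_int by (auto simp: residue_set_def)
  have "[x * int s + y * int r = x' * int s + y' * int r] (mod int s)"
    using c by (metis cong_modulus_mult mult.commute)
  moreover have "[u * int s + v * int r = v * int r] (mod int s)" for u v by (simp add: cong_def)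
  ultimately have "[y * int r = y' * int r] (mod int s)" by (meson cong_trans cong_sym)
  then have "[y = y'] (mod int s)" using assms(3) by (subst (asm) cong_mult_rcancel) auto
  then have "y = y'" using y cong_less_imp_eq_int by (auto simp: residue_set_def)
  then show "x = x' \<and> y = y'" using 1 by simp
qed

lemma crt_bij:
  assumes "r > 0" "s > 0" "coprime r s"
  shows "bij_betw (\<lambda>(x, y). (x * int s + y * int r) mod int (r * s)) (residue_set r \<times> residue_set s) (residue_set (r * s))"
  unfolding bij_betw_def
proof (intro conjI crt_inj assms card_subset_eq)
  show "(\<lambda>(x, y). (x * int s + y * int r) mod int (r * s)) ` (residue_set r \<times> residue_set s) \<subseteq> residue_set (r * s)"
    using assms by (auto simp: residue_set_def)
  show "card ((\<lambda>(x, y). (x * int s + y * int r) mod int (r * s)) ` (residue_set r \<times> residue_set s)) = card (residue_set (r * s))"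
    by (subst card_image[OF crt_inj[OF assms]]) (simp add: card_cartesian_product)
qed simp

lemma crt_unit:
  assumes "coprime r s"
  shows "coprime ((x * int s + y * int r) mod int (r * s)) (int (r * s)) \<longleftrightarrow> coprime x (int r) \<and> coprime y (int s)"
proof -
  have "coprime ((x * int s + y * int r) mod int (r * s)) (int (r * s)) \<longleftrightarrow> coprime (x * int s + y * int r) (int (r * s))"
    by (simp add: coprime_iff_gcd_eq_1 gcd.commute flip: gcd_red_int)
  also have "\<dots> \<longleftrightarrow> coprime (x * int s + y * int r) (int r) \<and> coprime (x * int s + y * int r) (int s)"
    by simp
  also have "coprime (x * int s + y * int r) (int r) \<longleftrightarrow> coprime (x * int s) (int r)"
    using gcd_add_mult[of "int r" y "x * int s"]
    by (simp add: coprime_iff_gcd_eq_1 gcd.commute[of _ "int r"] add.commute[of "x * int s"])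
  also have "\<dots> \<longleftrightarrow> coprime x (int r)" using assms by (simp add: coprime_commute)
  also have "coprime (x * int s + y * int r) (int s) \<longleftrightarrow> coprime (y * int r) (int s)"
    using gcd_add_mult[of "int s" x "y * int r"]
    by (simp add: coprime_iff_gcd_eq_1 gcd.commute[of _ "int s"])
  also have "\<dots> \<longleftrightarrow> coprime y (int s)" using assms by simp
  finally show ?thesis .
qed

lemma crt_unit_bij:
  assumes "r > 0" "s > 0" "coprime r s"
  shows "bij_betw (\<lambda>(x, y). (x * int s + y * int r) mod int (r * s)) (unit_residues r \<times> unit_residues s) (unit_residues (r * s))"
proof -
  let ?f = "\<lambda>(x, y). (x * int s + y * int r) mod int (r * s)"
  have b: "bij_betw ?f (residue_set r \<times> residue_set s) (residue_set (r * s))" by (rule crt_bij[OF assms])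
  have "?f ` (unit_residues r \<times> unit_residues s) = unit_residues (r * s)"
  proof (intro equalityI subsetI)
    fix z assume "z \<in> ?f ` (unit_residues r \<times> unit_residues s)"
    then obtain x y where xy: "x \<in> unit_residues r" "y \<in> unit_residues s" "z = ?f (x, y)" by auto
    then have "z \<in> residue_set (r * s)" using bij_betwE[OF b] by (auto simp: unit_residues_def)
    then show "z \<in> unit_residues (r * s)" using xy crt_unit[OF assms(3), of x y] by (simp add: unit_residues_def)
  next
    fix z assume z: "z \<in> unit_residues (r * s)"
    then have "z \<in> ?f ` (residue_set r \<times> residue_set s)" using b by (simp add: bij_betw_def unit_residues_def)
    then obtain x y where xy: "x \<in> residue_set r" "y \<in> residue_set s" "z = ?f (x, y)" by auto
    then show "z \<in> ?f ` (unit_residues r \<times> unit_residues s)"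
      using z crt_unit[OF assms(3), of x y] by (auto simp: unit_residues_def intro!: image_eqI[of _ _ "(x, y)"])
  qed
  moreover have "inj_on ?f (unit_residues r \<times> unit_residues s)"
    by (rule inj_on_subset[OF crt_inj[OF assms]]) (auto simp: unit_residues_def)
  ultimately show ?thesis by (simp add: bij_betw_def)
qed

lemma sum_crt:
  fixes f :: "int \<Rightarrow> complex"
  assumes "r > 0" "s > 0" "coprime r s"
  shows "(\<Sum>n\<in>residue_set (r * s). f n) = (\<Sum>x\<in>residue_set r. \<Sum>y\<in>residue_set s. f ((x * int s + y * int r) mod int (r * s)))"
    and "(\<Sum>n\<in>unit_residues (r * s). f n) = (\<Sum>x\<in>unit_residues r. \<Sum>y\<in>unit_residues s. f ((x * int s + y * int r) mod int (r * s)))"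
  using sum.reindex_bij_betw[OF crt_bij[OF assms], of f] sum.reindex_bij_betw[OF crt_unit_bij[OF assms], of f]
  by (simp_all add: sum.cartesian_product case_prod_beta)

lemma cis2pi_crt:
  assumes "r > 0" "s > 0"
  shows "cis2pi (of_int ((x * int s + y * int r) * m) / of_nat (r * s)) = cis2pi (of_int (x * m) / of_nat r) * cis2pi (of_int (y * m) / of_nat s)"
  using assms by (simp add: cis2pi_add[symmetric] add_divide_distrib distrib_right)

lemma quad_gauss_mod: "r > 0 \<Longrightarrow> quad_gauss (a mod int r) r = quad_gauss a r"
  unfolding quad_gauss_def
  by (intro sum.cong refl cis2pi_cong cong_mult) (auto simp: cong_def)

text \<open>Numerator and summation variable are both split. Modulo \<open>r\<close> only
  \<open>s * x\<close> is left of the variable, and the unit \<open>s\<close> is absorbed by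
  \<open>quad_gauss_affine\<close>; likewise modulo \<open>s\<close>. Hence \<open>a\<close> and
  \<open>b\<close> appear untwisted.\<close>

lemma quad_gauss_crt:
  assumes "r > 0" "s > 0" "coprime r s"
  shows "quad_gauss (a * int s + b * int r) (r * s) = quad_gauss a r * quad_gauss b s"
proof -
  have "quad_gauss (a * int s + b * int r) (r * s) =
     (\<Sum>x\<in>residue_set r. \<Sum>y\<in>residue_set s. cis2pi (of_int ((a * int s + b * int r) * ((x * int s + y * int r) mod int (r * s))\<^sup>2) / of_nat (r * s)))"
    unfolding quad_gauss_def by (rule sum_crt(1)[OF assms])
  also have "\<dots> = (\<Sum>x\<in>residue_set r. \<Sum>y\<in>residue_set s. cis2pi (of_int (a * (int s * x + 0)\<^sup>2) / of_nat r) * cis2pi (of_int (b * (int r * y + 0)\<^sup>2) / of_nat s))"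
  proof (intro sum.cong refl)
    fix x y
    have "cis2pi (of_int ((a * int s + b * int r) * ((x * int s + y * int r) mod int (r * s))\<^sup>2) / of_nat (r * s)) =
       cis2pi (of_int ((a * int s + b * int r) * (x * int s + y * int r)\<^sup>2) / of_nat (r * s))"
      using assms by (intro cis2pi_cong cong_mult cong_pow cong_refl) (auto simp: cong_def)
    also have "\<dots> = cis2pi (of_int (a * (x * int s + y * int r)\<^sup>2) / of_nat r) * cis2pi (of_int (b * (x * int s + y * int r)\<^sup>2) / of_nat s)"
      by (rule cis2pi_crt[OF assms(1,2)])
    also have "cis2pi (of_int (a * (x * int s + y * int r)\<^sup>2) / of_nat r) = cis2pi (of_int (a * (int s * x + 0)\<^sup>2) / of_nat r)"
      using assms by (intro cis2pi_cong cong_mult cong_pow cong_refl) (auto simp: cong_def mult.commute)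
    also have "cis2pi (of_int (b * (x * int s + y * int r)\<^sup>2) / of_nat s) = cis2pi (of_int (b * (int r * y + 0)\<^sup>2) / of_nat s)"
      using assms by (intro cis2pi_cong cong_mult cong_pow cong_refl) (auto simp: cong_def mult.commute)
    finally show "cis2pi (of_int ((a * int s + b * int r) * ((x * int s + y * int r) mod int (r * s))\<^sup>2) / of_nat (r * s)) =
      cis2pi (of_int (a * (int s * x + 0)\<^sup>2) / of_nat r) * cis2pi (of_int (b * (int r * y + 0)\<^sup>2) / of_nat s)" .
  qed
  also have "\<dots> = (\<Sum>x\<in>residue_set r. cis2pi (of_int (a * (int s * x + 0)\<^sup>2) / of_nat r)) * (\<Sum>y\<in>residue_set s. cis2pi (of_int (b * (int r * y + 0)\<^sup>2) / of_nat s))"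
    by (rule sum_product[symmetric])
  also have "\<dots> = quad_gauss a r * quad_gauss b s"
    using assms by (subst (1 2) quad_gauss_affine) (auto simp: coprime_commute)
  finally show ?thesis .
qed

lemma QR_mult:
  assumes "r > 0" "s > 0" "coprime r s"
  shows "QR d (r * s) lam = QR d r lam * QR d s lam"
proof -
  define F where "F = (\<lambda>r a. cis2pi (of_int (- a * int lam) / of_nat r) * (quad_gauss a r / of_nat r) ^ d)"
  have QRF: "QR d r lam = (\<Sum>a\<in>unit_residues r. F r a)" for r by (simp add: QR_conv_quad_gauss F_def)
  have "F (r * s) ((x * int s + y * int r) mod int (r * s)) = F r x * F s y" for x y
  proof -
    have "cis2pi (of_int (- ((x * int s + y * int r) mod int (r * s)) * int lam) / of_nat (r * s)) = cis2pi (of_int ((x * int s + y * int r) * (- int lam)) / of_nat (r * s))"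
      using assms by (intro cis2pi_cong) (auto simp: cong_def mod_minus_eq mod_mult_left_eq intro: mod_mult_cong mod_minus_cong)
    also have "\<dots> = cis2pi (of_int (- x * int lam) / of_nat r) * cis2pi (of_int (- y * int lam) / of_nat s)"
      unfolding cis2pi_crt[OF assms(1,2)] by simp
    finally have 1: "cis2pi (of_int (- ((x * int s + y * int r) mod int (r * s)) * int lam) / of_nat (r * s)) = cis2pi (of_int (- x * int lam) / of_nat r) * cis2pi (of_int (- y * int lam) / of_nat s)" .
    have 2: "quad_gauss ((x * int s + y * int r) mod int (r * s)) (r * s) = quad_gauss x r * quad_gauss y s"
      using assms by (simp only: quad_gauss_mod quad_gauss_crt nat_0_less_mult_iff)
    show ?thesis unfolding F_def 1 2 by (simp add: power_mult_distrib power_divide)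
  qed
  then show ?thesis unfolding QRF sum_crt(2)[OF assms] by (simp add: sum_product)
qed

section \<open>Gauss sums in a residue class\<close>

text \<open>The Gauss sum over the residues modulo \<open>lcm p q\<close> that are congruent to
  \<open>b\<close> modulo \<open>p\<close>; there are \<open>lcm p q / p = q / gcd p q\<close> of
  them. The frequency \<open>k\<close> is the dual variable of Poisson summation, and
  \<open>k = 0\<close> gives the main term.\<close>

definition cong_gauss :: "nat \<Rightarrow> nat \<Rightarrow> int \<Rightarrow> int \<Rightarrow> int \<Rightarrow> complex" where
  "cong_gauss p q h b k = (\<Sum>j\<in>residue_set (q div gcd p q).
     cis2pi (of_int (h * (b + int p * j)\<^sup>2) / of_nat q + of_int (k * (b + int p * j)) / of_nat (lcm p q)))"

text \<open>The arithmetic weight of all fractions with denominator \<open>q\<close> once the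
  integral over the arc has been split off. For \<open>p = 1\<close> and \<open>q > 0\<close> it is
  \<open>QR d q lam\<close>.\<close>

definition local_term :: "nat \<Rightarrow> nat \<Rightarrow> nat \<Rightarrow> nat \<Rightarrow> (nat \<Rightarrow> int) \<Rightarrow> complex" where
  "local_term d p q lam a = (\<Sum>h\<in>unit_residues q. cis2pi (of_int (- h * int lam) / of_nat q) *
     (\<Prod>i<d. cong_gauss p q h (a i) 0 / of_nat (lcm p q)))"

text \<open>After expansion of the square one factor \<open>gcd p q\<close> cancels between
  \<open>p\<close> and \<open>q\<close>, so the part depending on \<open>j\<close> has denominator
  \<open>N\<close>, which is also the number of terms: a complete quadratic sum modulo
  \<open>N\<close>.\<close>

lemma cong_gauss_quadratic:
  assumes "p > 0" "q > 0"
  defines "g \<equiv> gcd p q" and "N \<equiv> q div gcd p q"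
  shows "cong_gauss p q h b k = cis2pi (of_int (h * b\<^sup>2) / of_nat q + of_int (k * b) / of_nat (lcm p q)) *
    (\<Sum>j\<in>residue_set N. cis2pi (of_int (h * int p * int (p div g) * j\<^sup>2 + (2 * h * b * int (p div g) + k) * j) / of_nat N))"
proof -
  define u where "u = p div g"
  have g: "g > 0" using assms by (simp add: g_def)
  have p: "p = g * u" unfolding u_def g_def by simp
  have q: "q = g * N" unfolding N_def g_def by simp
  have "N > 0" using q assms(2) by (metis gr0I mult_0_right)
  have L: "lcm p q = p * N"
    unfolding lcm_nat_def g_def[symmetric] using q g by (simp add: mult.assoc)
  have u: "u > 0" using p assms(1) by (metis gr0I mult_0_right)
  have "of_int (h * (b + int p * j)\<^sup>2) / of_nat q + of_int (k * (b + int p * j)) / of_nat (lcm p q) =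
     (of_int (h * b\<^sup>2) / of_nat q + of_int (k * b) / of_nat (lcm p q)) +
       of_int (h * int p * int u * j\<^sup>2 + (2 * h * b * int u + k) * j) / (of_nat N :: real)" for j
    unfolding L using \<open>N > 0\<close> g u by (simp add: p q field_simps power2_eq_square)
  then show ?thesis
    unfolding cong_gauss_def N_def[symmetric] u_def[symmetric]
    by (simp only: cis2pi_add sum_distrib_left)
qed

text \<open>Uniformity in \<open>p\<close>, with \<open>g = gcd p q\<close>: the sum has only
  \<open>N = q / g\<close> terms, but its leading coefficient may share the factor \<open>g\<close>
  with \<open>N\<close>. Since \<open>h\<close> and \<open>p / g\<close> are units modulo
  \<open>N\<close>, the gcd is at most \<open>2 * g\<close>, and \<open>N * (2 * g) = 2 * q\<close>
  whatever \<open>g\<close> is.\<close>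

lemma norm_cong_gauss:
  assumes p: "p > 0" and q: "q > 0" and h: "coprime h (int q)"
  shows "norm (cong_gauss p q h b k) \<le> sqrt (2 * real q)"
proof -
  define g where "g = gcd p q"
  define N where "N = q div g"
  define A where "A = h * int p * int (p div g)"
  have g: "g > 0" using p by (simp add: g_def)
  have qN: "q = g * N" unfolding N_def g_def by simp
  have pu: "p = g * (p div g)" unfolding g_def by simp
  have "N > 0" using qN q by (metis gr0I mult_0_right)
  have hN: "coprime h (int N)" using h qN by simp
  have up: "coprime (int (p div g)) (int N)"
    unfolding N_def g_def using div_gcd_coprime[of p q] p by simp
  have "gcd (2 * A) (int N) dvd 2 * int g"
  proof -
    have 1: "gcd (2 * A) (int N) = gcd (2 * int p) (int N)"
    proof -
      have "2 * A = (2 * int p) * (h * int (p div g))" by (simp add: A_def)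
      moreover have "coprime (int N) (h * int (p div g))" using hN up by (simp add: coprime_commute)
      ultimately show ?thesis by (metis gcd.commute gcd_mult_right_right_cancel)
    qed
    have "2 * int p = (2 * int g) * int (p div g)" using pu by (metis mult.assoc of_nat_mult)
    moreover have "coprime (int N) (int (p div g))" using up by (simp add: coprime_commute)
    ultimately have "gcd (2 * int p) (int N) = gcd (2 * int g) (int N)"
      by (metis gcd.commute gcd_mult_right_right_cancel)
    then show ?thesis using 1 by simp
  qed
  then have "gcd (2 * A) (int N) \<le> 2 * int g" using g by (intro zdvd_imp_le) auto
  then have le: "real_of_int (gcd (2 * A) (int N)) \<le> 2 * real g" by linarith
  define S where "S = (\<Sum>j\<in>residue_set N. cis2pi (of_int (A * j\<^sup>2 + (2 * h * b * int (p div g) + k) * j) / of_nat N))"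
  have "norm (cong_gauss p q h b k) = norm S"
    unfolding cong_gauss_quadratic[OF p q] S_def A_def g_def N_def by (simp add: norm_mult)
  moreover have "(norm S)\<^sup>2 \<le> real N * real_of_int (gcd (2 * A) (int N))"
    unfolding S_def by (rule quadratic_exp_sum_bound[OF \<open>N > 0\<close>])
  moreover have "\<dots> \<le> real N * (2 * real g)" using le by (intro mult_left_mono) auto
  ultimately have "(norm (cong_gauss p q h b k))\<^sup>2 \<le> 2 * real q" by (simp add: qN mult_ac)
  then show ?thesis by (rule real_le_rsqrt)
qed

lemma cong_gauss_coprime:
  assumes p: "p > 0" and q: "q > 0" and cop: "coprime p q"
  shows "cong_gauss p q h b 0 = quad_gauss h q"
proof -
  have "gcd p q = 1" using cop by simp
  then have "cong_gauss p q h b 0 = (\<Sum>j\<in>residue_set q. cis2pi (of_int (h * (int p * j + b)\<^sup>2) / of_nat q))"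
    unfolding cong_gauss_def by (simp add: add.commute)
  also have "\<dots> = quad_gauss h q" using q cop by (intro quad_gauss_affine) auto
  finally show ?thesis .
qed

lemma local_term_coprime:
  assumes p: "p > 0" and q: "q > 0" and cop: "coprime p q"
  shows "local_term d p q lam a = QR d q lam / of_nat p ^ d"
proof -
  have "lcm p q = p * q" using cop by (simp add: lcm_coprime)
  then show ?thesis
    unfolding local_term_def QR_conv_quad_gauss cong_gauss_coprime[OF assms]
    by (simp add: sum_divide_distrib power_divide power_mult_distrib mult_ac)
qed

lemma unit_residues_prime:
  assumes "prime p"
  shows "unit_residues p = {1..<int p}"
proof -
  have "coprime a (int p) \<longleftrightarrow> a \<noteq> 0" if "0 \<le> a" "a < int p" for a
  proof
    assume "coprime a (int p)" then show "a \<noteq> 0" using prime_gt_1_nat[OF assms] by auto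
  next
    assume "a \<noteq> 0"
    then have "\<not> int p dvd a" using that zdvd_not_zless[of a "int p"] by auto
    then show "coprime a (int p)" using prime_imp_coprime[of "int p" a] assms by (simp add: coprime_commute)
  qed
  then show ?thesis by (auto simp: unit_residues_def residue_set_def)
qed

text \<open>Modulo \<open>p\<close> the variable \<open>b + p * j\<close> is constant, so the part
  of the numerator belonging to \<open>p\<close> comes out as a phase; modulo \<open>r\<close> it
  runs through all residues.\<close>

lemma cong_gauss_prime_factor:
  assumes p: "p > 0" and r: "r > 0" and cop: "coprime p r"
  shows "cong_gauss p (r * p) ((x * int p + y * int r) mod int (r * p)) b 0 = cis2pi (of_int (y * b\<^sup>2) / of_nat p) * quad_gauss x r"
proof -
  have g: "gcd p (r * p) = p" by simp
  have "cong_gauss p (r * p) ((x * int p + y * int r) mod int (r * p)) b 0 =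
     (\<Sum>j\<in>residue_set r. cis2pi (of_int (((x * int p + y * int r) mod int (r * p)) * (b + int p * j)\<^sup>2) / of_nat (r * p)))"
    unfolding cong_gauss_def g using p by simp
  also have "\<dots> = (\<Sum>j\<in>residue_set r. cis2pi (of_int (y * b\<^sup>2) / of_nat p) * cis2pi (of_int (x * (int p * j + b)\<^sup>2) / of_nat r))"
  proof (rule sum.cong[OF refl])
    fix j
    have "cis2pi (of_int (((x * int p + y * int r) mod int (r * p)) * (b + int p * j)\<^sup>2) / of_nat (r * p)) =
       cis2pi (of_int ((x * int p + y * int r) * (b + int p * j)\<^sup>2) / of_nat (r * p))"
      using p r by (intro cis2pi_cong cong_mult cong_refl) (auto simp: cong_def)
    also have "\<dots> = cis2pi (of_int (x * (b + int p * j)\<^sup>2) / of_nat r) * cis2pi (of_int (y * (b + int p * j)\<^sup>2) / of_nat p)"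
      by (rule cis2pi_crt[OF r p])
    also have "cis2pi (of_int (y * (b + int p * j)\<^sup>2) / of_nat p) = cis2pi (of_int (y * b\<^sup>2) / of_nat p)"
      using p by (intro cis2pi_cong cong_mult cong_pow cong_refl) (auto simp: cong_def)
    finally show "cis2pi (of_int (((x * int p + y * int r) mod int (r * p)) * (b + int p * j)\<^sup>2) / of_nat (r * p)) =
      cis2pi (of_int (y * b\<^sup>2) / of_nat p) * cis2pi (of_int (x * (int p * j + b)\<^sup>2) / of_nat r)"
      by (simp only: mult.commute add.commute)
  qed
  also have "\<dots> = cis2pi (of_int (y * b\<^sup>2) / of_nat p) * quad_gauss x r"
    unfolding sum_distrib_left[symmetric] using r cop by (subst quad_gauss_affine) auto
  finally show ?thesis .
qed

text \<open>The phases of the \<open>d\<close> coordinates multiply to the character of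
  \<open>y * norm_sq d a\<close> modulo \<open>p\<close>, which the congruence for \<open>a\<close>
  cancels against that of \<open>- y * lam\<close>. So all \<open>p - 1\<close> units
  \<open>y\<close> contribute the same.\<close>

lemma local_term_prime_factor:
  assumes p: "prime p" and r: "r > 0" and cop: "coprime p r"
    and a: "[norm_sq d a = int lam] (mod int p)"
  shows "local_term d p (r * p) lam a = of_nat (p - 1) * QR d r lam / of_nat p ^ d"
proof -
  have p0: "p > 0" using p by (simp add: prime_gt_0_nat)
  have cop': "coprime r p" using cop by (simp add: coprime_commute)
  have lcm: "lcm p (r * p) = r * p" by (simp add: lcm_nat_def p0)
  have factor: "cis2pi (of_int (- ((x * int p + y * int r) mod int (r * p)) * int lam) / of_nat (r * p)) *
     (\<Prod>i<d. cong_gauss p (r * p) ((x * int p + y * int r) mod int (r * p)) (a i) 0 / of_nat (r * p)) =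
     (cis2pi (of_int (- x * int lam) / of_nat r) * (quad_gauss x r / of_nat r) ^ d) / of_nat p ^ d" for x y
  proof -
    have "cis2pi (of_int (- ((x * int p + y * int r) mod int (r * p)) * int lam) / of_nat (r * p)) = cis2pi (of_int ((x * int p + y * int r) * (- int lam)) / of_nat (r * p))"
      using p0 r by (intro cis2pi_cong) (auto simp: cong_def mod_minus_eq mod_mult_left_eq intro: mod_mult_cong mod_minus_cong)
    also have "\<dots> = cis2pi (of_int (x * (- int lam)) / of_nat r) * cis2pi (of_int (y * (- int lam)) / of_nat p)"
      by (rule cis2pi_crt[OF r p0])
    finally have 1: "cis2pi (of_int (- ((x * int p + y * int r) mod int (r * p)) * int lam) / of_nat (r * p)) = cis2pi (of_int (- x * int lam) / of_nat r) * cis2pi (of_int (y * (- int lam)) / of_nat p)"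
      by simp
    have "(\<Prod>i<d. cong_gauss p (r * p) ((x * int p + y * int r) mod int (r * p)) (a i) 0 / of_nat (r * p)) =
       (\<Prod>i<d. cis2pi (of_int (y * (a i)\<^sup>2) / of_nat p) * (quad_gauss x r / of_nat (r * p)))"
      unfolding cong_gauss_prime_factor[OF p0 r cop] by simp
    also have "\<dots> = cis2pi (of_int (y * norm_sq d a) / of_nat p) * (quad_gauss x r / of_nat (r * p)) ^ d"
      by (simp only: prod.distrib prod_cis2pi[OF finite_lessThan] prod_constant card_lessThan norm_sq_def
          sum_distrib_left sum_divide_distrib of_int_sum)
    also have "cis2pi (of_int (y * norm_sq d a) / of_nat p) = cis2pi (of_int (y * int lam) / of_nat p)"
      using p0 a by (intro cis2pi_cong cong_mult cong_refl) auto
    finally have 2: "(\<Prod>i<d. cong_gauss p (r * p) ((x * int p + y * int r) mod int (r * p)) (a i) 0 / of_nat (r * p)) =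
       cis2pi (of_int (y * int lam) / of_nat p) * (quad_gauss x r / of_nat (r * p)) ^ d" .
    have 3: "cis2pi (of_int (y * (- int lam)) / of_nat p) * cis2pi (of_int (y * int lam) / of_nat p) = 1"
      by (simp flip: cis2pi_add)
    have "cis2pi (of_int (- x * int lam) / of_nat r) * cis2pi (of_int (y * (- int lam)) / of_nat p) * (cis2pi (of_int (y * int lam) / of_nat p) * (quad_gauss x r / of_nat (r * p)) ^ d) =
       (cis2pi (of_int (y * (- int lam)) / of_nat p) * cis2pi (of_int (y * int lam) / of_nat p)) * (cis2pi (of_int (- x * int lam) / of_nat r) * (quad_gauss x r / of_nat (r * p)) ^ d)"
      by (simp only: mult_ac)
    then show ?thesis unfolding 1 2 unfolding 3 by (simp add: power_divide power_mult_distrib)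
  qed
  have "card (unit_residues p) = p - 1" by (simp add: unit_residues_prime[OF p])
  then show ?thesis
    unfolding local_term_def sum_crt(2)[OF r p0 cop'] lcm factor QR_conv_quad_gauss
    by (simp add: sum_divide_distrib sum_distrib_left)
qed

text \<open>Shifting \<open>j\<close> by \<open>M = q / p^2\<close> permutes the residues modulo
  \<open>N = p * M\<close> and multiplies every term by the constant \<open>w\<close>, the character
  of \<open>2 * h * b\<close> modulo \<open>p\<close>. As \<open>w \<noteq> 1\<close> for odd
  \<open>p\<close>, the sum is zero.\<close>

lemma cong_gauss_square_factor:
  assumes p: "prime p" "odd p" and q: "q > 0" "p ^ 2 dvd q" and h: "coprime h (int q)" and b: "\<not> int p dvd b"
  shows "cong_gauss p q h b 0 = 0"
proof -
  have p0: "p > 0" using p by (simp add: prime_gt_0_nat)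
  have pq: "p dvd q" using q(2) by (metis dvd_mult_left power2_eq_square)
  then have g: "gcd p q = p" by (simp add: gcd_nat.absorb1)
  define M where "M = q div p ^ 2"
  have qM: "q = p * (p * M)" unfolding M_def using q(2) by (simp add: power2_eq_square mult.assoc[symmetric])
  have M: "M > 0" using qM q(1) by (metis gr0I mult_0_right)
  define N where "N = p * M"
  have N: "q div gcd p q = N" "N > 0" using p0 M unfolding g qM N_def by auto
  define f where "f = (\<lambda>j. cis2pi (of_int (h * int p * j\<^sup>2 + 2 * h * b * j) / of_nat N))"
  have S: "cong_gauss p q h b 0 = cis2pi (of_int (h * b\<^sup>2) / of_nat q) * (\<Sum>j\<in>residue_set N. f j)"
    unfolding cong_gauss_quadratic[OF p0 q(1)] N(1) unfolding g f_def using p0 by simp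
  have per: "f (j mod int N) = f j" for j
    unfolding f_def using N(2) by (intro cis2pi_cong cong_add cong_mult cong_pow cong_refl) (auto simp: cong_def)
  define w where "w = cis2pi (of_int (2 * h * b) / of_nat p)"
  have "f (1 * j + int M) = f j * w" for j
  proof -
    have "of_int (h * int p * (1 * j + int M)\<^sup>2 + 2 * h * b * (1 * j + int M)) / of_nat N =
       of_int (h * int p * j\<^sup>2 + 2 * h * b * j) / of_nat N + of_int (2 * h * b) / of_nat p + real_of_int (h * (2 * j + int M))"
      using p0 M by (simp add: N_def field_simps power2_eq_square)
    then show ?thesis unfolding f_def w_def by (simp only: cis2pi_add cis2pi_int mult_1_right)
  qed
  moreover have "(\<Sum>j\<in>residue_set N. f (1 * j + int M)) = (\<Sum>j\<in>residue_set N. f j)"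
    by (rule sum_residue_affine) (use N(2) per in auto)
  ultimately have "(\<Sum>j\<in>residue_set N. f j) * w = (\<Sum>j\<in>residue_set N. f j)"
    by (simp add: sum_distrib_right)
  moreover have "w \<noteq> 1"
  proof
    assume "w = 1"
    then have "cis2pi (of_int (2 * h * b) / of_nat p) = cis2pi 0" by (simp add: w_def)
    then obtain n :: int where "of_int (2 * h * b) / of_nat p = (of_int n :: real)" unfolding cis2pi_eq_iff by auto
    then have "real_of_int (2 * h * b) = real_of_int (n * int p)" using p0 by (simp add: field_simps)
    then have "2 * h * b = n * int p" by (simp only: of_int_eq_iff)
    then have "int p dvd 2 * h * b" by simp
    moreover have "prime (int p)" using p by simp
    ultimately have "int p dvd 2 \<or> int p dvd h" using b by (simp add: prime_dvd_mult_iff)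
    moreover have "\<not> int p dvd 2"
    proof
      assume "int p dvd 2"
      then have "int p \<le> 2" by (rule zdvd_imp_le) simp
      then have "p = 2" using prime_gt_1_nat[OF p(1)] by linarith
      then show False using p(2) by simp
    qed
    moreover have "\<not> int p dvd h"
    proof
      assume "int p dvd h"
      moreover have "int p dvd int q" using pq by simp
      ultimately have "is_unit (int p)" using h by (meson coprime_common_divisor)
      then show False using prime_gt_1_nat[OF p(1)] by simp
    qed
    ultimately show False by simp
  qed
  ultimately show ?thesis unfolding S by simp
qed

lemma local_term_square_factor:
  assumes p: "prime p" "odd p" and q: "q > 0" "p ^ 2 dvd q"
    and a: "[norm_sq d a = int lam] (mod int p)" and lam: "\<not> p dvd lam"
  shows "local_term d p q lam a = 0"
proof -
  have "\<exists>i<d. \<not> int p dvd a i"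
  proof (rule ccontr)
    assume "\<not> (\<exists>i<d. \<not> int p dvd a i)"
    then have "int p dvd norm_sq d a" unfolding norm_sq_def by (intro dvd_sum) (auto simp: power2_eq_square)
    then have "int p dvd int lam" using a by (simp add: cong_dvd_iff)
    then show False using lam by simp
  qed
  then obtain i where i: "i < d" "\<not> int p dvd a i" by blast
  have zero: "(\<Prod>i<d. cong_gauss p q h (a i) 0 / of_nat (lcm p q)) = 0" if "h \<in> unit_residues q" for h
    using cong_gauss_square_factor[OF p q _ i(2), of h] that i(1) by (intro prod_zero) (auto simp: unit_residues_def)
  show ?thesis unfolding local_term_def by (intro sum.neutral ballI) (simp only: zero mult_zero_right)
qed

section \<open>The singular series\<close>

lemma norm_infsum_le_has_sum:
  fixes f :: "'a \<Rightarrow> 'b::banach"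
  assumes "(g has_sum S) A" "\<And>x. x \<in> A \<Longrightarrow> norm (f x) \<le> g x"
  shows "norm (infsum f A) \<le> S"
proof -
  have g: "g summable_on A" using assms(1) by (auto simp: summable_on_def)
  have f: "(\<lambda>x. norm (f x)) summable_on A" by (rule Infinite_Sum.abs_summable_on_comparison_test'[OF g assms(2)])
  have "norm (infsum f A) \<le> infsum (\<lambda>x. norm (f x)) A" by (rule norm_infsum_bound[OF f])
  also have "\<dots> \<le> infsum g A" by (rule infsum_mono[OF f g assms(2)])
  finally show ?thesis using infsumI[OF assms(1)] by simp
qed

text \<open>\<open>c\<close> stands for 2 in general and for 1 when \<open>r\<close> is odd,
  matching the two parts of \<open>norm_quad_gauss\<close>.\<close>

lemma norm_QR_le:
  assumes r: "r > 0" and c: "\<And>a. a \<in> unit_residues r \<Longrightarrow> norm (quad_gauss a r) \<le> sqrt (c * real r)"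
  shows "norm (QR d r lam) \<le> real (card (unit_residues r)) * sqrt (c / real r) ^ d"
proof -
  have "norm (QR d r lam) \<le> (\<Sum>a\<in>unit_residues r. norm (cis2pi (of_int (- a * int lam) / of_nat r) * (quad_gauss a r / of_nat r) ^ d))"
    unfolding QR_conv_quad_gauss by (rule norm_sum)
  also have "\<dots> \<le> (\<Sum>a\<in>unit_residues r. sqrt (c / real r) ^ d)"
  proof (rule sum_mono)
    fix a assume a: "a \<in> unit_residues r"
    have "norm (quad_gauss a r) / real r \<le> sqrt (c * real r) / real r"
      by (intro divide_right_mono c a) simp
    also have "\<dots> = sqrt (c / real r)" using r
      by (simp add: real_sqrt_divide real_sqrt_mult field_simps)
    finally show "norm (cis2pi (of_int (- a * int lam) / of_nat r) * (quad_gauss a r / of_nat r) ^ d) \<le> sqrt (c / real r) ^ d"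
      by (simp add: norm_mult norm_power norm_divide power_mono)
  qed
  finally show ?thesis by simp
qed

lemma card_unit_residues_le: "card (unit_residues r) \<le> r"
  using card_mono[of "residue_set r" "unit_residues r"] by (auto simp: unit_residues_def)

lemma inverse_sqrt_power_5:
  assumes "x > (0::real)"
  shows "x * sqrt (1 / x) ^ 5 = x powr (-3/2)"
proof -
  have "sqrt (1 / x) = x powr (-1/2)"
    using assms by (simp add: powr_half_sqrt[symmetric] powr_divide powr_minus_divide)
  then have "x * sqrt (1 / x) ^ 5 = x powr 1 * x powr (-5/2)"
    using assms by (simp add: powr_power)
  also have "\<dots> = x powr (1 + -5/2)" by (rule powr_add[symmetric])
  finally show ?thesis by simp
qed

text \<open>Dimension 5 is the worst case. The trivial count of at most \<open>r\<close> units
  against \<open>d\<close> factors of size \<open>r powr (-1/2)\<close> leaves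
  \<open>r powr (-3/2)\<close>, which is summable.\<close>

lemma inverse_sqrt_power_le:
  assumes "x \<ge> (1::real)" "d \<ge> 5"
  shows "x * sqrt (1 / x) ^ d \<le> x powr (-3/2)"
proof -
  have "sqrt (1 / x) ^ d \<le> sqrt (1 / x) ^ 5" using assms by (intro power_decreasing) auto
  then have "x * sqrt (1 / x) ^ d \<le> x * sqrt (1 / x) ^ 5" using assms by (intro mult_left_mono) auto
  then show ?thesis using assms by (simp add: inverse_sqrt_power_5)
qed

lemma norm_QR_bound:
  assumes d: "d \<ge> 5" and r: "r > 0"
  shows "norm (QR d r lam) \<le> sqrt 2 ^ d * real r powr (-3/2)"
proof -
  have "norm (QR d r lam) \<le> real (card (unit_residues r)) * sqrt (2 / real r) ^ d"
    by (rule norm_QR_le[OF r]) (use norm_quad_gauss(1)[OF r] in \<open>auto simp: unit_residues_def\<close>)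
  also have "\<dots> \<le> real r * sqrt (2 / real r) ^ d"
    using card_unit_residues_le[of r] by (intro mult_right_mono) auto
  also have "\<dots> = sqrt 2 ^ d * (real r * sqrt (1 / real r) ^ d)"
    by (simp add: real_sqrt_divide power_divide)
  also have "\<dots> \<le> sqrt 2 ^ d * real r powr (-3/2)"
    using d r by (intro mult_left_mono inverse_sqrt_power_le) auto
  finally show ?thesis .
qed

lemma norm_QR_bound_odd:
  assumes d: "d \<ge> 5" and r: "odd r"
  shows "norm (QR d r lam) \<le> real r powr (-3/2)"
proof -
  have r0: "r > 0" using r by (auto intro: Nat.gr0I)
  have "norm (QR d r lam) \<le> real (card (unit_residues r)) * sqrt (1 / real r) ^ d"
    by (rule norm_QR_le[OF r0]) (use norm_quad_gauss(2)[OF r0 _ r] in \<open>auto simp: unit_residues_def\<close>)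
  also have "\<dots> \<le> real r * sqrt (1 / real r) ^ d"
    using card_unit_residues_le[of r] by (intro mult_right_mono) auto
  also have "\<dots> \<le> real r powr (-3/2)"
    using d r0 by (intro inverse_sqrt_power_le) auto
  finally show ?thesis .
qed

lemma QR_1: "QR d 1 lam = 1"
proof -
  have "residue_set 1 = {0}" by (auto simp: residue_set_def)
  then have "quad_gauss 0 1 = 1" "unit_residues 1 = {0}" by (auto simp: quad_gauss_def unit_residues_def)
  then show ?thesis by (simp add: QR_conv_quad_gauss)
qed

text \<open>The Gauss sum is \<open>1 + cis2pi (1 / 2) = 0\<close>. The estimate
  \<open>norm_QR_bound_2\<close> gives only 1 for this term and would leave no room in the Euler
  factor at 2.\<close>

lemma QR_2:
  assumes "d > 0"
  shows "QR d 2 lam = 0"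
proof -
  have r: "residue_set 2 = {0, 1}" by (auto simp: residue_set_def)
  then have "unit_residues 2 = {1}" by (auto simp: unit_residues_def)
  moreover have "quad_gauss 1 2 = 0" by (simp add: quad_gauss_def r cis2pi_conv_cis)
  ultimately show ?thesis using assms by (simp add: QR_conv_quad_gauss)
qed

lemma card_unit_residues_2: "card (unit_residues (2 ^ Suc k)) \<le> 2 ^ k"
proof -
  have "unit_residues (2 ^ Suc k) \<subseteq> (\<lambda>i. 2 * i + 1) ` {0..<2 ^ k}"
  proof
    fix a assume "a \<in> unit_residues (2 ^ Suc k)"
    then have a: "0 \<le> a" "a < 2 ^ Suc k" "odd a" by (auto simp: unit_residues_def residue_set_def)
    then obtain i where "a = 2 * i + 1" by (elim oddE)
    then show "a \<in> (\<lambda>i. 2 * i + 1) ` {0..<2 ^ k}" using a by auto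
  qed
  then have "card (unit_residues (2 ^ Suc k)) \<le> card ((\<lambda>i::int. 2 * i + 1) ` {0..<2 ^ k})"
    by (intro card_mono) auto
  also have "\<dots> \<le> card {0..<2 ^ k :: int}" by (rule card_image_le) simp
  also have "\<dots> = 2 ^ k" by (simp add: nat_power_eq)
  finally show ?thesis .
qed

text \<open>The 2 in the Gauss sum bound cancels one power of the modulus, and only half of the
  residues are odd. So \<open>2 ^ Suc k\<close> is estimated like an odd modulus of size
  \<open>2 ^ k\<close>, without the constant \<open>sqrt 2 ^ d\<close>.\<close>

lemma norm_QR_bound_2:
  assumes d: "d \<ge> 5"
  shows "norm (QR d (2 ^ Suc k) lam) \<le> (2 powr (-3/2)) ^ k"
proof -
  have "norm (QR d (2 ^ Suc k) lam) \<le> real (card (unit_residues (2 ^ Suc k))) * sqrt (2 / real (2 ^ Suc k)) ^ d"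
    by (rule norm_QR_le) (use norm_quad_gauss(1)[of "2 ^ Suc k"] in \<open>auto simp: unit_residues_def\<close>)
  also have "\<dots> \<le> 2 ^ k * sqrt (2 / real (2 ^ Suc k)) ^ d"
    using card_unit_residues_2[of k] by (intro mult_right_mono) (auto simp flip: of_nat_le_iff)
  also have "2 / real (2 ^ Suc k) = 1 / 2 ^ k" by simp
  also have "2 ^ k * sqrt (1 / 2 ^ k) ^ d \<le> (2 ^ k) powr (-3/2 :: real)"
    using d by (intro inverse_sqrt_power_le) auto
  also have "\<dots> = (2 powr (-3/2)) ^ k" by (simp add: powr_power mult.commute flip: powr_realpow)
       (simp add: powr_powr mult.commute)
  finally show ?thesis .
qed

lemma QR_abs_summable:
  assumes "d \<ge> 5"
  shows "(\<lambda>r. norm (QR d r lam)) summable_on {1..}"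
proof (rule Infinite_Sum.abs_summable_on_comparison_test')
  have "(\<lambda>r::nat. real r powr (-3/2)) summable_on UNIV"
    by (subst summable_on_UNIV_nonneg_real_iff) (auto simp: summable_real_powr_iff)
  then show "(\<lambda>r::nat. sqrt 2 ^ d * real r powr (-3/2)) summable_on {1..}"
    by (intro summable_on_cmult_right) (auto intro: summable_on_subset)
qed (use norm_QR_bound[OF assms] in auto)

text \<open>
  With \<open>x = 2 powr (-3/2)\<close> the powers of 2 contribute at most \<open>x / (1 - x) \<le> 3/5\<close>, because \<open>QR 2\<close> vanishes;
  an odd prime contributes at most \<open>y / (1 - y) \<le> 5/4 * y\<close>, where \<open>y = p powr (-3/2) \<le> 1/5\<close>.
\<close>

definition euler_gap :: "nat \<Rightarrow> real" where
  "euler_gap p = (if p = 2 then 3/5 else 5/4 * real p powr (-3/2))"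

lemma norm_QR_prime_powers:
  assumes d: "d \<ge> 5" and p: "prime p"
  shows "norm (\<Sum>\<^sub>\<infinity>k\<in>{1..}. QR d (p ^ k) lam) \<le> euler_gap p"
proof (cases "p = 2")
  case True
  define x :: real where "x = 2 powr (-3/2)"
  have x: "x > 0" "x < 1" by (simp_all add: x_def powr_less_one)
  have "x ^ 2 = 2 powr (- 3)" unfolding x_def by (subst powr_power) auto
  also have "\<dots> = 1 / 8" by (simp add: powr_minus_divide)
  finally have x2: "x ^ 2 = 1 / 8" .
  \<comment> \<open>\<open>x^2 = 8/64 < 9/64\<close>, and \<open>(3/8) / (5/8)\<close> is the
    constant \<open>3/5\<close> of \<open>euler_gap\<close>.\<close>
  have "x \<le> 3 / 8"
    by (rule power2_le_imp_le) (auto simp: x2 power_divide)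
  then have le: "x / (1 - x) \<le> 3 / 5" using x by (simp add: field_simps)
  have "Suc ` {1..} = {2..}"
  proof (intro equalityI subsetI)
    fix n :: nat assume "n \<in> {2..}"
    then have "n = Suc (n - 1)" "n - 1 \<in> {1..}" by auto
    then show "n \<in> Suc ` {1..}" by blast
  qed auto
  have "(\<Sum>\<^sub>\<infinity>k\<in>{1..}. QR d (p ^ k) lam) = (\<Sum>\<^sub>\<infinity>k\<in>Suc ` {1..}. QR d (p ^ k) lam)"
  proof (rule infsum_cong_neutral)
    fix k assume "k \<in> {1..} - Suc ` {1..}"
    then have "k = 1" using \<open>Suc ` {1..} = {2..}\<close> by auto
    then show "QR d (p ^ k) lam = 0" using QR_2[of d lam] d True by simp
  qed auto
  also have "\<dots> = (\<Sum>\<^sub>\<infinity>k\<in>{1..}. QR d (2 ^ Suc k) lam)"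
    using True by (subst infsum_reindex) (auto simp: o_def)
  also have "norm \<dots> \<le> x / (1 - x)"
    by (rule norm_infsum_le_has_sum[OF has_sum_geometric_from_1])
       (use x norm_QR_bound_2[OF d] in \<open>auto simp: x_def simp del: power_Suc\<close>)
  finally have "norm (\<Sum>\<^sub>\<infinity>k\<in>{1..}. QR d (p ^ k) lam) \<le> 3 / 5" using le by (rule order_trans)
  moreover have "euler_gap p = 3 / 5" by (simp add: euler_gap_def True)
  ultimately show ?thesis by (simp only:)
next
  case False
  define y where "y = real p powr (-3/2)"
  have "odd p" using primes_dvd_imp_eq[OF two_is_prime_nat p] False by blast
  have "p \<ge> 3" using p False prime_ge_2_nat[of p] by simp
  have y0: "y > 0" using \<open>p \<ge> 3\<close> by (simp add: y_def)
  have "y \<le> 3 powr (-3/2)" unfolding y_def using \<open>p \<ge> 3\<close> by (intro powr_mono2') auto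
  also have "3 powr (-3/2) \<le> (1 / 5 :: real)"
  proof (rule power2_le_imp_le)
    show "(3 powr (-3/2))\<^sup>2 \<le> (1 / 5 :: real)\<^sup>2" by (simp add: powr_power powr_minus_divide power_divide)
  qed simp
  finally have y: "y \<le> 1 / 5" .
  have "norm (\<Sum>\<^sub>\<infinity>k\<in>{1..}. QR d (p ^ k) lam) \<le> y / (1 - y)"
  proof (rule norm_infsum_le_has_sum[OF has_sum_geometric_from_1])
    show "norm y < 1" using y0 y by simp
    fix k :: nat
    have "norm (QR d (p ^ k) lam) \<le> real (p ^ k) powr (-3/2)"
      using \<open>odd p\<close> by (intro norm_QR_bound_odd d) simp
    also have "\<dots> = y ^ k" using \<open>p \<ge> 3\<close> by (simp add: y_def powr_power mult.commute flip: powr_realpow)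
       (simp add: powr_powr mult.commute)
    finally show "norm (QR d (p ^ k) lam) \<le> y ^ k" .
  qed
  also have "\<dots> \<le> 5 / 4 * y" using y0 y by (simp add: field_simps)
  finally show ?thesis using False by (simp add: euler_gap_def y_def)
qed

section \<open>Euler product over finite sets of primes\<close>

definition smooth :: "nat set \<Rightarrow> nat set" where
  "smooth T = {r. r \<ge> 1 \<and> prime_factors r \<subseteq> T}"

text \<open>Zero has an empty set of prime factors too; \<open>r \<ge> 1\<close> in the definition
  keeps it out.\<close>

lemma smooth_empty: "smooth {} = {1}"
  by (auto simp: smooth_def prime_factorization_empty_iff)

lemma smooth_insert_bij:
  assumes p: "prime p" and T: "p \<notin> T"
  shows "bij_betw (\<lambda>(r, k). r * p ^ k) (smooth T \<times> UNIV) (smooth (insert p T))"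
proof -
  have p1: "p > 1" using p by (rule prime_gt_1_nat)
  have nd: "\<not> p dvd r" if "r \<in> smooth T" for r
    using that T p by (auto simp: smooth_def prime_factors_dvd)
  have mult: "multiplicity p (r * p ^ k) = k" if r: "r \<in> smooth T" for r k
  proof -
    have "r \<noteq> 0" using r by (auto simp: smooth_def)
    then show ?thesis
      using p nd[OF r] by (simp add: prime_elem_multiplicity_mult_distrib not_dvd_imp_multiplicity_0)
  qed
  have in_smooth: "r * p ^ k \<in> smooth (insert p T)" if r: "r \<in> smooth T" for r k
  proof -
    have "prime_factors (r * p ^ k) \<subseteq> prime_factors r \<union> prime_factors (p ^ k)"
      using p1 r by (subst prime_factors_product) (auto simp: smooth_def)
    also have "prime_factors (p ^ k) \<subseteq> {p}"
    proof
      fix q assume "q \<in> prime_factors (p ^ k)"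
      then have q: "prime q" "q dvd p ^ k" by (auto simp: in_prime_factors_iff)
      then have "q dvd p" by (rule prime_dvd_power)
      then show "q \<in> {p}" using primes_dvd_imp_eq[OF q(1) p] by simp
    qed
    finally show ?thesis using r p1 by (auto simp: smooth_def)
  qed
  have div_smooth: "n div p ^ multiplicity p n \<in> smooth T" if n: "n \<in> smooth (insert p T)" for n
  proof -
    have n0: "n \<noteq> 0" using n by (auto simp: smooth_def)
    define m where "m = n div p ^ multiplicity p n"
    have nm: "n = p ^ multiplicity p n * m" by (simp add: m_def multiplicity_dvd)
    have m0: "m \<noteq> 0" using nm n0 by (metis mult_0_right)
    have "\<not> p dvd m"
      unfolding m_def using n0 p1 by (intro multiplicity_decompose) auto
    then have "p \<notin> prime_factors m" by (auto simp: in_prime_factors_iff)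
    moreover have "prime_factors m \<subseteq> prime_factors n" using nm n0 by (metis dvd_prime_factors dvd_triv_right)
    moreover have "prime_factors n \<subseteq> insert p T" using n by (simp add: smooth_def)
    ultimately have "prime_factors m \<subseteq> T" by blast
    then show ?thesis using m0 by (fold m_def) (simp add: smooth_def)
  qed
  show ?thesis
    by (rule bij_betw_byWitness[where f' = "\<lambda>n. (n div p ^ multiplicity p n, multiplicity p n)"])
       (use p1 mult in_smooth div_smooth in \<open>auto simp: multiplicity_dvd\<close>)
qed

text \<open>Primes are adjoined one at a time, so that only a double series over \<open>r\<close>
  and the exponent \<open>k\<close> has to be rearranged; absolute convergence permits it. The
  \<open>1 +\<close> is the term \<open>k = 0\<close>.\<close>

lemma infsum_QR_smooth_insert:
  assumes d: "d \<ge> 5" and p: "prime p" and T: "p \<notin> T"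
  shows "(\<Sum>\<^sub>\<infinity>r\<in>smooth (insert p T). QR d r lam) = (\<Sum>\<^sub>\<infinity>r\<in>smooth T. QR d r lam) * (1 + (\<Sum>\<^sub>\<infinity>k\<in>{1..}. QR d (p ^ k) lam))"
proof -
  have p0: "p > 0" using p by (simp add: prime_gt_0_nat)
  have sum: "(\<lambda>r. QR d r lam) summable_on A" if "A \<subseteq> {1..}" for A
    using abs_summable_summable[OF QR_abs_summable[OF d]] that by (rule summable_on_subset)
  have QRm: "QR d (r * p ^ k) lam = QR d r lam * QR d (p ^ k) lam" if "r \<in> smooth T" for r k
  proof (rule QR_mult)
    show "r > 0" using that by (auto simp: smooth_def)
    have "\<not> p dvd r" using that T p by (auto simp: smooth_def prime_factors_dvd)
    then show "coprime r (p ^ k)" using p by (simp add: prime_imp_coprime coprime_commute)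
  qed (use p0 in simp)
  have sm: "(\<lambda>z. QR d (case z of (r, k) \<Rightarrow> r * p ^ k) lam) summable_on smooth T \<times> UNIV"
    using summable_on_reindex_bij_betw[OF smooth_insert_bij[OF p T], of "\<lambda>n. QR d n lam"] sum[of "smooth (insert p T)"]
    by (auto simp: smooth_def)
  have "(\<Sum>\<^sub>\<infinity>r\<in>smooth (insert p T). QR d r lam) = (\<Sum>\<^sub>\<infinity>z\<in>smooth T \<times> UNIV. QR d (case z of (r, k) \<Rightarrow> r * p ^ k) lam)"
    by (rule infsum_reindex_bij_betw[OF smooth_insert_bij[OF p T], symmetric])
  also have "\<dots> = (\<Sum>\<^sub>\<infinity>r\<in>smooth T. \<Sum>\<^sub>\<infinity>k. QR d (r * p ^ k) lam)"
    using infsum_Sigma_banach[OF sm] by simp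
  also have "\<dots> = (\<Sum>\<^sub>\<infinity>r\<in>smooth T. QR d r lam * (\<Sum>\<^sub>\<infinity>k. QR d (p ^ k) lam))"
    by (intro infsum_cong) (simp add: QRm infsum_cmult_right')
  also have "\<dots> = (\<Sum>\<^sub>\<infinity>r\<in>smooth T. QR d r lam) * (\<Sum>\<^sub>\<infinity>k. QR d (p ^ k) lam)"
    by (rule infsum_cmult_left')
  also have "(\<Sum>\<^sub>\<infinity>k. QR d (p ^ k) lam) = 1 + (\<Sum>\<^sub>\<infinity>k\<in>{1..}. QR d (p ^ k) lam)"
  proof -
    have "inj_on (\<lambda>k. p ^ k) {1..}" using prime_gt_1_nat[OF p] by (auto intro!: inj_onI)
    moreover have "(\<lambda>k. p ^ k) ` {1..} \<subseteq> {1..}" using p0 by auto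
    ultimately have "(\<lambda>k. QR d (p ^ k) lam) summable_on {1..}"
      using sum summable_on_reindex[of "\<lambda>k. p ^ k" "{1..}" "\<lambda>r. QR d r lam"] by (simp add: o_def)
    moreover have "(UNIV :: nat set) = insert 0 {1..}" by auto
    ultimately show ?thesis using infsum_insert[of "\<lambda>k. QR d (p ^ k) lam" "{1..}" 0] QR_1[of d lam] by simp
  qed
  finally show ?thesis .
qed

lemma euler_gap_bounds:
  assumes "prime p"
  shows "0 \<le> euler_gap p" "euler_gap p \<le> 1"
proof -
  show "0 \<le> euler_gap p" by (simp add: euler_gap_def)
  show "euler_gap p \<le> 1"
  proof (cases "p = 2")
    case False
    then have "p \<ge> 3" using prime_ge_2_nat[OF assms] by simp
    then have "real p powr (-3/2) \<le> 3 powr (-3/2)" by (intro powr_mono2') auto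
    also have "\<dots> \<le> (4/5 :: real)"
      by (rule power2_le_imp_le) (auto simp: powr_power powr_minus_divide power_divide)
    finally show ?thesis by (simp add: euler_gap_def)
  qed (simp add: euler_gap_def)
qed

text \<open>Each Euler factor satisfies \<open>norm (1 + z) \<ge> 1 - norm z\<close>; since
  \<open>euler_gap\<close> is at most 1, these lower bounds are nonnegative and may be
  multiplied.\<close>

lemma norm_QR_smooth_ge:
  assumes d: "d \<ge> 5" and T: "finite T" "\<And>p. p \<in> T \<Longrightarrow> prime p"
  shows "norm (\<Sum>\<^sub>\<infinity>r\<in>smooth T. QR d r lam) \<ge> (\<Prod>p\<in>T. 1 - euler_gap p)"
  using T
proof (induction T rule: finite_induct)
  case empty
  then show ?case using QR_1[of d lam] by (simp add: smooth_empty)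
next
  case (insert p T)
  have "norm (1 + (\<Sum>\<^sub>\<infinity>k\<in>{1..}. QR d (p ^ k) lam)) \<ge> norm (1::complex) - norm (\<Sum>\<^sub>\<infinity>k\<in>{1..}. QR d (p ^ k) lam)"
    by (rule norm_diff_ineq)
  then have "norm (1 + (\<Sum>\<^sub>\<infinity>k\<in>{1..}. QR d (p ^ k) lam)) \<ge> 1 - euler_gap p"
    using norm_QR_prime_powers[OF d, of p lam] insert by simp
  then have "(1 - euler_gap p) * (\<Prod>p\<in>T. 1 - euler_gap p) \<le> norm (1 + (\<Sum>\<^sub>\<infinity>k\<in>{1..}. QR d (p ^ k) lam)) * norm (\<Sum>\<^sub>\<infinity>r\<in>smooth T. QR d r lam)"
    using insert euler_gap_bounds(2) by (intro mult_mono) (auto intro!: prod_nonneg)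
  then show ?case using insert by (simp add: infsum_QR_smooth_insert[OF d] norm_mult mult.commute)
qed

text \<open>With \<open>a = sqrt (x - 1)\<close> and \<open>b = sqrt (x + 1)\<close> the right side
  is \<open>2 / (a * b * (a + b))\<close>, and \<open>a * b \<le> x\<close>,
  \<open>a + b \<le> 2 * sqrt x\<close>. The step length 2 fits a sum over odd numbers.\<close>

lemma powr_three_halves_telescope:
  assumes "x > (1::real)"
  shows "x powr (-3/2) \<le> 1 / sqrt (x - 1) - 1 / sqrt (x + 1)"
proof -
  define a b s where "a = sqrt (x - 1)" and "b = sqrt (x + 1)" and "s = sqrt x"
  have ab: "a > 0" "b > 0" "s > 0" "a\<^sup>2 = x - 1" "b\<^sup>2 = x + 1" "s\<^sup>2 = x" using assms by (auto simp: a_def b_def s_def)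
  have "x powr (-3/2) = 1 / (x * s)"
  proof -
    have "x powr (3/2) = x powr (1 + 1/2)" by simp
    also have "\<dots> = x * s" unfolding powr_add using assms by (simp add: powr_half_sqrt s_def)
    finally show ?thesis by (simp add: powr_minus_divide)
  qed
  also have "\<dots> \<le> 2 / (a * b * (a + b))"
  proof -
    have 1: "a * b \<le> x"
    proof (rule power2_le_imp_le)
      show "(a * b)\<^sup>2 \<le> x\<^sup>2" unfolding power_mult_distrib ab by (simp add: power2_eq_square algebra_simps)
    qed (use assms in auto)
    have 2: "a + b \<le> 2 * s"
    proof (rule power2_le_imp_le)
      have "(a + b)\<^sup>2 = a\<^sup>2 + b\<^sup>2 + 2 * (a * b)" by (simp add: power2_sum)
      then show "(a + b)\<^sup>2 \<le> (2 * s)\<^sup>2" unfolding power_mult_distrib ab using 1 by simp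
    qed (use ab in auto)
    have "a * b * (a + b) \<le> x * (2 * s)" using 1 2 ab assms by (intro mult_mono) auto
    then have "2 / (x * (2 * s)) \<le> 2 / (a * b * (a + b))"
      using ab assms by (intro divide_left_mono) auto
    then show ?thesis by simp
  qed
  also have "\<dots> = 1 / a - 1 / b"
  proof -
    have "(b - a) * (a + b) = 2" using ab by (simp add: algebra_simps power2_eq_square)
    then have "2 / (a * b * (a + b)) = (b - a) * (a + b) / (a * b * (a + b))" by simp
    also have "\<dots> = (b - a) / (a * b)" using ab by simp
    also have "\<dots> = 1 / a - 1 / b" using ab by (simp add: field_simps)
    finally show ?thesis .
  qed
  finally show ?thesis by (simp add: a_def b_def)
qed

lemma sum_odd_powr_le:
  "(\<Sum>j=1..M. real (2 * j + 1) powr (-3/2)) \<le> 1 / sqrt 2 - 1 / sqrt (real (2 * M + 2))"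
proof (induction M)
  case (Suc M)
  have "real (2 * Suc M + 1) powr (-3/2) \<le> 1 / sqrt (real (2 * Suc M + 1) - 1) - 1 / sqrt (real (2 * Suc M + 1) + 1)"
    by (rule powr_three_halves_telescope) simp
  also have "real (2 * Suc M + 1) - 1 = real (2 * M + 2)" by simp
  also have "real (2 * Suc M + 1) + 1 = real (2 * Suc M + 2)" by simp
  finally show ?case using Suc by simp
qed simp

text \<open>The odd primes are replaced by all odd numbers from 3 on, for which the sum is at most
  \<open>1 / sqrt 2 \<le> 18 / 25\<close>; times \<open>5 / 4\<close> this is \<open>9 / 10\<close>.
  The prime 2 is kept apart, as \<open>3 / 5 + 9 / 10\<close> exceeds 1, and the result is
  \<open>2/5\<close> times \<open>1/10\<close>.\<close>

lemma prod_euler_gap_ge: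
  assumes T: "finite T" "\<And>p. p \<in> T \<Longrightarrow> prime p"
  shows "(\<Prod>p\<in>T. 1 - euler_gap p) \<ge> 1 / 25"
proof -
  define U where "U = T - {2}"
  have U: "finite U" "\<And>p. p \<in> U \<Longrightarrow> prime p \<and> odd p"
  proof -
    show "finite U" using T by (simp add: U_def)
    fix p assume "p \<in> U"
    then have "prime p" "p \<noteq> 2" using T by (auto simp: U_def)
    then show "prime p \<and> odd p" using primes_dvd_imp_eq[OF two_is_prime_nat] by blast
  qed
  have "(\<Sum>p\<in>U. real p powr (-3/2)) \<le> 1 / sqrt 2"
  proof -
    define M where "M = Max (insert 0 U)"
    have "U \<subseteq> (\<lambda>j. 2 * j + 1) ` {1..M}"
    proof
      fix p assume p: "p \<in> U"
      then obtain j where j: "p = 2 * j + 1" using U(2)[of p] by (auto elim: oddE)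
      have "p \<le> M" using p U(1) by (simp add: M_def)
      moreover have "p > 1" using p U(2) prime_gt_1_nat by blast
      ultimately show "p \<in> (\<lambda>j. 2 * j + 1) ` {1..M}" using j by auto
    qed
    then have "(\<Sum>p\<in>U. real p powr (-3/2)) \<le> (\<Sum>p\<in>(\<lambda>j. 2 * j + 1) ` {1..M}. real p powr (-3/2))"
      by (intro sum_mono2) auto
    also have "\<dots> = (\<Sum>j=1..M. real (2 * j + 1) powr (-3/2))"
      by (subst sum.reindex) (auto simp: inj_on_def)
    also have "\<dots> \<le> 1 / sqrt 2 - 1 / sqrt (real (2 * M + 2))" by (rule sum_odd_powr_le)
    also have "\<dots> \<le> 1 / sqrt 2" by simp
    finally show ?thesis .
  qed
  moreover have "1 / sqrt 2 \<le> (18 / 25 :: real)"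
    by (rule power2_le_imp_le) (auto simp: power_divide)
  moreover have "(\<Sum>p\<in>U. euler_gap p) = 5 / 4 * (\<Sum>p\<in>U. real p powr (-3/2))"
    unfolding sum_distrib_left by (intro sum.cong refl) (simp add: euler_gap_def U_def)
  ultimately have "(\<Sum>p\<in>U. euler_gap p) \<le> 9 / 10" by simp
  moreover have "1 - (\<Sum>p\<in>U. euler_gap p) \<le> (\<Prod>p\<in>U. 1 - euler_gap p)"
    by (rule Weierstrass_prod_ineq) (use euler_gap_bounds U(2) in auto)
  ultimately have 1: "(\<Prod>p\<in>U. 1 - euler_gap p) \<ge> 1 / 10" by linarith
  show ?thesis
  proof (cases "2 \<in> T")
    case True
    then have "(\<Prod>p\<in>T. 1 - euler_gap p) = (1 - euler_gap 2) * (\<Prod>p\<in>U. 1 - euler_gap p)"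
      using T(1) by (simp add: U_def prod.remove)
    then show ?thesis using 1 by (simp add: euler_gap_def)
  next
    case False
    then have "U = T" by (simp add: U_def)
    then show ?thesis using 1 by simp
  qed
qed

text \<open>A finite set \<open>F\<close> of moduli carries the absolute series up to
  \<open>e\<close>, and \<open>F\<close> lies in \<open>smooth T\<close> for the finite set
  \<open>T\<close> of its primes. As the lower bound \<open>1 / 25\<close> is the same for every
  \<open>T\<close>, no infinite product has to be formed.\<close>

theorem norm_singular_series_ge:
  assumes d: "d \<ge> 5"
  shows "norm (\<Sum>\<^sub>\<infinity>r\<in>{1..}. QR d r lam) \<ge> 1 / 25"
proof (rule field_le_epsilon)
  fix e :: real assume e: "e > 0"
  define g where "g = (\<lambda>r. norm (QR d r lam))"
  have g: "g summable_on {1..}" unfolding g_def by (rule QR_abs_summable[OF d])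
  have sum: "(\<lambda>r. QR d r lam) summable_on A" if "A \<subseteq> {1..}" for A
    using abs_summable_summable[OF QR_abs_summable[OF d]] that by (rule summable_on_subset)
  have "(g has_sum infsum g {1..}) {1..}" using g by simp
  then have "(sum g \<longlongrightarrow> infsum g {1..}) (finite_subsets_at_top {1..})" by (simp add: has_sum_def)
  then have "eventually (\<lambda>F. dist (sum g F) (infsum g {1..}) < e) (finite_subsets_at_top {1..})"
    using e by (rule tendstoD)
  then obtain F where F: "finite F" "F \<subseteq> {1..}" "dist (sum g F) (infsum g {1..}) < e"
    unfolding eventually_finite_subsets_at_top by blast
  define T where "T = \<Union> (prime_factors ` F)"
  have T: "finite T" "\<And>p. p \<in> T \<Longrightarrow> prime p" using F(1) by (auto simp: T_def)
  have FT: "F \<subseteq> smooth T" using F(2) by (auto simp: smooth_def T_def)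
  have sT: "smooth T \<subseteq> {1..}" by (auto simp: smooth_def)
  have "(\<Sum>\<^sub>\<infinity>r\<in>{1..}. QR d r lam) = (\<Sum>\<^sub>\<infinity>r\<in>smooth T \<union> ({1..} - smooth T). QR d r lam)"
    using sT by (simp add: Un_absorb1)
  also have "\<dots> = (\<Sum>\<^sub>\<infinity>r\<in>smooth T. QR d r lam) + (\<Sum>\<^sub>\<infinity>r\<in>{1..} - smooth T. QR d r lam)"
    by (rule infsum_Un_disjoint) (use sum sT in auto)
  finally have split: "(\<Sum>\<^sub>\<infinity>r\<in>{1..}. QR d r lam) = (\<Sum>\<^sub>\<infinity>r\<in>smooth T. QR d r lam) + (\<Sum>\<^sub>\<infinity>r\<in>{1..} - smooth T. QR d r lam)" .
  have gs: "g summable_on A" if "A \<subseteq> {1..}" for A using g that by (rule summable_on_subset)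
  have "norm (\<Sum>\<^sub>\<infinity>r\<in>{1..} - smooth T. QR d r lam) \<le> infsum g ({1..} - smooth T)"
    using gs[of "{1..} - smooth T"] unfolding g_def by (intro norm_infsum_bound) auto
  also have "\<dots> \<le> infsum g ({1..} - F)"
    by (rule infsum_mono2) (use gs FT in \<open>auto simp: g_def\<close>)
  also have "infsum g ({1..} - F) = infsum g {1..} - sum g F"
  proof -
    have "infsum g (F \<union> ({1..} - F)) = infsum g F + infsum g ({1..} - F)"
      by (rule infsum_Un_disjoint) (use gs F in auto)
    then show ?thesis using F(1,2) by (simp add: Un_absorb1)
  qed
  also have "\<dots> \<le> e" using F(3) by (simp add: dist_real_def)
  finally have "norm (\<Sum>\<^sub>\<infinity>r\<in>smooth T. QR d r lam) \<le> norm (\<Sum>\<^sub>\<infinity>r\<in>{1..}. QR d r lam) + e"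
    using norm_diff_ineq[of "\<Sum>\<^sub>\<infinity>r\<in>smooth T. QR d r lam" "\<Sum>\<^sub>\<infinity>r\<in>{1..} - smooth T. QR d r lam"] unfolding split by linarith
  moreover have "(1 / 25 :: real) \<le> (\<Prod>p\<in>T. 1 - euler_gap p)" by (rule prod_euler_gap_ge[OF T])
  moreover have "\<dots> \<le> norm (\<Sum>\<^sub>\<infinity>r\<in>smooth T. QR d r lam)" by (rule norm_QR_smooth_ge[OF d T])
  ultimately show "1 / 25 \<le> norm (\<Sum>\<^sub>\<infinity>r\<in>{1..}. QR d r lam) + e" by linarith
qed

section \<open>Theta series of a residue class\<close>

definition theta_series :: "nat \<Rightarrow> int \<Rightarrow> complex \<Rightarrow> complex" where
  "theta_series p b z = (\<Sum>\<^sub>\<infinity>m::int. exp (2 * pi * \<i> * z * of_int ((b + int p * m)\<^sup>2)))"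

lemma norm_theta_term: "norm (exp (2 * pi * \<i> * z * of_int n)) = exp (- (2 * pi * Im z) * of_int n)"
  by (simp add: norm_exp_eq_Re)

lemma theta_term_summable:
  assumes "p > 0" "y > 0"
  shows "(\<lambda>m::int. exp (- (2 * pi * y) * of_int ((b + int p * m)\<^sup>2))) summable_on UNIV"
proof -
  have "(\<lambda>m::int. exp (- (2 * pi * y * (real p)\<^sup>2) * (of_int b / real p + of_int m)\<^sup>2)) summable_on UNIV"
    using assms by (intro gauss_shift_summable) auto
  moreover have "(real p)\<^sup>2 * (of_int b / real p + of_int m)\<^sup>2 = of_int ((b + int p * m)\<^sup>2)" for m
    using assms by (simp add: power_mult_distrib[symmetric] distrib_left)
  then have "2 * pi * y * (real p)\<^sup>2 * (of_int b / real p + of_int m)\<^sup>2 = 2 * pi * y * of_int ((b + int p * m)\<^sup>2)" for m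
    by (simp only: mult.assoc)
  ultimately show ?thesis by (simp only: mult_minus_left)
qed

lemma theta_series_abs_summable:
  assumes "p > 0" "Im z > 0"
  shows "(\<lambda>m::int. norm (exp (2 * pi * \<i> * z * of_int ((b + int p * m)\<^sup>2)))) summable_on UNIV"
  unfolding norm_theta_term by (rule theta_term_summable[OF assms])

lemma int_residue_bij:
  assumes "N > 0"
  shows "bij_betw (\<lambda>(j, t). j + int N * t) (residue_set N \<times> UNIV) UNIV"
  by (rule bij_betw_byWitness[where f' = "\<lambda>m. (m mod int N, m div int N)"])
     (use assms in \<open>auto simp: residue_set_def\<close>)

text \<open>Write \<open>m = j + N * t\<close>. Since \<open>p * N = lcm p q\<close> is divisible by
  \<open>q\<close>, the character belonging to \<open>h / q\<close> depends on \<open>j\<close>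
  alone; the sum over \<open>t\<close> is a shifted Gaussian sum of the form treated by
  \<open>theta_inversion\<close>.\<close>

lemma theta_series_split:
  fixes h :: int and w :: complex
  assumes p: "p > 0" and q: "q > 0" and w: "Im w > 0"
  shows "theta_series p b (of_int h / of_nat q + w) =
    (\<Sum>j\<in>residue_set (q div gcd p q). cis2pi (of_int (h * (b + int p * j)\<^sup>2) / of_nat q) *
      (\<Sum>\<^sub>\<infinity>t::int. exp (- (- 2 * \<i> * w * of_nat (lcm p q) ^ 2) * of_real (pi * (of_int (b + int p * j) / of_nat (lcm p q) + of_int t)\<^sup>2))))"
proof -
  define N where "N = q div gcd p q"
  define L where "L = lcm p q"
  have g: "gcd p q > 0" using p by simp
  have qN: "q = gcd p q * N" by (simp add: N_def)
  have N: "N > 0" using qN q by (metis gr0I mult_0_right)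
  have L1: "L = p * N"
    unfolding L_def lcm_nat_def N_def by (simp add: div_mult_swap)
  have L: "L = p * N" "L > 0" using L1 p N by auto
  obtain u where u: "L = q * u" unfolding L_def by (meson dvd_lcm2 dvdE)
  define z where "z = of_int h / of_nat q + w"
  have z: "Im z > 0" using w by (simp add: z_def)
  define f where "f = (\<lambda>m::int. exp (2 * pi * \<i> * z * of_int ((b + int p * m)\<^sup>2)))"
  have f: "f summable_on UNIV" unfolding f_def by (rule abs_summable_summable[OF theta_series_abs_summable[OF p z]])
  have fs: "(\<lambda>x. f (case x of (j, t) \<Rightarrow> j + int N * t)) summable_on residue_set N \<times> UNIV"
    using summable_on_reindex_bij_betw[OF int_residue_bij[OF N], of f] f by simp
  have "theta_series p b z = infsum f UNIV" by (simp add: theta_series_def f_def)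
  also have "\<dots> = (\<Sum>\<^sub>\<infinity>x\<in>residue_set N \<times> UNIV. f (case x of (j, t) \<Rightarrow> j + int N * t))"
    by (rule infsum_reindex_bij_betw[OF int_residue_bij[OF N], symmetric])
  also have "\<dots> = (\<Sum>\<^sub>\<infinity>j\<in>residue_set N. \<Sum>\<^sub>\<infinity>t. f (j + int N * t))"
    using infsum_Sigma_banach[OF fs] by simp
  also have "\<dots> = (\<Sum>j\<in>residue_set N. \<Sum>\<^sub>\<infinity>t. f (j + int N * t))" by simp
  also have "\<dots> = (\<Sum>j\<in>residue_set N. cis2pi (of_int (h * (b + int p * j)\<^sup>2) / of_nat q) *
      (\<Sum>\<^sub>\<infinity>t::int. exp (- (- 2 * \<i> * w * of_nat L ^ 2) * of_real (pi * (of_int (b + int p * j) / of_nat L + of_int t)\<^sup>2))))"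
  proof (rule sum.cong[OF refl])
    fix j
    have "f (j + int N * t) = cis2pi (of_int (h * (b + int p * j)\<^sup>2) / of_nat q) *
        exp (- (- 2 * \<i> * w * of_nat L ^ 2) * of_real (pi * (of_int (b + int p * j) / of_nat L + of_int t)\<^sup>2))" for t
    proof -
      define c where "c = b + int p * j"
      have n: "b + int p * (j + int N * t) = c + int L * t" by (simp add: c_def L(1) distrib_left)
      have e1: "exp (2 * pi * \<i> * (of_int h / of_nat q) * of_int ((c + int L * t)\<^sup>2)) = cis2pi (of_int (h * c\<^sup>2) / of_nat q)"
      proof -
        have "exp (2 * pi * \<i> * (of_int h / of_nat q) * of_int ((c + int L * t)\<^sup>2)) = cis2pi (of_int (h * (c + int L * t)\<^sup>2) / of_nat q)"
          by (simp add: cis2pi_def mult_ac)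
        also have "\<dots> = cis2pi (of_int (h * c\<^sup>2) / of_nat q)"
          using q by (intro cis2pi_cong cong_mult cong_pow cong_refl) (auto simp: cong_def u mult.assoc)
        finally show ?thesis .
      qed
      have sq: "(of_nat L)\<^sup>2 * (of_int c / of_nat L + of_int t)\<^sup>2 = (of_int ((c + int L * t)\<^sup>2) :: real)"
        using L(2) by (simp add: power_mult_distrib[symmetric] distrib_left)
      have "- (- 2 * \<i> * w * of_nat L ^ 2) * of_real (pi * (of_int c / of_nat L + of_int t)\<^sup>2) =
         2 * pi * \<i> * w * of_real ((of_nat L)\<^sup>2 * (of_int c / of_nat L + of_int t)\<^sup>2)" by simp
      also have "\<dots> = 2 * pi * \<i> * w * of_int ((c + int L * t)\<^sup>2)" unfolding sq by simp
      finally have e2: "- (- 2 * \<i> * w * of_nat L ^ 2) * of_real (pi * (of_int c / of_nat L + of_int t)\<^sup>2) = 2 * pi * \<i> * w * of_int ((c + int L * t)\<^sup>2)" .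
      have "f (j + int N * t) = exp (2 * pi * \<i> * (of_int h / of_nat q) * of_int ((c + int L * t)\<^sup>2) + 2 * pi * \<i> * w * of_int ((c + int L * t)\<^sup>2))"
        unfolding f_def n z_def by (simp only: distrib_left distrib_right)
      also have "\<dots> = cis2pi (of_int (h * c\<^sup>2) / of_nat q) * exp (2 * pi * \<i> * w * of_int ((c + int L * t)\<^sup>2))"
        by (simp only: exp_add e1)
      finally show ?thesis unfolding c_def[symmetric] e2 .
    qed
    then show "(\<Sum>\<^sub>\<infinity>t. f (j + int N * t)) = cis2pi (of_int (h * (b + int p * j)\<^sup>2) / of_nat q) *
      (\<Sum>\<^sub>\<infinity>t::int. exp (- (- 2 * \<i> * w * of_nat L ^ 2) * of_real (pi * (of_int (b + int p * j) / of_nat L + of_int t)\<^sup>2)))"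
      by (simp only: infsum_cmult_right')
  qed
  finally show ?thesis by (simp only: z_def N_def L_def)
qed

lemma powr_minus_half_scale:
  assumes "Re z > 0" "(L::nat) > 0"
  shows "(z * of_nat L ^ 2) powr (-1/2) = z powr (-1/2) / of_nat L"
proof -
  have z: "z \<noteq> 0" using assms by auto
  have "(z * of_nat L ^ 2) = of_real ((real L)\<^sup>2) * z" by simp
  then have "Ln (z * of_nat L ^ 2) = of_real (ln ((real L)\<^sup>2)) + Ln z"
    using Ln_times_of_real[of "(real L)\<^sup>2" z] Ln_of_real[of "(real L)\<^sup>2"] z assms(2) by (simp add: mult.commute)
  also have "ln ((real L)\<^sup>2) = 2 * ln (real L)" using assms(2) by (simp add: ln_realpow)
  finally have ln: "(-1/2) * Ln (z * of_nat L ^ 2) = - of_real (ln (real L)) + (-1/2) * Ln z"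
    by (simp add: algebra_simps)
  have "exp (- complex_of_real (ln (real L))) = 1 / of_nat L"
    using assms(2) by (simp add: exp_minus exp_of_real field_simps)
  have "(z * of_nat L ^ 2) powr (-1/2) = exp ((-1/2) * Ln (z * of_nat L ^ 2))"
    using z assms(2) by (simp only: powr_def) simp
  also have "\<dots> = exp (- of_real (ln (real L))) * exp ((-1/2) * Ln z)" unfolding ln exp_add ..
  also have "exp ((-1/2) * Ln z) = z powr (-1/2)" using z by (simp only: powr_def) simp
  finally show ?thesis
    unfolding \<open>exp (- complex_of_real (ln (real L))) = 1 / of_nat L\<close> by simp
qed

lemma has_sum_finite_sum:
  fixes f :: "'a \<Rightarrow> 'b \<Rightarrow> 'c::topological_comm_monoid_add"
  assumes "finite J" "\<And>j. j \<in> J \<Longrightarrow> (f j has_sum S j) A"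
  shows "((\<lambda>x. \<Sum>j\<in>J. f j x) has_sum (\<Sum>j\<in>J. S j)) A"
  using assms by (induction J rule: finite_induct) (auto intro!: has_sum_add)

text \<open>The dual frequency 0 is the main term. For the others \<open>theta_inversion\<close>
  leaves \<open>norm (s powr (-1/2))\<close> times the Gauss sum bound times
  \<open>pi / sqrt \<beta>\<close>, and in \<open>norm s * \<beta> = pi * Im w / norm w\<close> the
  modulus \<open>lcm p q\<close> has cancelled, so the error does not see \<open>p\<close>.\<close>

lemma theta_approx:
  fixes h :: int and w :: complex
  assumes p: "p > 0" and q: "q > 0" and h: "coprime h (int q)" and w: "Im w > 0"
  shows "norm (theta_series p b (of_int h / of_nat q + w) - cong_gauss p q h b 0 / of_nat (lcm p q) * (- 2 * \<i> * w) powr (-1/2))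
     \<le> sqrt (2 * pi * (real q * norm w / Im w))"
proof -
  define L where "L = lcm p q"
  define N where "N = q div gcd p q"
  have L: "L > 0" using p q by (simp add: L_def lcm_pos_nat)
  define s where "s = - 2 * \<i> * w * of_nat L ^ 2"
  have Rew: "Re (- 2 * \<i> * w) > 0" using w by simp
  have Res: "Re s = 2 * Im w * (real L)\<^sup>2"
  proof -
    have "s = of_real ((real L)\<^sup>2) * (- 2 * \<i> * w)" by (simp add: s_def)
    moreover have "Re (of_real t * z) = t * Re z" for t z by simp
    ultimately have "Re s = (real L)\<^sup>2 * Re (- 2 * \<i> * w)" by (simp only:)
    then show ?thesis by simp
  qed
  have s: "Re s > 0" using Res w L by simp
  have ns: "norm s = 2 * norm w * (real L)\<^sup>2" by (simp add: s_def norm_mult norm_power)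
  define B where "B = (\<lambda>k::int. exp (- of_real (pi * (of_int k)\<^sup>2) / s))"
  define \<beta> where "\<beta> = pi * Re (1 / s)"
  have Re1s: "Re (1 / s) = Re s / (norm s)\<^sup>2"
    by (simp add: Re_divide cmod_power2)
  have s0: "s \<noteq> 0" using s by auto
  have \<beta>: "\<beta> > 0" unfolding \<beta>_def Re1s using s s0 by simp
  have nB: "norm (B k) = exp (- \<beta> * (of_int k)\<^sup>2)" for k
  proof -
    have "- of_real (pi * (of_int k)\<^sup>2) / s = of_real (- (pi * (of_int k)\<^sup>2)) * (1 / s)" by simp
    moreover have "Re (of_real t * z) = t * Re z" for t z by simp
    ultimately show ?thesis unfolding B_def norm_exp_eq_Re by (simp only: \<beta>_def) (simp add: mult_ac)
  qed
  have sumB: "(\<lambda>k. c k * B k) summable_on UNIV" if "\<And>k. norm (c k) \<le> M" for c :: "int \<Rightarrow> complex" and M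
  proof (rule abs_summable_summable, rule Infinite_Sum.abs_summable_on_comparison_test')
    show "(\<lambda>k. M * exp (- \<beta> * (of_int k)\<^sup>2)) summable_on (UNIV :: int set)"
      by (intro summable_on_cmult_right gauss_summable \<beta>)
    show "norm (c k * B k) \<le> M * exp (- \<beta> * (of_int k)\<^sup>2)" for k
      unfolding norm_mult nB using that[of k] by (intro mult_right_mono) auto
  qed
  define G where "G = (\<lambda>k. cong_gauss p q h b k)"
  have G: "norm (G k) \<le> sqrt (2 * real q)" for k unfolding G_def by (rule norm_cong_gauss[OF p q h])
  have "theta_series p b (of_int h / of_nat q + w) =
    (\<Sum>j\<in>residue_set N. cis2pi (of_int (h * (b + int p * j)\<^sup>2) / of_nat q) *
      (\<Sum>\<^sub>\<infinity>t::int. exp (- s * of_real (pi * (of_int (b + int p * j) / of_nat L + of_int t)\<^sup>2))))"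
    unfolding s_def N_def L_def by (rule theta_series_split[OF p q w])
  also have "\<dots> = (\<Sum>j\<in>residue_set N. s powr (-1/2) * (\<Sum>\<^sub>\<infinity>k::int. cis2pi (of_int (h * (b + int p * j)\<^sup>2) / of_nat q + of_int (k * (b + int p * j)) / of_nat L) * B k))"
  proof (rule sum.cong[OF refl])
    fix j
    have "cis2pi (of_int (h * (b + int p * j)\<^sup>2) / of_nat q) * (s powr (-1/2) * (\<Sum>\<^sub>\<infinity>k::int. cis2pi (of_int k * (of_int (b + int p * j) / of_nat L)) * B k)) =
      s powr (-1/2) * (\<Sum>\<^sub>\<infinity>k::int. cis2pi (of_int (h * (b + int p * j)\<^sup>2) / of_nat q) * (cis2pi (of_int k * (of_int (b + int p * j) / of_nat L)) * B k))"
      unfolding infsum_cmult_right' by (simp only: mult_ac)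
    moreover have "cis2pi (of_int (h * (b + int p * j)\<^sup>2) / of_nat q) * (cis2pi (of_int k * (of_int (b + int p * j) / of_nat L)) * B k) =
       cis2pi (of_int (h * (b + int p * j)\<^sup>2) / of_nat q + of_int (k * (b + int p * j)) / of_nat L) * B k" for k
      by (simp add: cis2pi_add)
    moreover have "(\<Sum>\<^sub>\<infinity>t::int. exp (- s * of_real (pi * (of_int (b + int p * j) / of_nat L + of_int t)\<^sup>2))) =
      s powr (-1/2) * (\<Sum>\<^sub>\<infinity>k::int. cis2pi (of_int k * (of_int (b + int p * j) / of_nat L)) * B k)"
      unfolding B_def by (rule theta_inversion[OF s])
    ultimately show "cis2pi (of_int (h * (b + int p * j)\<^sup>2) / of_nat q) *
      (\<Sum>\<^sub>\<infinity>t::int. exp (- s * of_real (pi * (of_int (b + int p * j) / of_nat L + of_int t)\<^sup>2))) =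
      s powr (-1/2) * (\<Sum>\<^sub>\<infinity>k::int. cis2pi (of_int (h * (b + int p * j)\<^sup>2) / of_nat q + of_int (k * (b + int p * j)) / of_nat L) * B k)"
      by (simp only:)
  qed
  also have "\<dots> = s powr (-1/2) * (\<Sum>j\<in>residue_set N. \<Sum>\<^sub>\<infinity>k::int. cis2pi (of_int (h * (b + int p * j)\<^sup>2) / of_nat q + of_int (k * (b + int p * j)) / of_nat L) * B k)"
    by (rule sum_distrib_left[symmetric])
  also have "(\<Sum>j\<in>residue_set N. \<Sum>\<^sub>\<infinity>k::int. cis2pi (of_int (h * (b + int p * j)\<^sup>2) / of_nat q + of_int (k * (b + int p * j)) / of_nat L) * B k) =
     (\<Sum>\<^sub>\<infinity>k::int. G k * B k)"
  proof -
    have "((\<lambda>k. \<Sum>j\<in>residue_set N. cis2pi (of_int (h * (b + int p * j)\<^sup>2) / of_nat q + of_int (k * (b + int p * j)) / of_nat L) * B k) has_sum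
       (\<Sum>j\<in>residue_set N. \<Sum>\<^sub>\<infinity>k::int. cis2pi (of_int (h * (b + int p * j)\<^sup>2) / of_nat q + of_int (k * (b + int p * j)) / of_nat L) * B k)) UNIV"
      by (intro has_sum_finite_sum has_sum_infsum sumB[of _ 1]) auto
    then show ?thesis
      by (simp add: G_def cong_gauss_def N_def L_def sum_distrib_right infsumI)
  qed
  also have "(\<Sum>\<^sub>\<infinity>k::int. G k * B k) = G 0 + (\<Sum>\<^sub>\<infinity>k\<in>UNIV - {0::int}. G k * B k)"
  proof -
    have "(\<lambda>k. G k * B k) summable_on (UNIV - {0})" using sumB[OF G] by (rule summable_on_subset) auto
    from infsum_insert[OF this, of 0] show ?thesis by (simp add: insert_Diff_if B_def)
  qed
  finally have theta: "theta_series p b (of_int h / of_nat q + w) = s powr (-1/2) * (G 0 + (\<Sum>\<^sub>\<infinity>k\<in>UNIV - {0::int}. G k * B k))" .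
  have sp: "s powr (-1/2) = (- 2 * \<i> * w) powr (-1/2) / of_nat L"
    unfolding s_def by (rule powr_minus_half_scale[OF Rew L])
  have diff: "theta_series p b (of_int h / of_nat q + w) - G 0 / of_nat L * (- 2 * \<i> * w) powr (-1/2) = s powr (-1/2) * (\<Sum>\<^sub>\<infinity>k\<in>UNIV - {0::int}. G k * B k)"
    unfolding theta sp by (simp add: algebra_simps add_divide_distrib)
  have tail: "norm (\<Sum>\<^sub>\<infinity>k\<in>UNIV - {0::int}. G k * B k) \<le> sqrt (2 * real q) * (pi / sqrt \<beta>)"
  proof -
    have gs: "(\<lambda>k::int. exp (- \<beta> * (of_int k)\<^sup>2)) summable_on (UNIV - {0})" by (rule gauss_summable_nonzero(1)[OF \<beta>])
    have gs': "(\<lambda>k::int. sqrt (2 * real q) * exp (- \<beta> * (of_int k)\<^sup>2)) summable_on (UNIV - {0})"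
      by (intro summable_on_cmult_right gs)
    have le: "norm (G k * B k) \<le> sqrt (2 * real q) * exp (- \<beta> * (of_int k)\<^sup>2)" for k
      unfolding norm_mult nB by (intro mult_right_mono G) auto
    have ab: "(\<lambda>k. norm (G k * B k)) summable_on (UNIV - {0})"
      by (rule Infinite_Sum.abs_summable_on_comparison_test'[OF gs' le])
    have "norm (\<Sum>\<^sub>\<infinity>k\<in>UNIV - {0::int}. G k * B k) \<le> (\<Sum>\<^sub>\<infinity>k\<in>UNIV - {0::int}. norm (G k * B k))"
      by (rule norm_infsum_bound[OF ab])
    also have "\<dots> \<le> (\<Sum>\<^sub>\<infinity>k\<in>UNIV - {0::int}. sqrt (2 * real q) * exp (- \<beta> * (of_int k)\<^sup>2))"
      by (rule infsum_mono[OF ab gs' le])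
    also have "\<dots> = sqrt (2 * real q) * (\<Sum>\<^sub>\<infinity>k\<in>UNIV - {0::int}. exp (- \<beta> * (of_int k)\<^sup>2))"
      by (rule infsum_cmult_right')
    also have "\<dots> \<le> sqrt (2 * real q) * (pi / sqrt \<beta>)"
      by (intro mult_left_mono gauss_summable_nonzero(2)[OF \<beta>]) auto
    finally show ?thesis .
  qed
  have nsp: "norm (s powr (-1/2)) = 1 / sqrt (norm s)"
    using s0 by (subst norm_powr_real_powr') (auto simp: powr_minus_divide powr_half_sqrt)
  have "norm (theta_series p b (of_int h / of_nat q + w) - G 0 / of_nat L * (- 2 * \<i> * w) powr (-1/2)) \<le> 1 / sqrt (norm s) * (sqrt (2 * real q) * (pi / sqrt \<beta>))"
    unfolding diff norm_mult nsp by (intro mult_left_mono tail) auto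
  also have "\<dots> = sqrt (2 * pi * (real q * norm w / Im w))"
  proof -
    have "(1 / sqrt (norm s) * (sqrt (2 * real q) * (pi / sqrt \<beta>)))\<^sup>2 = 2 * real q * pi\<^sup>2 / (norm s * \<beta>)"
      using \<beta> by (simp add: power_mult_distrib power_divide)
    also have "norm s * \<beta> = pi * (Re s / norm s)"
      unfolding \<beta>_def Re1s using s0 by (simp add: power2_eq_square)
    also have "Re s / norm s = Im w / norm w"
      unfolding Res ns using L by simp
    also have "2 * real q * pi\<^sup>2 / (pi * (Im w / norm w)) = 2 * pi * (real q * norm w / Im w)"
      by (simp add: power2_eq_square)
    finally show ?thesis
      using \<beta> by (intro real_sqrt_unique[symmetric]) auto
  qed
  finally show ?thesis by (simp add: G_def L_def)
qed

text \<open>\<open>lcm p q \<ge> q\<close> throws away any gain from \<open>p\<close>; that is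
  affordable, as this bound enters error terms only.\<close>

lemma theta_main_bound:
  assumes p: "p > 0" and q: "q > 0" and h: "coprime h (int q)" and w: "Im w > 0"
  shows "norm (cong_gauss p q h b 0 / of_nat (lcm p q) * (- 2 * \<i> * w) powr (-1/2)) \<le> 1 / sqrt (real q * norm w)"
proof -
  have w0: "norm w > 0" using w by auto
  have "norm ((- 2 * \<i> * w) powr (-1/2)) = norm (- 2 * \<i> * w) powr (-1/2)"
    by (subst norm_powr_real_powr') auto
  also have "\<dots> = 1 / sqrt (2 * norm w)"
    by (simp add: norm_mult powr_minus_divide powr_half_sqrt)
  finally have 1: "norm ((- 2 * \<i> * w) powr (-1/2)) = 1 / sqrt (2 * norm w)" .
  have "q \<le> lcm p q" using p q by (intro dvd_imp_le) (auto simp: lcm_pos_nat)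
  then have 2: "norm (cong_gauss p q h b 0) / real (lcm p q) \<le> sqrt (2 * real q) / real q"
    using norm_cong_gauss[OF p q h, of b 0] q by (intro frac_le) auto
  have "norm (cong_gauss p q h b 0 / of_nat (lcm p q) * (- 2 * \<i> * w) powr (-1/2)) \<le> sqrt (2 * real q) / real q * (1 / sqrt (2 * norm w))"
    unfolding norm_mult 1 norm_divide norm_of_nat by (intro mult_right_mono 2) auto
  also have "\<dots> = 1 / sqrt (real q * norm w)"
    using q w0 by (simp add: real_sqrt_mult field_simps)
  finally show ?thesis .
qed

section \<open>Counting a residue class on the sphere by an integral of theta series\<close>

definition class_count :: "nat \<Rightarrow> nat \<Rightarrow> nat \<Rightarrow> (nat \<Rightarrow> int) \<Rightarrow> nat" where
  "class_count d lam p a = card {n \<in> sphere_points d lam. \<forall>i<d. [n i = a i] (mod int p)}"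

definition theta_integrand :: "nat \<Rightarrow> nat \<Rightarrow> nat \<Rightarrow> (nat \<Rightarrow> int) \<Rightarrow> complex \<Rightarrow> complex" where
  "theta_integrand d lam p a z = (\<Prod>i<d. theta_series p (a i) z) * exp (2 * pi * \<i> * z * (- of_nat lam))"

text \<open>Orthogonality on a horizontal segment at any height \<open>y\<close>. The starting point
  \<open>c\<close> is left free because the dissection into arcs begins slightly to the left of
  0.\<close>

lemma lborel_integral_unit_character:
  fixes k :: int
  shows "(LINT u:{c..c+1}|lborel. exp (2 * pi * \<i> * Complex u y * of_int k)) = (if k = 0 then 1 else 0)"
proof -
  have e: "exp (2 * pi * \<i> * Complex u y * of_int k) = exp (- of_real (2 * pi * y * of_int k)) * cis2pi (of_int k * u)" for u
  proof -
    have "2 * pi * \<i> * Complex u y * of_int k = - of_real (2 * pi * y * of_int k) + 2 * pi * \<i> * of_real (of_int k * u)"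
      by (simp add: complex_eq_iff)
    then show ?thesis by (simp only: exp_add cis2pi_def)
  qed
  have "continuous_on {c..c+1} (\<lambda>u. exp (- of_real (2 * pi * y * of_int k)) * cis2pi (of_int k * u))"
    by (intro continuous_intros)
  then have "set_integrable lborel {c..c+1} (\<lambda>u. exp (- of_real (2 * pi * y * of_int k)) * cis2pi (of_int k * u))"
    by (rule borel_integrable_atLeastAtMost')
  from set_borel_integral_eq_integral(2)[OF this]
  have "(LINT u:{c..c+1}|lborel. exp (2 * pi * \<i> * Complex u y * of_int k)) =
     integral {c..c+1} (\<lambda>u. exp (- of_real (2 * pi * y * of_int k)) * cis2pi (of_int k * u))"
    by (simp only: e)
  also have "\<dots> = exp (- of_real (2 * pi * y * of_int k)) * integral {c..c+1} (\<lambda>u. cis2pi (of_int k * u))"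
    by simp
  also have "integral {c..c+1} (\<lambda>u. cis2pi (of_int k * u)) = integral {0..1} (\<lambda>u. cis2pi (of_int k * c) * cis2pi (of_int k * u))"
  proof -
    have "integral {c..c+1} (\<lambda>u. cis2pi (of_int k * u)) = integral {0..1} (\<lambda>u. cis2pi (of_int k * (c + u)))"
      using integral_shift_Icc_real[of 0 1 "\<lambda>u. cis2pi (of_int k * u)" c] by (simp only: o_def add.commute add_0_right add_0_left)
    moreover have "cis2pi (of_int k * (c + u)) = cis2pi (of_int k * c) * cis2pi (of_int k * u)" for u
      by (simp only: distrib_left cis2pi_add)
    ultimately show ?thesis by (simp only:)
  qed
  also have "\<dots> = cis2pi (of_int k * c) * integral {0..1} (\<lambda>u. cis2pi (of_int k * u))"
    by simp
  finally show ?thesis by (auto simp: integral_cis2pi)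
qed

lemma set_integrable_unit_character:
  fixes k :: int
  shows "set_integrable lborel {c..c+1} (\<lambda>u. exp (2 * pi * \<i> * Complex u y * of_int k))"
proof (rule borel_integrable_atLeastAtMost')
  have "(\<lambda>u. exp (2 * pi * \<i> * Complex u y * of_int k)) = (\<lambda>u. exp (2 * pi * \<i> * (of_real u + \<i> * of_real y) * of_int k))"
    by (simp add: Complex_eq)
  then show "continuous_on {c..c + 1} (\<lambda>u. exp (2 * pi * \<i> * Complex u y * of_int k))"
    by (simp only:) (intro continuous_intros)
qed

text \<open>Substitute \<open>n = a + p * m\<close>. A coordinate of a solution is bounded by its
  square, hence by \<open>lam\<close>, so every \<open>m\<close> lies in the box and truncated theta
  products count exactly.\<close>

lemma class_count_box:
  assumes p: "p > 0" and M: "int M \<ge> int lam + (\<Sum>i<d. \<bar>a i\<bar>)"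
  shows "card {m \<in> {..<d} \<rightarrow>\<^sub>E {- int M..int M}. (\<Sum>i<d. (a i + int p * m i)\<^sup>2) = int lam} = class_count d lam p a"
proof -
  define A where "A = {m \<in> {..<d} \<rightarrow>\<^sub>E {- int M..int M}. (\<Sum>i<d. (a i + int p * m i)\<^sup>2) = int lam}"
  define B where "B = {n \<in> sphere_points d lam. \<forall>i<d. [n i = a i] (mod int p)}"
  define F where "F = (\<lambda>m. \<lambda>i\<in>{..<d}. a i + int p * m i)"
  define G where "G = (\<lambda>n. \<lambda>i\<in>{..<d}. (n i - a i) div int p)"
  have "bij_betw F A B"
  proof (rule bij_betw_byWitness[where f' = G])
    show "\<forall>m\<in>A. G (F m) = m"
      using p by (auto simp: A_def F_def G_def fun_eq_iff PiE_def extensional_def)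
    show "\<forall>n\<in>B. F (G n) = n"
    proof
      fix n assume n: "n \<in> B"
      show "F (G n) = n"
      proof
        fix i
        show "F (G n) i = n i"
        proof (cases "i < d")
          case True
          then have "[n i = a i] (mod int p)" using n by (simp add: B_def)
          then have "int p dvd n i - a i" by (simp add: cong_iff_dvd_diff)
          then show ?thesis using True by (simp add: F_def G_def)
        next
          case False
          then show ?thesis using n by (auto simp: F_def B_def sphere_points_def int_vectors_def PiE_def extensional_def)
        qed
      qed
    qed
    show "F ` A \<subseteq> B"
    proof
      fix n assume "n \<in> F ` A"
      then obtain m where m: "m \<in> A" "n = F m" by auto
      have "norm_sq d n = int lam" using m by (simp add: norm_sq_def F_def A_def)
      moreover have "n \<in> int_vectors d" using m by (auto simp: int_vectors_def F_def)
      moreover have "[n i = a i] (mod int p)" if "i < d" for i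
        using m that by (simp add: F_def cong_def)
      ultimately show "n \<in> B" by (simp add: B_def sphere_points_def)
    qed
    show "G ` B \<subseteq> A"
    proof
      fix m assume "m \<in> G ` B"
      then obtain n where n: "n \<in> B" "m = G n" by auto
      have nsq: "(\<Sum>i<d. (n i)\<^sup>2) = int lam" using n by (simp add: B_def sphere_points_def norm_sq_def)
      have div: "a i + int p * m i = n i" if "i < d" for i
      proof -
        have "[n i = a i] (mod int p)" using n that by (simp add: B_def)
        then have "int p dvd n i - a i" by (simp add: cong_iff_dvd_diff)
        then show ?thesis using that n(2) by (simp add: G_def)
      qed
      have "\<bar>m i\<bar> \<le> int M" if i: "i < d" for i
      proof -
        have "\<bar>n i\<bar> \<le> (n i)\<^sup>2" using abs_le_square_iff[of 1 "n i"] self_le_power[of "\<bar>n i\<bar>" 2]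
          by (cases "n i = 0") auto
        also have "(n i)\<^sup>2 \<le> (\<Sum>i<d. (n i)\<^sup>2)" using i by (intro member_le_sum) auto
        finally have 1: "\<bar>n i\<bar> \<le> int lam" using nsq by simp
        have 2: "\<bar>a i\<bar> \<le> (\<Sum>i<d. \<bar>a i\<bar>)" using i by (intro member_le_sum) auto
        have "\<bar>m i\<bar> \<le> \<bar>int p * m i\<bar>" using p by (simp add: abs_mult mult_le_cancel_right1)
        also have "int p * m i = n i - a i" using div[OF i] by simp
        finally show ?thesis using 1 2 M by linarith
      qed
      then have "m \<in> {..<d} \<rightarrow>\<^sub>E {- int M..int M}"
        using n(2) by (auto simp: G_def PiE_def extensional_def abs_le_iff) (metis (no_types, lifting) abs_le_iff minus_le_iff restrict_apply')+
      then show "m \<in> A" using div nsq by (simp add: A_def)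
    qed
  qed
  then show ?thesis unfolding class_count_def A_def B_def by (rule bij_betw_same_card)
qed

text \<open>The theta series are truncated to \<open>\<bar>m\<bar> \<le> M\<close> before
  multiplying out. The integral of the finite product counts solutions in a box, which is eventually
  constant in \<open>M\<close>, while dominated convergence gives the integral of the full product;
  no \<open>d\<close>-fold infinite sum is rearranged.\<close>

lemma class_count_integral:
  fixes a :: "nat \<Rightarrow> int"
  assumes p: "p > 0" and y: "y > 0"
  shows "set_integrable lborel {c..c+1} (\<lambda>u. theta_integrand d lam p a (Complex u y))"
    and "(LINT u:{c..c+1}|lborel. theta_integrand d lam p a (Complex u y)) = of_nat (class_count d lam p a)"
proof -
  define e where "e = (\<lambda>z n. exp (2 * pi * \<i> * z * complex_of_int n))"
  define T where "T = (\<lambda>M b z. \<Sum>m\<in>{- int M..int M}. e z ((b + int p * m)\<^sup>2))"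
  define K where "K = (\<lambda>b. \<Sum>\<^sub>\<infinity>m::int. exp (- (2 * pi * y) * of_int ((b + int p * m)\<^sup>2)))"
  define w where "w = (\<Prod>i<d. K (a i)) * exp (2 * pi * y * real lam)"
  define S where "S = (\<lambda>M u. (\<Prod>i<d. T M (a i) (Complex u y)) * e (Complex u y) (- int lam))"
  have ne: "norm (e (Complex u y) n) = exp (- (2 * pi * y) * of_int n)" for u n
    unfolding e_def norm_theta_term by simp
  have TK: "norm (T M b (Complex u y)) \<le> K b" for M b u
  proof -
    have "norm (T M b (Complex u y)) \<le> (\<Sum>m\<in>{- int M..int M}. norm (e (Complex u y) ((b + int p * m)\<^sup>2)))"
      unfolding T_def by (rule norm_sum)
    also have "\<dots> = (\<Sum>\<^sub>\<infinity>m\<in>{- int M..int M}. exp (- (2 * pi * y) * of_int ((b + int p * m)\<^sup>2)))"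
      by (simp add: ne)
    also have "\<dots> \<le> K b" unfolding K_def
      by (rule infsum_mono2) (use theta_term_summable[OF p y] in auto)
    finally show ?thesis .
  qed
  have Tlim: "(\<lambda>M. T M b (Complex u y)) \<longlonglongrightarrow> theta_series p b (Complex u y)" for b u
  proof -
    have "(\<lambda>m::int. e (Complex u y) ((b + int p * m)\<^sup>2)) summable_on UNIV"
      unfolding e_def by (rule abs_summable_summable[OF theta_series_abs_summable]) (use p y in auto)
    then have "((\<lambda>m::int. e (Complex u y) ((b + int p * m)\<^sup>2)) has_sum theta_series p b (Complex u y)) UNIV"
      unfolding theta_series_def e_def by (rule has_sum_infsum)
    then show ?thesis unfolding has_sum_def T_def by (rule filterlim_compose[OF _ filterlim_int_intervals(2)])
  qed
  have Slim: "(\<lambda>M. S M u) \<longlonglongrightarrow> theta_integrand d lam p a (Complex u y)" for u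
  proof -
    have "(\<lambda>M. S M u) \<longlonglongrightarrow> (\<Prod>i<d. theta_series p (a i) (Complex u y)) * e (Complex u y) (- int lam)"
      unfolding S_def by (intro tendsto_intros Tlim)
    then show ?thesis by (simp add: theta_integrand_def e_def)
  qed
  have Sw: "norm (S M u) \<le> w" for M u
  proof -
    have "norm (\<Prod>i<d. T M (a i) (Complex u y)) \<le> (\<Prod>i<d. K (a i))"
      unfolding prod_norm[symmetric] by (intro prod_mono conjI norm_ge_zero TK)
    then show ?thesis unfolding S_def w_def norm_mult ne by (intro mult_mono) (auto intro: order_trans[OF norm_ge_zero TK] prod_nonneg)
  qed
  have S_eq: "S M u = (\<Sum>m\<in>{..<d} \<rightarrow>\<^sub>E {- int M..int M}. e (Complex u y) ((\<Sum>i<d. (a i + int p * m i)\<^sup>2) - int lam))" for M u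
  proof -
    have prod_e: "(\<Prod>i\<in>I. e z (f i)) = e z (\<Sum>i\<in>I. f i)" if "finite I" for z f and I :: "nat set"
      using that unfolding e_def by (simp add: exp_sum[symmetric] sum_distrib_left)
    have "(\<Prod>i<d. T M (a i) (Complex u y)) = (\<Sum>m\<in>{..<d} \<rightarrow>\<^sub>E {- int M..int M}. \<Prod>i<d. e (Complex u y) ((a i + int p * m i)\<^sup>2))"
      unfolding T_def by (rule prod_sum_PiE) auto
    moreover have "e z m * e z n = e z (m + n)" for z m n
      unfolding e_def by (simp add: exp_add[symmetric] distrib_left)
    ultimately show ?thesis unfolding S_def by (simp add: prod_e sum_distrib_right)
  qed
  have S_int: "set_integrable lborel {c..c+1} (S M)" for M
    unfolding S_eq e_def set_integrable_def scaleR_sum_right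
    by (rule Bochner_Integration.integrable_sum) (rule set_integrable_unit_character[unfolded set_integrable_def])
  have S_val: "(LINT u:{c..c+1}|lborel. S M u) = of_nat (card {m \<in> {..<d} \<rightarrow>\<^sub>E {- int M..int M}. (\<Sum>i<d. (a i + int p * m i)\<^sup>2) = int lam})" for M
  proof -
    have fin: "finite ({..<d} \<rightarrow>\<^sub>E {- int M..int M})" by (intro finite_PiE) auto
    have "(LINT u:{c..c+1}|lborel. S M u) = (\<Sum>m\<in>{..<d} \<rightarrow>\<^sub>E {- int M..int M}. LINT u:{c..c+1}|lborel. e (Complex u y) ((\<Sum>i<d. (a i + int p * m i)\<^sup>2) - int lam))"
      unfolding S_eq set_lebesgue_integral_def scaleR_sum_right e_def
      by (rule Bochner_Integration.integral_sum) (rule set_integrable_unit_character[unfolded set_integrable_def])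
    also have "\<dots> = (\<Sum>m\<in>{..<d} \<rightarrow>\<^sub>E {- int M..int M}. if (\<Sum>i<d. (a i + int p * m i)\<^sup>2) = int lam then 1 else 0)"
      unfolding e_def lborel_integral_unit_character by simp
    also have "\<dots> = of_nat (card {m \<in> {..<d} \<rightarrow>\<^sub>E {- int M..int M}. (\<Sum>i<d. (a i + int p * m i)\<^sup>2) = int lam})"
      using fin by (simp add: sum.If_cases Int_def)
    finally show ?thesis .
  qed
  have lim: "(\<lambda>M. LINT u|lborel. indicator {c..c+1} u *\<^sub>R S M u) \<longlonglongrightarrow> (LINT u|lborel. indicator {c..c+1} u *\<^sub>R theta_integrand d lam p a (Complex u y))"
    and int: "integrable lborel (\<lambda>u. indicator {c..c+1} u *\<^sub>R theta_integrand d lam p a (Complex u y))"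
  proof -
    have m: "(\<lambda>u. indicator {c..c+1} u *\<^sub>R S M u) \<in> borel_measurable lborel" for M
      using S_int[of M] by (auto simp: set_integrable_def dest: borel_measurable_integrable)
    have l: "(\<lambda>M. indicator {c..c+1} u *\<^sub>R S M u) \<longlonglongrightarrow> indicator {c..c+1} u *\<^sub>R theta_integrand d lam p a (Complex u y)" for u
      by (intro tendsto_intros Slim)
    have m': "(\<lambda>u. indicator {c..c+1} u *\<^sub>R theta_integrand d lam p a (Complex u y)) \<in> borel_measurable lborel"
      by (rule borel_measurable_LIMSEQ_metric[OF m l])
    have wint: "integrable lborel (\<lambda>u. indicator {c..c+1} u * w)"
      using integrable_real_indicator[of "{c..c+1}" lborel] by simp
    have b: "norm (indicator {c..c+1} u *\<^sub>R S M u) \<le> indicator {c..c+1} u * w" for M u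
      using Sw[of M u] by (auto simp: indicator_def)
    show "(\<lambda>M. LINT u|lborel. indicator {c..c+1} u *\<^sub>R S M u) \<longlonglongrightarrow> (LINT u|lborel. indicator {c..c+1} u *\<^sub>R theta_integrand d lam p a (Complex u y))"
      by (rule integral_dominated_convergence[where s="\<lambda>M u. indicator {c..c+1} u *\<^sub>R S M u", OF m' m wint AE_I2[OF l] AE_I2[OF b]])
    show "integrable lborel (\<lambda>u. indicator {c..c+1} u *\<^sub>R theta_integrand d lam p a (Complex u y))"
      by (rule integrable_dominated_convergence[where s="\<lambda>M u. indicator {c..c+1} u *\<^sub>R S M u", OF m' m wint AE_I2[OF l] AE_I2[OF b]])
  qed
  show "set_integrable lborel {c..c+1} (\<lambda>u. theta_integrand d lam p a (Complex u y))"
    using int by (simp add: set_integrable_def)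
  have "eventually (\<lambda>M. (LINT u|lborel. indicator {c..c+1} u *\<^sub>R S M u) = of_nat (class_count d lam p a)) sequentially"
  proof (rule eventually_sequentiallyI)
    fix M assume "M \<ge> nat (int lam + (\<Sum>i<d. \<bar>a i\<bar>))"
    then have "int M \<ge> int lam + (\<Sum>i<d. \<bar>a i\<bar>)" by linarith
    from class_count_box[OF p this] S_val[of M]
    show "(LINT u|lborel. indicator {c..c+1} u *\<^sub>R S M u) = of_nat (class_count d lam p a)"
      by (simp add: set_lebesgue_integral_def)
  qed
  then have "(\<lambda>M. LINT u|lborel. indicator {c..c+1} u *\<^sub>R S M u) \<longlonglongrightarrow> of_nat (class_count d lam p a)"
    by (rule tendsto_eventually)
  then show "(LINT u:{c..c+1}|lborel. theta_integrand d lam p a (Complex u y)) = of_nat (class_count d lam p a)"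
    unfolding set_lebesgue_integral_def using lim LIMSEQ_unique by blast
qed

section \<open>The circle method\<close>

definition cauchy_mass :: real where
  "cauchy_mass = (LINT x|lborel. 1 / (1 + x\<^sup>2))"

lemma cauchy_mass_nonneg: "cauchy_mass \<ge> 0"
  unfolding cauchy_mass_def by (intro Bochner_Integration.integral_nonneg) (simp add: add_nonneg_nonneg)

lemma cauchy_kernel:
  assumes "y > (0::real)"
  shows "integrable lborel (\<lambda>u. 1 / (u\<^sup>2 + y\<^sup>2))" "(LINT u|lborel. 1 / (u\<^sup>2 + y\<^sup>2)) = cauchy_mass / y"
proof -
  have eq: "1 / (1 + (0 + (1 / y) * u)\<^sup>2) = y\<^sup>2 * (1 / (u\<^sup>2 + y\<^sup>2))" for u
    using assms by (simp add: power_divide add_divide_distrib[symmetric] divide_simps)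
  have "integrable lborel (\<lambda>u. 1 / (1 + (0 + (1 / y) * u)\<^sup>2))"
    using assms by (intro lborel_integrable_real_affine[OF integrable_inverse_1_plus_sq]) auto
  then show "integrable lborel (\<lambda>u. 1 / (u\<^sup>2 + y\<^sup>2))"
    unfolding eq integrable_mult_left_iff using assms by auto
  have "cauchy_mass = (1 / y) * (LINT u|lborel. 1 / (1 + (0 + (1 / y) * u)\<^sup>2))"
    unfolding cauchy_mass_def using assms by (subst lborel_integral_real_affine[where c="1/y" and t=0]) auto
  also have "\<dots> = (1 / y) * (y\<^sup>2 * (LINT u|lborel. 1 / (u\<^sup>2 + y\<^sup>2)))"
    unfolding eq integral_mult_right_zero ..
  also have "(1 / y) * (y\<^sup>2 * J) = y * J" for J
    using assms by (simp add: power2_eq_square)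
  finally have "cauchy_mass / y = (y * (LINT u|lborel. 1 / (u\<^sup>2 + y\<^sup>2))) / y" by (simp only:)
  also have "(y * J) / y = J" for J using assms by simp
  finally show "(LINT u|lborel. 1 / (u\<^sup>2 + y\<^sup>2)) = cauchy_mass / y" by (rule sym)
qed

lemma norm_prod_diff_le:
  fixes z w :: "nat \<Rightarrow> complex"
  assumes "\<And>i. i < d \<Longrightarrow> norm (z i) \<le> B" "\<And>i. i < d \<Longrightarrow> norm (w i) \<le> B" "\<And>i. i < d \<Longrightarrow> norm (z i - w i) \<le> e"
    and B: "B \<ge> 0" and e: "e \<ge> 0"
  shows "norm ((\<Prod>i<d. z i) - (\<Prod>i<d. w i)) \<le> real d * B ^ (d - 1) * e"
  using assms(1-3)
proof (induction d)
  case (Suc d)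
  have IH: "norm ((\<Prod>i<d. z i) - (\<Prod>i<d. w i)) \<le> real d * B ^ (d - 1) * e" by (rule Suc.IH) (use Suc.prems in auto)
  have W: "norm (\<Prod>i<d. w i) \<le> B ^ d"
  proof -
    have "norm (\<Prod>i<d. w i) \<le> (\<Prod>i<d. B)"
      unfolding prod_norm[symmetric] using Suc.prems by (intro prod_mono) auto
    then show ?thesis by simp
  qed
  have "(\<Prod>i<Suc d. z i) - (\<Prod>i<Suc d. w i) = z d * ((\<Prod>i<d. z i) - (\<Prod>i<d. w i)) + (z d - w d) * (\<Prod>i<d. w i)"
    by (simp add: algebra_simps)
  then have "norm ((\<Prod>i<Suc d. z i) - (\<Prod>i<Suc d. w i)) \<le> norm (z d) * norm ((\<Prod>i<d. z i) - (\<Prod>i<d. w i)) + norm (z d - w d) * norm (\<Prod>i<d. w i)"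
    by (metis norm_mult norm_triangle_ineq)
  also have "\<dots> \<le> B * (real d * B ^ (d - 1) * e) + e * B ^ d"
    using Suc.prems[of d] IH W B e by (intro add_mono mult_mono) auto
  also have "B * (real d * B ^ (d - 1) * e) = real d * B ^ d * e"
    by (cases d) auto
  finally show ?case by (simp add: algebra_simps)
qed simp

text \<open>The archimedean factor on an arc, as a function of the signed distance \<open>u\<close>
  from its centre. It does not depend on the fraction, so one integral serves all arcs.\<close>

definition singular_kernel :: "nat \<Rightarrow> nat \<Rightarrow> real \<Rightarrow> complex" where
  "singular_kernel d lam u = ((- 2 * \<i> * Complex u (1 / real lam)) powr (-1/2)) ^ d *
     exp (2 * pi * \<i> * Complex u (1 / real lam) * (- of_nat lam))"

lemma norm_Complex_sq: "(norm (Complex u y))\<^sup>2 = u\<^sup>2 + y\<^sup>2"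
  by (simp add: cmod_power2)

lemma norm_exp_height:
  assumes "lam > 0" "Im z = 1 / real lam"
  shows "norm (exp (2 * pi * \<i> * z * (- of_nat lam))) = exp (2 * pi)"
  using assms by (simp add: norm_exp_eq_Re)

lemma norm_singular_kernel:
  assumes "lam > 0"
  shows "norm (singular_kernel d lam u) \<le> exp (2 * pi) * (1 / sqrt (norm (Complex u (1 / real lam)))) ^ d"
proof -
  define w where "w = Complex u (1 / real lam)"
  have "norm w > 0" using assms by (simp add: w_def complex_eq_iff)
  have "norm ((- 2 * \<i> * w) powr (-1/2)) = norm (- 2 * \<i> * w) powr (-1/2)"
    by (subst norm_powr_real_powr') auto
  also have "\<dots> = 1 / sqrt (2 * norm w)"
    by (simp add: norm_mult powr_minus_divide powr_half_sqrt)
  also have "\<dots> \<le> 1 / sqrt (norm w)"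
    using \<open>norm w > 0\<close> by (intro divide_left_mono) auto
  finally have "norm ((- 2 * \<i> * w) powr (-1/2)) ^ d \<le> (1 / sqrt (norm w)) ^ d"
    by (intro power_mono) auto
  then have "norm (singular_kernel d lam u) \<le> (1 / sqrt (norm w)) ^ d * exp (2 * pi)"
    unfolding singular_kernel_def w_def[symmetric] norm_mult norm_power
    using norm_exp_height[OF assms, of w] by (simp add: w_def)
  then show ?thesis by (simp add: w_def mult.commute)
qed

lemma singular_kernel_measurable [measurable]:
  assumes "lam > 0"
  shows "singular_kernel d lam \<in> borel_measurable borel"
proof (rule borel_measurable_continuous_onI)
  have "singular_kernel d lam = (\<lambda>u. ((- 2 * \<i> * (of_real u + \<i> * of_real (1 / real lam))) powr (-1/2)) ^ d *
     exp (2 * pi * \<i> * (of_real u + \<i> * of_real (1 / real lam)) * (- of_nat lam)))"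
    by (simp add: singular_kernel_def Complex_eq fun_eq_iff)
  moreover have "continuous_on UNIV (\<lambda>u. (- 2 * \<i> * (of_real u + \<i> * of_real (1 / real lam))) powr (-1/2))"
  proof (rule continuous_on_compose2[where g = "\<lambda>z. z powr (-1/2)" and t = "{z. Re z > 0}"])
    show "continuous_on {z. Re z > 0} (\<lambda>z. z powr (-1/2 :: complex))"
      by (intro holomorphic_on_imp_continuous_on holomorphic_intros) (auto simp: complex_nonpos_Reals_iff)
    show "continuous_on UNIV (\<lambda>u. - 2 * \<i> * (complex_of_real u + \<i> * complex_of_real (1 / real lam)))"
      by (intro continuous_intros)
    show "(\<lambda>u. - 2 * \<i> * (complex_of_real u + \<i> * complex_of_real (1 / real lam))) ` UNIV \<subseteq> {z. Re z > 0}"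
      using assms by auto
  qed
  moreover have "continuous_on UNIV (\<lambda>u. exp (2 * pi * \<i> * (of_real u + \<i> * of_real (1 / real lam)) * (- of_nat lam)))"
    by (intro continuous_intros)
  ultimately show "continuous_on UNIV (singular_kernel d lam)"
    by (simp only:) (intro continuous_on_mult continuous_on_power)
qed

text \<open>Of the \<open>d\<close> factors \<open>norm w powr (-1/2)\<close> four form the
  integrable Cauchy kernel, and the other \<open>d - 4\<close> are bounded by means of the distance
  \<open>\<delta>\<close>.\<close>

lemma norm_singular_kernel_outside:
  assumes lam: "lam > 0" and d: "d \<ge> 4" and \<delta>: "0 < \<delta>" "\<delta> \<le> norm (Complex u (1 / real lam))"
  shows "norm (singular_kernel d lam u) \<le> exp (2 * pi) * (1 / sqrt \<delta>) ^ (d - 4) * (1 / (u\<^sup>2 + (1 / real lam)\<^sup>2))"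
proof -
  define n where "n = norm (Complex u (1 / real lam))"
  have n: "n > 0" "\<delta> \<le> n" using \<delta> by (auto simp: n_def)
  have "(1 / sqrt n) ^ d = (1 / sqrt n) ^ (d - 4) * (1 / sqrt n) ^ 4"
    using d by (simp flip: power_add)
  also have "(1 / sqrt n) ^ 4 = 1 / n\<^sup>2"
  proof -
    have "(1 / sqrt n) ^ 4 = ((1 / sqrt n)\<^sup>2)\<^sup>2" by (simp flip: power_mult)
    then show ?thesis using n by (simp add: power_divide)
  qed
  also have "n\<^sup>2 = u\<^sup>2 + (1 / real lam)\<^sup>2" by (simp add: n_def norm_Complex_sq)
  also have "(1 / sqrt n) ^ (d - 4) * (1 / (u\<^sup>2 + (1 / real lam)\<^sup>2)) \<le> (1 / sqrt \<delta>) ^ (d - 4) * (1 / (u\<^sup>2 + (1 / real lam)\<^sup>2))"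
    using n \<delta> by (intro mult_right_mono power_mono divide_left_mono) auto
  finally have "exp (2 * pi) * (1 / sqrt n) ^ d \<le> exp (2 * pi) * ((1 / sqrt \<delta>) ^ (d - 4) * (1 / (u\<^sup>2 + (1 / real lam)\<^sup>2)))"
    by (intro mult_left_mono) auto
  then show ?thesis using norm_singular_kernel[OF lam, of d u] unfolding n_def by simp
qed

lemma singular_kernel_integrable:
  assumes lam: "lam > 0" and d: "d \<ge> 4"
  shows "integrable lborel (singular_kernel d lam)"
proof (rule Bochner_Integration.integrable_bound)
  define y where "y = 1 / real lam"
  have y: "y > 0" using lam by (simp add: y_def)
  show "integrable lborel (\<lambda>u. exp (2 * pi) * (1 / sqrt y) ^ (d - 4) * (1 / (u\<^sup>2 + y\<^sup>2)))"
    using cauchy_kernel(1)[OF y] by (intro integrable_mult_right)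
  have "norm (singular_kernel d lam u) \<le> exp (2 * pi) * (1 / sqrt y) ^ (d - 4) * (1 / (u\<^sup>2 + y\<^sup>2))" for u
    unfolding y_def using y lam d abs_Im_le_cmod[of "Complex u (1 / real lam)"]
    by (intro norm_singular_kernel_outside) (auto simp: y_def)
  then show "AE u in lborel. norm (singular_kernel d lam u) \<le> norm (exp (2 * pi) * (1 / sqrt y) ^ (d - 4) * (1 / (u\<^sup>2 + y\<^sup>2)))"
    by (intro AE_I2) (metis abs_ge_self order_trans real_norm_def)
qed (use lam in measurable)

text \<open>The substitution \<open>u = - y * v\<close> with \<open>y = 1 / lam\<close> turns
  \<open>- 2 * \<i> * w\<close> into \<open>2 * y * (1 + \<i> * v)\<close> and the exponent into
  \<open>2 * pi * (1 + \<i> * v)\<close>. What results is \<open>inverse_laplace_gamma\<close> at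
  \<open>k = d / 2\<close> and \<open>x = 2 * pi\<close>.\<close>

lemma singular_integral:
  assumes lam: "lam > 0" and d: "d \<ge> 4"
  shows "(LINT u|lborel. singular_kernel d lam u) = of_real (sphere_const d * real lam powr (real d / 2 - 1))"
proof -
  define y where "y = 1 / real lam"
  define k where "k = real d / 2"
  have y: "y > 0" using lam by (simp add: y_def)
  have k: "k \<ge> 2" using d by (simp add: k_def)
  have sub: "singular_kernel d lam (0 + (- y) * v) = of_real ((2 * y) powr (- k)) * ((1 + \<i> * of_real v) powr (- of_real k) * exp (of_real (2 * pi) * (1 + \<i> * of_real v)))" for v
  proof -
    have w: "- 2 * \<i> * Complex (- y * v) y = of_real (2 * y) * (1 + \<i> * of_real v)"
      by (simp add: complex_eq_iff)
    have v0: "1 + \<i> * complex_of_real v \<noteq> 0" by (simp add: complex_eq_iff)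
    have ly: "Ln (of_real (2 * y) * (1 + \<i> * of_real v)) = of_real (ln (2 * y)) + Ln (1 + \<i> * of_real v)"
      using Ln_times_of_real[of "2 * y" "1 + \<i> * of_real v"] Ln_of_real[of "2 * y"] y v0 by simp
    have nz: "of_real (2 * y) * (1 + \<i> * complex_of_real v) \<noteq> 0" using y v0 by simp
    have "((of_real (2 * y) * (1 + \<i> * complex_of_real v)) powr (-1/2)) ^ d = exp (of_nat d * ((-1/2) * Ln (of_real (2 * y) * (1 + \<i> * of_real v))))"
      using nz by (simp only: powr_def if_False exp_of_nat_mult)
    also have "of_nat d * ((-1/2) * Ln (of_real (2 * y) * (1 + \<i> * of_real v))) = of_real (- k * ln (2 * y)) + - of_real k * Ln (1 + \<i> * of_real v)"
      unfolding ly by (simp add: k_def algebra_simps)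
    also have "exp \<dots> = of_real ((2 * y) powr (- k)) * (1 + \<i> * of_real v) powr (- of_real k)"
    proof -
      have "(2 * y) powr (- k) = exp (- k * ln (2 * y))" using y by (simp add: powr_def)
      moreover have "(1 + \<i> * complex_of_real v) powr (- of_real k) = exp (- of_real k * Ln (1 + \<i> * of_real v))"
        using v0 by (simp only: powr_def if_False)
      ultimately show ?thesis by (simp only: exp_add exp_of_real)
    qed
    finally have 1: "((- 2 * \<i> * Complex (- y * v) y) powr (-1/2)) ^ d = of_real ((2 * y) powr (- k)) * (1 + \<i> * of_real v) powr (- of_real k)"
      unfolding w .
    have 2: "2 * pi * \<i> * Complex (- y * v) y * (- of_nat lam) = of_real (2 * pi) * (1 + \<i> * of_real v)"
      using lam by (simp add: complex_eq_iff y_def)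
    show ?thesis unfolding singular_kernel_def y_def[symmetric] add_0 1 2 by (simp only: mult.assoc)
  qed
  have "(LINT u|lborel. singular_kernel d lam u) = \<bar>- y\<bar> *\<^sub>R (LINT v|lborel. singular_kernel d lam (0 + (- y) * v))"
    using y by (intro lborel_integral_real_affine) auto
  also have "\<dots> = of_real y * (of_real ((2 * y) powr (- k)) * of_real (2 * pi * (2 * pi) powr (k - 1) / Gamma k))"
    unfolding sub integral_mult_right_zero using k y
    by (subst inverse_laplace_gamma) (auto simp: scaleR_conv_of_real)
  also have "\<dots> = of_real (y * (2 * y) powr (- k) * (2 * pi * (2 * pi) powr (k - 1) / Gamma k))"
    by simp
  also have "y * (2 * y) powr (- k) * (2 * pi * (2 * pi) powr (k - 1) / Gamma k) = pi powr k / Gamma k * real lam powr (k - 1)"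
  proof -
    have "2 * pi * (2 * pi) powr (k - 1) = (2 * pi) powr k" by (simp add: powr_diff)
    then have "y * (2 * y) powr (- k) * (2 * pi * (2 * pi) powr (k - 1) / Gamma k) = y * ((2 * y) powr (- k) * (2 * pi) powr k) / Gamma k"
      by simp
    also have "(2 * y) powr (- k) * (2 * pi) powr k = pi powr k * real lam powr k"
      using y lam by (simp add: powr_mult powr_minus y_def powr_divide)
    also have "y * (pi powr k * real lam powr k) / Gamma k = pi powr k / Gamma k * real lam powr (k - 1)"
      using lam by (simp add: y_def powr_diff)
    finally show ?thesis .
  qed
  finally show ?thesis by (simp add: sphere_const_def k_def)
qed

text \<open>
  The tail is estimated crudely by a Cauchy integral over the whole line; after summation over \<open>q\<close> this
  costs no more than the error of the theta approximation.
\<close>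

lemma singular_kernel_tail:
  assumes lam: "lam > 0" and d: "d \<ge> 4" and \<delta>: "\<delta> > 0"
  shows "norm ((LINT u:{-\<delta><..<\<delta>}|lborel. singular_kernel d lam u) - of_real (sphere_const d * real lam powr (real d / 2 - 1)))
      \<le> exp (2 * pi) * (1 / sqrt \<delta>) ^ (d - 4) * (cauchy_mass * real lam)"
proof -
  define y where "y = 1 / real lam"
  have y: "y > 0" using lam by (simp add: y_def)
  have int: "integrable lborel (singular_kernel d lam)" by (rule singular_kernel_integrable[OF lam d])
  have int1: "integrable lborel (\<lambda>u. indicator {-\<delta><..<\<delta>} u *\<^sub>R singular_kernel d lam u)"
    using int by (intro integrable_mult_indicator) auto
  have "(LINT u:{-\<delta><..<\<delta>}|lborel. singular_kernel d lam u) - (LINT u|lborel. singular_kernel d lam u) =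
     (LINT u|lborel. indicator {-\<delta><..<\<delta>} u *\<^sub>R singular_kernel d lam u - singular_kernel d lam u)"
    unfolding set_lebesgue_integral_def using int int1 by simp
  also have "norm \<dots> \<le> (LINT u|lborel. exp (2 * pi) * (1 / sqrt \<delta>) ^ (d - 4) * (1 / (u\<^sup>2 + y\<^sup>2)))"
  proof (rule order_trans[OF integral_norm_bound], rule integral_mono)
    show "integrable lborel (\<lambda>u. norm (indicator {-\<delta><..<\<delta>} u *\<^sub>R singular_kernel d lam u - singular_kernel d lam u))"
      using int int1 by (intro integrable_norm Bochner_Integration.integrable_diff)
    show "integrable lborel (\<lambda>u. exp (2 * pi) * (1 / sqrt \<delta>) ^ (d - 4) * (1 / (u\<^sup>2 + y\<^sup>2)))"
      using cauchy_kernel(1)[OF y] by (intro integrable_mult_right)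
    fix u
    show "norm (indicator {-\<delta><..<\<delta>} u *\<^sub>R singular_kernel d lam u - singular_kernel d lam u) \<le> exp (2 * pi) * (1 / sqrt \<delta>) ^ (d - 4) * (1 / (u\<^sup>2 + y\<^sup>2))"
    proof (cases "u \<in> {-\<delta><..<\<delta>}")
      case True
      then show ?thesis using \<delta> by simp
    next
      case False
      then have "\<delta> \<le> \<bar>u\<bar>" by auto
      also have "\<dots> \<le> norm (Complex u (1 / real lam))" using abs_Re_le_cmod[of "Complex u (1 / real lam)"] by simp
      finally show ?thesis using norm_singular_kernel_outside[OF lam d \<delta>] False by (simp add: y_def)
    qed
  qed
  also have "\<dots> = exp (2 * pi) * (1 / sqrt \<delta>) ^ (d - 4) * (cauchy_mass * real lam)"
    unfolding integral_mult_right_zero cauchy_kernel(2)[OF y] by (simp add: y_def)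
  finally show ?thesis unfolding singular_integral[OF lam d] .
qed

section \<open>Dissection into arcs and pointwise estimates\<close>

locale circle_method =
  fixes d p lam :: nat and a :: "nat \<Rightarrow> int"
  assumes d: "d \<ge> 5" and p: "p > 0" and lam: "lam > 0"
begin

text \<open>All sizes are powers of \<open>R\<close>: \<open>lam = R ^ 4\<close>, \<open>Q\<close>
  is about \<open>R^2\<close>, the height is \<open>1 / R ^ 4\<close>, and the error of the theta
  approximation is \<open>O(R)\<close>.\<close>

definition R :: real where "R = real lam powr (1/4)"
definition Q :: nat where "Q = nat \<lfloor>sqrt (real lam)\<rfloor>"

lemma R_ge_1: "R \<ge> 1" unfolding R_def using lam by (intro ge_one_powr_ge_zero) auto

lemma R_pos: "R > 0" using R_ge_1 by linarith

lemma R_sq: "R\<^sup>2 = sqrt (real lam)"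
  unfolding R_def using lam by (simp add: powr_power powr_half_sqrt)

lemma R_pow_4: "R ^ 4 = real lam"
proof -
  have "R ^ 4 = (R\<^sup>2)\<^sup>2" by (simp flip: power_mult)
  then show ?thesis by (simp add: R_sq)
qed

lemma Q_bounds: "Q \<ge> 1" "real Q \<le> R\<^sup>2" "R\<^sup>2 \<le> 2 * real Q"
proof -
  have "sqrt (real lam) \<ge> 1" using lam by simp
  then have fl: "\<lfloor>sqrt (real lam)\<rfloor> \<ge> 1" by (simp add: le_floor_iff)
  then show "Q \<ge> 1" unfolding Q_def by linarith
  have q: "real Q = of_int \<lfloor>sqrt (real lam)\<rfloor>" unfolding Q_def using fl by simp
  show "real Q \<le> R\<^sup>2" unfolding q R_sq by (rule of_int_floor_le)
  have "sqrt (real lam) < real Q + 1" unfolding q by linarith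
  then show "R\<^sup>2 \<le> 2 * real Q" unfolding R_sq using \<open>Q \<ge> 1\<close> by linarith
qed

definition offset :: "nat \<Rightarrow> int \<Rightarrow> real \<Rightarrow> complex" where
  "offset q h x = Complex (x - of_int h / of_nat q) (1 / real lam)"

lemma Im_offset: "Im (offset q h x) = 1 / real lam" "Im (offset q h x) > 0"
  using lam by (auto simp: offset_def)

lemma norm_offset_pos: "norm (offset q h x) > 0"
  using Im_offset(2)[of q h x] by auto

lemma Complex_offset: "Complex x (1 / real lam) = of_int h / of_nat q + offset q h x"
  by (simp add: offset_def complex_eq_iff)

text \<open>Horizontal distance and height both contribute \<open>O(1 / (q * R^2))\<close>. This is
  what makes \<open>q * norm w / Im w\<close>, the quantity in \<open>theta_approx\<close>, at most
  \<open>3 * R^2\<close>.\<close>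

lemma near_fraction:
  assumes q: "1 \<le> q" "q \<le> Q" and x: "\<bar>x - of_int h / of_nat q\<bar> \<le> 1 / (real q * real Q)"
  shows "real q * norm (offset q h x) \<le> 3 / R\<^sup>2"
proof -
  have "norm (offset q h x) \<le> \<bar>x - of_int h / of_nat q\<bar> + 1 / real lam"
    using cmod_le[of "offset q h x"] by (simp add: offset_def)
  also have "\<dots> \<le> 1 / (real q * real Q) + 1 / real lam" using x by simp
  finally have "real q * norm (offset q h x) \<le> real q * (1 / (real q * real Q) + 1 / real lam)"
    by (intro mult_left_mono) auto
  also have "\<dots> = 1 / real Q + real q / real lam" using q by (simp add: distrib_left)
  also have "\<dots> \<le> 2 / R\<^sup>2 + 1 / R\<^sup>2"
  proof (rule add_mono)
    show "1 / real Q \<le> 2 / R\<^sup>2" using Q_bounds R_pos by (simp add: field_simps)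
    have "real q \<le> R\<^sup>2" using q Q_bounds(2) by linarith
    then have "real q / R ^ 4 \<le> R\<^sup>2 / R ^ 4" using R_pos by (intro divide_right_mono) auto
    also have "R\<^sup>2 / R ^ 4 = 1 / R\<^sup>2" using R_pos by (simp add: power_numeral_reduce field_simps)
    finally show "real q / real lam \<le> 1 / R\<^sup>2" by (simp add: R_pow_4)
  qed
  finally show ?thesis by (simp add: add_divide_distrib[symmetric])
qed

definition main_factor :: "nat \<Rightarrow> int \<Rightarrow> real \<Rightarrow> nat \<Rightarrow> complex" where
  "main_factor q h x i = cong_gauss p q h (a i) 0 / of_nat (lcm p q) * (- 2 * \<i> * offset q h x) powr (-1/2)"

lemma theta_near_fraction:
  assumes q: "1 \<le> q" "q \<le> Q" and h: "coprime h (int q)" and x: "\<bar>x - of_int h / of_nat q\<bar> \<le> 1 / (real q * real Q)"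
  shows "norm (theta_series p (a i) (Complex x (1 / real lam)) - main_factor q h x i) \<le> 5 * R"
    and "norm (main_factor q h x i) \<le> 1 / sqrt (real q * norm (offset q h x))"
proof -
  have q0: "q > 0" using q by simp
  have "real q * norm (offset q h x) / Im (offset q h x) = (real q * norm (offset q h x)) * R ^ 4"
    using lam by (simp add: Im_offset R_pow_4)
  also have "\<dots> \<le> (3 / R\<^sup>2) * R ^ 4" using near_fraction[OF q x] R_pos by (intro mult_right_mono) auto
  also have "\<dots> = 3 * R\<^sup>2" using R_pos by (simp add: power_numeral_reduce field_simps)
  finally have "2 * pi * (real q * norm (offset q h x) / Im (offset q h x)) \<le> (2 * pi) * (3 * R\<^sup>2)"
    by (intro mult_left_mono) auto
  \<comment> \<open>\<open>2 * pi < 8\<close> and \<open>24 \<le> 25\<close> are the origin of the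
    constant 5.\<close>
  also have "\<dots> \<le> 8 * (3 * R\<^sup>2)" using pi_less_4 by (intro mult_right_mono) auto
  also have "\<dots> \<le> (5 * R)\<^sup>2" by (simp add: power_mult_distrib)
  finally have "sqrt (2 * pi * (real q * norm (offset q h x) / Im (offset q h x))) \<le> 5 * R"
    using R_pos by (intro real_le_lsqrt) auto
  then show "norm (theta_series p (a i) (Complex x (1 / real lam)) - main_factor q h x i) \<le> 5 * R"
    using theta_approx[where b="a i" and w="offset q h x", OF p q0 h Im_offset(2)] unfolding main_factor_def Complex_offset[of x h q] by linarith
  show "norm (main_factor q h x i) \<le> 1 / sqrt (real q * norm (offset q h x))"
    unfolding main_factor_def by (rule theta_main_bound[OF p q0 h Im_offset(2)])
qed

definition coeff :: "nat \<Rightarrow> int \<Rightarrow> complex" where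
  "coeff q h = cis2pi (of_int (- h * int lam) / of_nat q) * (\<Prod>i<d. cong_gauss p q h (a i) 0 / of_nat (lcm p q))"

lemma prod_main_factor:
  "(\<Prod>i<d. main_factor q h x i) * exp (2 * pi * \<i> * Complex x (1 / real lam) * (- of_nat lam)) =
     coeff q h * singular_kernel d lam (x - of_int h / of_nat q)"
proof -
  have "exp (2 * pi * \<i> * Complex x (1 / real lam) * (- of_nat lam)) =
     exp (2 * pi * \<i> * of_real (of_int (- h * int lam) / of_nat q) + 2 * pi * \<i> * offset q h x * (- of_nat lam))"
    unfolding Complex_offset[of x h q] by (simp add: algebra_simps)
  also have "\<dots> = cis2pi (of_int (- h * int lam) / of_nat q) * exp (2 * pi * \<i> * offset q h x * (- of_nat lam))"
    unfolding exp_add cis2pi_def ..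
  finally have e: "exp (2 * pi * \<i> * Complex x (1 / real lam) * (- of_nat lam)) = cis2pi (of_int (- h * int lam) / of_nat q) * exp (2 * pi * \<i> * offset q h x * (- of_nat lam))" .
  have "(\<Prod>i<d. main_factor q h x i) = (\<Prod>i<d. cong_gauss p q h (a i) 0 / of_nat (lcm p q)) * ((- 2 * \<i> * offset q h x) powr (-1/2)) ^ d"
    unfolding main_factor_def prod.distrib by simp
  then show ?thesis unfolding e coeff_def singular_kernel_def offset_def[symmetric] by (simp only: mult_ac)
qed

text \<open>\<open>norm_prod_diff_le\<close> with \<open>B = 11 * X\<close> and
  \<open>e = 5 * R\<close>, where \<open>X = 1 / sqrt (q * norm w)\<close>: because of
  \<open>R \<le> 2 * X\<close>, a theta factor is at most \<open>X + 5 * R \<le> 11 * X\<close>. The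
  exponential has modulus \<open>exp (2 * pi)\<close> on the line of height
  \<open>1 / lam\<close>.\<close>

definition arc_const :: real where "arc_const = exp (2 * pi) * (real d * 11 ^ (d - 1) * 5)"

text \<open>Near a fraction \<open>R\<close> is at most a multiple of the bound \<open>X\<close> for
  a main factor, so the product of \<open>d\<close> factors errs by
  \<open>O(R * X ^ (d - 1))\<close>. Four of the \<open>X\<close> give \<open>1 / q^2\<close> times
  the Cauchy kernel, which can be integrated over the line; the other \<open>d - 5\<close> are
  replaced by their bound \<open>R^2\<close>, whence the exponent \<open>2 * d - 9\<close>.\<close>

lemma arc_error:
  assumes q: "1 \<le> q" "q \<le> Q" and h: "coprime h (int q)" and x: "\<bar>x - of_int h / of_nat q\<bar> \<le> 1 / (real q * real Q)"
  shows "norm (theta_integrand d lam p a (Complex x (1 / real lam)) - coeff q h * singular_kernel d lam (x - of_int h / of_nat q))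
    \<le> arc_const * (R ^ (2 * d - 9) / (real q)\<^sup>2) * (1 / ((x - of_int h / of_nat q)\<^sup>2 + (1 / real lam)\<^sup>2))"
proof -
  define n where "n = norm (offset q h x)"
  define X where "X = 1 / sqrt (real q * n)"
  have n: "n > 0" unfolding n_def by (rule norm_offset_pos)
  have qn: "real q * n > 0" using q n by simp
  have X: "X > 0" using qn by (simp add: X_def)
  have X2: "X\<^sup>2 = 1 / (real q * n)" using qn by (simp add: X_def power_divide)
  have RX: "R \<le> 2 * X"
  proof (rule power2_le_imp_le)
    have "R\<^sup>2 \<le> 3 / (real q * n)" using near_fraction[OF q x] qn R_pos unfolding n_def[symmetric] by (simp add: field_simps)
    also have "\<dots> \<le> 4 / (real q * n)" using qn by (intro divide_right_mono) auto
    finally show "R\<^sup>2 \<le> (2 * X)\<^sup>2" by (simp add: power_mult_distrib X2)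
  qed (use X in auto)
  have XR: "X \<le> R\<^sup>2"
  proof (rule power2_le_imp_le)
    have "1 / R ^ 4 \<le> n" unfolding n_def R_pow_4 using abs_Im_le_cmod[of "offset q h x"] by (simp add: Im_offset)
    then have "1 / n \<le> R ^ 4" using n R_pos by (simp add: field_simps)
    moreover have "1 / (real q * n) \<le> 1 / n" using q n by (intro divide_left_mono) auto
    ultimately have "X\<^sup>2 \<le> R ^ 4" unfolding X2 by linarith
    then show "X\<^sup>2 \<le> (R\<^sup>2)\<^sup>2" by (simp flip: power_mult)
  qed simp
  have main: "norm (main_factor q h x i) \<le> 11 * X" for i
    using theta_near_fraction(2)[OF q h x, of i] X unfolding n_def[symmetric] X_def[symmetric] by linarith
  have diff: "norm (theta_series p (a i) (Complex x (1 / real lam)) - main_factor q h x i) \<le> 5 * R" for i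
    by (rule theta_near_fraction(1)[OF q h x])
  have theta: "norm (theta_series p (a i) (Complex x (1 / real lam))) \<le> 11 * X" for i
  proof -
    have "norm (theta_series p (a i) (Complex x (1 / real lam))) \<le> norm (main_factor q h x i) + norm (theta_series p (a i) (Complex x (1 / real lam)) - main_factor q h x i)"
      by (rule norm_triangle_sub)
    also have "\<dots> \<le> X + 5 * R"
      using theta_near_fraction(2)[OF q h x, of i] diff[of i] unfolding n_def[symmetric] X_def[symmetric] by linarith
    finally show ?thesis using RX by linarith
  qed
  have "norm ((\<Prod>i<d. theta_series p (a i) (Complex x (1 / real lam))) - (\<Prod>i<d. main_factor q h x i)) \<le> real d * (11 * X) ^ (d - 1) * (5 * R)"
    by (rule norm_prod_diff_le) (use main diff theta X R_pos in auto)
  then have "norm (theta_integrand d lam p a (Complex x (1 / real lam)) - coeff q h * singular_kernel d lam (x - of_int h / of_nat q)) \<le> real d * (11 * X) ^ (d - 1) * (5 * R) * exp (2 * pi)"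
    unfolding theta_integrand_def prod_main_factor[symmetric] left_diff_distrib[symmetric] norm_mult
    by (intro mult_mono) (use norm_exp_height[OF lam, of "Complex x (1 / real lam)"] X R_pos in \<open>auto intro!: mult_nonneg_nonneg\<close>)
  also have "\<dots> = arc_const * (R * X ^ (d - 1))" by (simp add: arc_const_def power_mult_distrib)
  also have "X ^ (d - 1) = X ^ (d - 5) * X ^ 4"
  proof -
    have "d - 1 = (d - 5) + 4" using d by simp
    then show ?thesis by (metis power_add)
  qed
  also have "X ^ 4 = 1 / (real q)\<^sup>2 * (1 / n\<^sup>2)"
  proof -
    have "X ^ 4 = (X\<^sup>2)\<^sup>2" by (simp flip: power_mult)
    then show ?thesis by (simp add: X2 power_divide power_mult_distrib)
  qed
  also have "arc_const * (R * (X ^ (d - 5) * (1 / (real q)\<^sup>2 * (1 / n\<^sup>2)))) \<le> arc_const * (R * ((R\<^sup>2) ^ (d - 5) * (1 / (real q)\<^sup>2 * (1 / n\<^sup>2))))"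
    using X XR R_pos by (intro mult_left_mono mult_right_mono power_mono) (auto simp: arc_const_def)
  also have "R * ((R\<^sup>2) ^ (d - 5) * (1 / (real q)\<^sup>2 * (1 / n\<^sup>2))) = R ^ (2 * d - 9) / (real q)\<^sup>2 * (1 / n\<^sup>2)"
  proof -
    have "2 * d - 9 = Suc (2 * (d - 5))" using d by simp
    then have "R ^ (2 * d - 9) = R * (R\<^sup>2) ^ (d - 5)" by (simp add: power_mult)
    then show ?thesis by simp
  qed
  also have "n\<^sup>2 = (x - of_int h / of_nat q)\<^sup>2 + (1 / real lam)\<^sup>2"
    unfolding n_def offset_def by (rule norm_Complex_sq)
  finally show ?thesis by (simp add: mult.assoc)
qed

text \<open>Half of the Dirichlet radius \<open>1 / (q * Q)\<close>. Halving makes the arcs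
  disjoint, and the points between the two radii are still close enough to \<open>h / q\<close> for
  the theta approximation.\<close>

definition radius :: "nat \<Rightarrow> real" where "radius q = 1 / (2 * real q * real Q)"
definition arc :: "nat \<Rightarrow> int \<Rightarrow> real set" where
  "arc q h = {of_int h / of_nat q - radius q <..< of_int h / of_nat q + radius q}"

text \<open>The left end of the arc around \<open>0 / 1\<close>. With this start no arc has to be
  cut and reassembled modulo 1.\<close>

definition left_end :: real where "left_end = - (1 / (2 * real Q))"

lemma radius_pos: "q \<ge> 1 \<Longrightarrow> radius q > 0"
  using Q_bounds by (simp add: radius_def)

lemma arc_margin:
  assumes "1 \<le> q" "q \<le> Q"
  shows "1 / real q - radius q \<ge> 1 / (2 * real Q)" "radius q \<le> 1 / (2 * real Q)"
proof -
  have "real q \<le> 2 * real Q - 1" using assms by linarith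
  then show "1 / real q - radius q \<ge> 1 / (2 * real Q)"
    using assms by (simp add: radius_def field_simps)
  show "radius q \<le> 1 / (2 * real Q)"
    unfolding radius_def using assms by (intro divide_left_mono) auto
qed

lemma arc_subset:
  assumes q: "1 \<le> q" "q \<le> Q" and h: "h \<in> unit_residues q"
  shows "arc q h \<subseteq> {left_end..left_end + 1}"
proof
  fix x assume x: "x \<in> arc q h"
  have h': "0 \<le> h" "h \<le> int q - 1" using h by (auto simp: unit_residues_def residue_set_def)
  have "of_int h / real q \<ge> 0" using h' by simp
  moreover have "of_int h / real q \<le> 1 - 1 / real q"
  proof -
    have "real_of_int h \<le> real q - 1" using h' by linarith
    then have "of_int h / real q \<le> (real q - 1) / real q" by (intro divide_right_mono) auto
    then show ?thesis using q by (simp add: diff_divide_distrib)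
  qed
  ultimately show "x \<in> {left_end..left_end + 1}"
    using x arc_margin[OF q] by (auto simp: arc_def left_end_def)
qed

text \<open>Distinct reduced fractions differ by at least \<open>1 / (q * q')\<close>, while the two
  radii add up to \<open>(q + q') / (2 * Q * q * q')\<close>, which is no larger. Strictness comes
  from the arcs being open.\<close>

lemma arc_disjoint:
  assumes q: "1 \<le> q" "q \<le> Q" "1 \<le> q'" "q' \<le> Q" and h: "h \<in> unit_residues q" "h' \<in> unit_residues q'"
    and x: "x \<in> arc q h" "x \<in> arc q' h'"
  shows "q = q' \<and> h = h'"
proof -
  have cop: "coprime h (int q)" "coprime h' (int q')" using h by (auto simp: unit_residues_def)
  have "\<bar>of_int h / real q - of_int h' / real q'\<bar> < radius q + radius q'"
    using x by (auto simp: arc_def abs_less_iff)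
  also have "radius q + radius q' = (real q + real q') / (2 * real Q) / (real q * real q')"
    using q by (simp add: radius_def field_simps)
  also have "\<dots> \<le> 1 / (real q * real q')"
    using q by (intro divide_right_mono) (auto simp: field_simps)
  finally have "\<bar>of_int h / real q - of_int h' / real q'\<bar> * (real q * real q') < 1"
    using q by (simp add: field_simps)
  moreover have "\<bar>of_int h / real q - of_int h' / real q'\<bar> * (real q * real q') = \<bar>(of_int h / real q - of_int h' / real q') * (real q * real q')\<bar>"
    by (simp add: abs_mult)
  moreover have "(of_int h / real q - of_int h' / real q') * (real q * real q') = real_of_int (h * int q' - h' * int q)"
    using q by (simp add: field_simps)
  ultimately have "\<bar>real_of_int (h * int q' - h' * int q)\<bar> < 1" by simp
  then have eq: "h * int q' = h' * int q" by linarith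
  have "int q dvd h * int q'" by (simp add: eq)
  then have "int q dvd int q'" using cop(1) by (simp add: coprime_dvd_mult_right_iff coprime_commute)
  moreover have "int q' dvd h' * int q" by (simp flip: eq)
  then have "int q' dvd int q" using cop(2) by (simp add: coprime_dvd_mult_right_iff coprime_commute)
  ultimately have "q = q'" by (simp add: dvd_antisym)
  then show ?thesis using eq q by simp
qed

definition arcs :: "(nat \<times> int) set" where "arcs = Sigma {1..Q} unit_residues"

text \<open>The Dirichlet fraction is within \<open>1 / (q * Q)\<close>, so the theta error is at
  most \<open>5 * R\<close>; being at least \<open>radius q\<close> away from it bounds the main
  factor by \<open>2 * R\<close>.\<close>

lemma minor_bound:
  assumes x: "x \<in> {left_end..left_end + 1}" and nx: "x \<notin> (\<Union>(q, h)\<in>arcs. arc q h)"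
  shows "norm (theta_integrand d lam p a (Complex x (1 / real lam))) \<le> exp (2 * pi) * (7 * R) ^ d"
proof -
  obtain h k where hk: "coprime h k" "0 < k" "k \<le> int Q" "\<bar>of_int k * x - of_int h\<bar> < 1 / real Q"
    using Dirichlet_approx_coprime[of Q x] Q_bounds(1) by (metis less_le_trans zero_less_one)
  define q where "q = nat k"
  have q: "1 \<le> q" "q \<le> Q" and k: "k = int q" using hk by (auto simp: q_def)
  have h: "coprime h (int q)" using hk(1) k by simp
  have "\<bar>x - of_int h / real q\<bar> * real q = \<bar>of_int k * x - of_int h\<bar>"
  proof -
    have "of_int k * x - of_int h = (x - of_int h / real q) * real q"
      using q k by (simp add: field_simps)
    then show ?thesis by (simp add: abs_mult)
  qed
  then have "\<bar>x - of_int h / real q\<bar> * real q < 1 / real Q" using hk(4) by simp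
  then have near: "\<bar>x - of_int h / real q\<bar> \<le> 1 / (real q * real Q)"
    using q by (simp add: field_simps)
  have far: "\<bar>x - of_int h / real q\<bar> \<ge> radius q"
  proof (rule ccontr)
    assume "\<not> \<bar>x - of_int h / real q\<bar> \<ge> radius q"
    then have xa: "x \<in> arc q h" by (auto simp: arc_def abs_less_iff)
    \<comment> \<open>Dirichlet's theorem does not confine \<open>h\<close> to
      \<open>0 \<le> h < q\<close>. A fraction outside that range whose arc contained
      \<open>x\<close> would push \<open>x\<close> out of the unit interval that starts at
      \<open>left_end\<close>.\<close>
    have "h \<ge> 0"
    proof (rule ccontr)
      assume "\<not> h \<ge> 0"
      then have "real_of_int h \<le> -1" by linarith
      then have "of_int h / real q \<le> (-1) / real q" by (intro divide_right_mono) auto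
      then have "x < - (1 / (2 * real Q))" using xa arc_margin[OF q] by (auto simp: arc_def)
      then show False using x by (simp add: left_end_def)
    qed
    moreover have "h < int q"
    proof (rule ccontr)
      assume "\<not> h < int q"
      then have "real_of_int h \<ge> real q" by linarith
      then have "of_int h / real q \<ge> 1" using q by simp
      then have "x > 1 - 1 / (2 * real Q)" using xa arc_margin[OF q] by (auto simp: arc_def)
      then show False using x by (simp add: left_end_def)
    qed
    ultimately have "h \<in> unit_residues q" using h by (simp add: unit_residues_def residue_set_def)
    then have "(q, h) \<in> arcs" using q by (simp add: arcs_def)
    then show False using nx xa by blast
  qed
  define n where "n = norm (offset q h x)"
  have "radius q \<le> n"
    using far abs_Re_le_cmod[of "offset q h x"] by (simp add: n_def offset_def)
  then have "real q * radius q \<le> real q * n" by (intro mult_left_mono) auto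
  then have "1 / (2 * real Q) \<le> real q * n" using q by (simp add: radius_def)
  moreover have "1 / (2 * R\<^sup>2) \<le> 1 / (2 * real Q)" using Q_bounds R_pos by (intro divide_left_mono) auto
  ultimately have qn: "1 / (2 * R\<^sup>2) \<le> real q * n" by linarith
  have qn0: "real q * n > 0" using q norm_offset_pos[of q h x] by (simp add: n_def)
  have X: "1 / sqrt (real q * n) \<le> 2 * R"
  proof (rule power2_le_imp_le)
    have "1 / (real q * n) \<le> 2 * R\<^sup>2" using qn qn0 R_pos by (simp add: field_simps)
    then have "1 / (real q * n) \<le> 4 * R\<^sup>2" using zero_le_power2[of R] by linarith
    then show "(1 / sqrt (real q * n))\<^sup>2 \<le> (2 * R)\<^sup>2" using qn0 by (simp add: power_divide power_mult_distrib)
  qed (use R_pos in auto)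
  have theta: "norm (theta_series p (a i) (Complex x (1 / real lam))) \<le> 7 * R" for i
  proof -
    have "norm (theta_series p (a i) (Complex x (1 / real lam))) \<le> norm (main_factor q h x i) + norm (theta_series p (a i) (Complex x (1 / real lam)) - main_factor q h x i)"
      by (rule norm_triangle_sub)
    also have "\<dots> \<le> 2 * R + 5 * R"
      using theta_near_fraction[OF q h near, of i] X unfolding n_def[symmetric] by linarith
    finally show ?thesis by simp
  qed
  have "norm (\<Prod>i<d. theta_series p (a i) (Complex x (1 / real lam))) \<le> (\<Prod>i<d. 7 * R)"
    unfolding prod_norm[symmetric] by (intro prod_mono conjI norm_ge_zero theta)
  then show ?thesis unfolding theta_integrand_def norm_mult
    using norm_exp_height[OF lam, of "Complex x (1 / real lam)"] by (simp add: mult.commute)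
qed

end

section \<open>Integration over the arcs and summation over denominators\<close>

context circle_method
begin

definition main_value :: complex where
  "main_value = of_real (sphere_const d * real lam powr (real d / 2 - 1))"

definition major_const :: real where
  "major_const = (arc_const + exp (2 * pi) * 2 ^ d) * cauchy_mass"

lemma norm_coeff:
  assumes q: "1 \<le> q" and h: "h \<in> unit_residues q"
  shows "norm (coeff q h) \<le> (sqrt 2 / sqrt (real q)) ^ d"
proof -
  have q0: "q > 0" and cop: "coprime h (int q)" using q h by (auto simp: unit_residues_def)
  have "norm (cong_gauss p q h (a i) 0 / of_nat (lcm p q)) \<le> sqrt 2 / sqrt (real q)" for i
  proof -
    have "q \<le> lcm p q" using p q0 by (intro dvd_imp_le) (auto simp: lcm_pos_nat)
    then have "norm (cong_gauss p q h (a i) 0) / real (lcm p q) \<le> sqrt (2 * real q) / real q"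
      using norm_cong_gauss[OF p q0 cop, of "a i" 0] q0 by (intro frac_le) auto
    also have "\<dots> = sqrt 2 / sqrt (real q)" using q0 by (simp add: real_sqrt_mult field_simps)
    finally show ?thesis by (simp add: norm_divide)
  qed
  then have "norm (\<Prod>i<d. cong_gauss p q h (a i) 0 / of_nat (lcm p q)) \<le> (\<Prod>i<d. sqrt 2 / sqrt (real q))"
    unfolding prod_norm[symmetric] by (intro prod_mono conjI norm_ge_zero)
  then show ?thesis by (simp add: coeff_def norm_mult)
qed

text \<open>\<open>1 / sqrt (radius q)\<close> grows like \<open>sqrt q\<close>, so
  \<open>d - 4\<close> of the \<open>d\<close> coefficient factors \<open>1 / sqrt q\<close> are
  used up against it and four remain, giving \<open>1 / q^2\<close>; the price is
  \<open>R ^ (d - 4)\<close> from \<open>sqrt Q \<le> R\<close>.\<close>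

lemma coeff_radius_bound:
  assumes q: "1 \<le> q"
  shows "(sqrt 2 / sqrt (real q)) ^ d * (1 / sqrt (radius q)) ^ (d - 4) \<le> 2 ^ d * R ^ (d - 4) / (real q)\<^sup>2"
proof -
  define s where "s = sqrt (real q)"
  have s: "s > 0" "s\<^sup>2 = real q" using q by (auto simp: s_def)
  have Qr: "sqrt (real Q) \<le> R" using Q_bounds(2) R_pos by (intro real_le_lsqrt) auto
  have rad: "1 / sqrt (radius q) = sqrt 2 * s * sqrt (real Q)"
    by (simp add: radius_def real_sqrt_divide real_sqrt_mult s_def)
  have "(sqrt 2 / s) ^ d * (sqrt 2 * s * sqrt (real Q)) ^ (d - 4) = (sqrt 2 / s) ^ 4 * ((sqrt 2 / s) * (sqrt 2 * s * sqrt (real Q))) ^ (d - 4)"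
  proof -
    have "d = 4 + (d - 4)" using d by simp
    then have "(sqrt 2 / s) ^ d = (sqrt 2 / s) ^ 4 * (sqrt 2 / s) ^ (d - 4)" by (metis power_add)
    then show ?thesis by (simp only: power_mult_distrib mult.assoc)
  qed
  also have "(sqrt 2 / s) * (sqrt 2 * s * sqrt (real Q)) = 2 * sqrt (real Q)" using s by simp
  also have "(sqrt 2 / s) ^ 4 = 4 / (real q)\<^sup>2"
  proof -
    have "(sqrt 2 / s) ^ 4 = ((sqrt 2 / s)\<^sup>2)\<^sup>2" by (simp flip: power_mult)
    then show ?thesis by (simp add: power_divide s(2))
  qed
  also have "4 / (real q)\<^sup>2 * (2 * sqrt (real Q)) ^ (d - 4) \<le> 4 / (real q)\<^sup>2 * (2 * R) ^ (d - 4)"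
    using Qr by (intro mult_left_mono power_mono) auto
  also have "\<dots> = (4 * 2 ^ (d - 4)) * R ^ (d - 4) / (real q)\<^sup>2" by (simp add: power_mult_distrib)
  also have "\<dots> \<le> 2 ^ d * R ^ (d - 4) / (real q)\<^sup>2"
  proof -
    have "(4::real) * 2 ^ (d - 4) = 2 ^ (2 + (d - 4))" by (simp add: power_add)
    also have "\<dots> \<le> 2 ^ d" using d by (intro power_increasing) auto
    finally show ?thesis using R_pos by (intro divide_right_mono mult_right_mono) auto
  qed
  finally show ?thesis unfolding rad s_def[symmetric] .
qed

text \<open>Two errors of the common shape \<open>R ^ (2 * d - 5) / q^2\<close>. Integrating the
  Cauchy kernel of \<open>arc_error\<close> gives a factor \<open>lam = R ^ 4\<close> on top of
  \<open>R ^ (2 * d - 9)\<close>; extending the singular integral to the whole line costs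
  \<open>R ^ (d - 4) * lam = R ^ d\<close>, which is no larger because
  \<open>d \<ge> 5\<close>.\<close>

lemma arc_integral:
  assumes q: "1 \<le> q" "q \<le> Q" and h: "h \<in> unit_residues q"
  shows "norm ((LINT x:arc q h|lborel. theta_integrand d lam p a (Complex x (1 / real lam))) - coeff q h * main_value)
     \<le> major_const * R ^ (2 * d - 5) / (real q)\<^sup>2"
proof -
  define y where "y = 1 / real lam"
  have y: "y > 0" using lam by (simp add: y_def)
  define c where "c = of_int h / real q"
  define T where "T = (\<lambda>x. theta_integrand d lam p a (Complex x y))"
  define S where "S = (\<lambda>x. singular_kernel d lam (x - c))"
  have cop: "coprime h (int q)" using h by (simp add: unit_residues_def)
  have d4: "d \<ge> 4" using d by simp
  have r: "radius q > 0" by (rule radius_pos[OF q(1)])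
  have arc: "arc q h = {c - radius q<..<c + radius q}" by (simp add: arc_def c_def)
  have Tint: "set_integrable lborel (arc q h) T"
    unfolding T_def by (rule set_integrable_subset[OF class_count_integral(1)[OF p y, of left_end]])
       (use arc_subset[OF q h] in \<open>auto simp: arc_def\<close>)
  have "integrable lborel S"
    unfolding S_def using lborel_integrable_real_affine[OF singular_kernel_integrable[OF lam d4], of 1 "- c"] by simp
  then have Sint: "set_integrable lborel (arc q h) (\<lambda>x. coeff q h * S x)"
    unfolding set_integrable_def by (intro integrable_mult_indicator integrable_mult_right) (auto simp: arc_def)
  have D1: "norm ((LINT x:arc q h|lborel. T x) - (LINT x:arc q h|lborel. coeff q h * S x)) \<le> arc_const * (R ^ (2 * d - 9) / (real q)\<^sup>2) * (cauchy_mass * real lam)"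
  proof -
    define B where "B = (\<lambda>x. arc_const * (R ^ (2 * d - 9) / (real q)\<^sup>2) * (1 / ((- c + 1 * x)\<^sup>2 + y\<^sup>2)))"
    have c1: "integrable lborel (\<lambda>x. 1 / ((- c + 1 * x)\<^sup>2 + y\<^sup>2))"
      using cauchy_kernel(1)[OF y] by (rule lborel_integrable_real_affine) simp
    have c2: "(LINT x|lborel. 1 / ((- c + 1 * x)\<^sup>2 + y\<^sup>2)) = cauchy_mass * real lam"
      using lborel_integral_real_affine[of 1 "\<lambda>x. 1 / (x\<^sup>2 + y\<^sup>2)" "- c"] cauchy_kernel(2)[OF y] by (simp add: y_def)
    have Bint: "integrable lborel B" unfolding B_def by (intro integrable_mult_right c1)
    have Dint: "set_integrable lborel (arc q h) (\<lambda>x. T x - coeff q h * S x)"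
      by (rule set_integral_diff(1)[OF Tint Sint])
    have "(LINT x:arc q h|lborel. T x) - (LINT x:arc q h|lborel. coeff q h * S x) = (LINT x:arc q h|lborel. T x - coeff q h * S x)"
      by (rule set_integral_diff(2)[OF Tint Sint, symmetric])
    also have "norm \<dots> \<le> (LINT x|lborel. norm (indicator (arc q h) x *\<^sub>R (T x - coeff q h * S x)))"
      unfolding set_lebesgue_integral_def by (rule integral_norm_bound)
    also have "\<dots> \<le> (LINT x|lborel. B x)"
    proof (rule integral_mono)
      show "integrable lborel (\<lambda>x. norm (indicator (arc q h) x *\<^sub>R (T x - coeff q h * S x)))"
        by (rule integrable_norm[OF Dint[unfolded set_integrable_def]])
      fix x
      show "norm (indicator (arc q h) x *\<^sub>R (T x - coeff q h * S x)) \<le> B x"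
      proof (cases "x \<in> arc q h")
        case True
        have "radius q \<le> 1 / (real q * real Q)" unfolding radius_def using q by (intro divide_left_mono) auto
        then have near: "\<bar>x - of_int h / real q\<bar> \<le> 1 / (real q * real Q)"
          using True by (auto simp: arc_def abs_le_iff)
        show ?thesis using arc_error[OF q cop near] True
          by (simp add: B_def T_def S_def c_def y_def)
      next
        case False
        have "B x \<ge> 0" unfolding B_def arc_const_def using R_pos by (intro mult_nonneg_nonneg) (auto simp: add_nonneg_nonneg)
        then show ?thesis using False by simp
      qed
    qed (rule Bint)
    also have "\<dots> = arc_const * (R ^ (2 * d - 9) / (real q)\<^sup>2) * (cauchy_mass * real lam)"
      unfolding B_def integral_mult_right_zero c2 ..
    finally show ?thesis .
  qed
  have "(LINT x:arc q h|lborel. coeff q h * S x) = coeff q h * (LINT x:arc q h|lborel. S x)"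
    by (rule set_integral_mult_right)
  also have "(LINT x:arc q h|lborel. S x) = (LINT u:{- radius q<..<radius q}|lborel. singular_kernel d lam u)"
  proof -
    have "(LINT u:{- radius q<..<radius q}|lborel. singular_kernel d lam u) =
      \<bar>1\<bar> *\<^sub>R (LINT x|lborel. indicator {- radius q<..<radius q} (- c + 1 * x) *\<^sub>R singular_kernel d lam (- c + 1 * x))"
      unfolding set_lebesgue_integral_def by (rule lborel_integral_real_affine) simp
    also have "\<dots> = (LINT x:arc q h|lborel. S x)"
      unfolding set_lebesgue_integral_def arc S_def by (auto intro!: Bochner_Integration.integral_cong simp: indicator_def)
    finally show ?thesis by (rule sym)
  qed
  finally have S_eq: "(LINT x:arc q h|lborel. coeff q h * S x) = coeff q h * (LINT u:{- radius q<..<radius q}|lborel. singular_kernel d lam u)" .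
  have D2: "norm ((LINT x:arc q h|lborel. coeff q h * S x) - coeff q h * main_value) \<le> exp (2 * pi) * (2 ^ d * R ^ (d - 4) / (real q)\<^sup>2) * (cauchy_mass * real lam)"
  proof -
    have "norm ((LINT x:arc q h|lborel. coeff q h * S x) - coeff q h * main_value) = norm (coeff q h) * norm ((LINT u:{- radius q<..<radius q}|lborel. singular_kernel d lam u) - main_value)"
      unfolding S_eq right_diff_distrib[symmetric] norm_mult ..
    also have "\<dots> \<le> (sqrt 2 / sqrt (real q)) ^ d * (exp (2 * pi) * (1 / sqrt (radius q)) ^ (d - 4) * (cauchy_mass * real lam))"
      using norm_coeff[OF q(1) h] singular_kernel_tail[OF lam d4 r] unfolding main_value_def
      by (intro mult_mono) auto
    also have "\<dots> = exp (2 * pi) * ((sqrt 2 / sqrt (real q)) ^ d * (1 / sqrt (radius q)) ^ (d - 4)) * (cauchy_mass * real lam)"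
      by (simp only: mult_ac)
    also have "\<dots> \<le> exp (2 * pi) * (2 ^ d * R ^ (d - 4) / (real q)\<^sup>2) * (cauchy_mass * real lam)"
      by (intro mult_right_mono mult_left_mono coeff_radius_bound[OF q(1)]) (auto simp: cauchy_mass_nonneg)
    finally show ?thesis .
  qed
  have R1: "R ^ (2 * d - 9) * real lam = R ^ (2 * d - 5)"
  proof -
    have "2 * d - 5 = (2 * d - 9) + 4" using d by simp
    then show ?thesis unfolding R_pow_4[symmetric] by (metis power_add)
  qed
  have R2: "R ^ (d - 4) * real lam \<le> R ^ (2 * d - 5)"
    unfolding R_pow_4[symmetric] power_add[symmetric] using d R_ge_1 by (intro power_increasing) auto
  have "norm ((LINT x:arc q h|lborel. T x) - coeff q h * main_value) \<le>
     norm ((LINT x:arc q h|lborel. T x) - (LINT x:arc q h|lborel. coeff q h * S x)) + norm ((LINT x:arc q h|lborel. coeff q h * S x) - coeff q h * main_value)"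
    using norm_triangle_ineq[of "(LINT x:arc q h|lborel. T x) - (LINT x:arc q h|lborel. coeff q h * S x)" "(LINT x:arc q h|lborel. coeff q h * S x) - coeff q h * main_value"] by simp
  also have "\<dots> \<le> arc_const * (R ^ (2 * d - 9) / (real q)\<^sup>2) * (cauchy_mass * real lam) + exp (2 * pi) * (2 ^ d * R ^ (d - 4) / (real q)\<^sup>2) * (cauchy_mass * real lam)"
    by (rule add_mono[OF D1 D2])
  also have "\<dots> = arc_const * cauchy_mass / (real q)\<^sup>2 * (R ^ (2 * d - 9) * real lam) + exp (2 * pi) * 2 ^ d * cauchy_mass / (real q)\<^sup>2 * (R ^ (d - 4) * real lam)"
    by (simp add: mult_ac)
  also have "\<dots> \<le> arc_const * cauchy_mass / (real q)\<^sup>2 * R ^ (2 * d - 5) + exp (2 * pi) * 2 ^ d * cauchy_mass / (real q)\<^sup>2 * R ^ (2 * d - 5)"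
    unfolding R1 by (intro add_mono mult_left_mono R2) (auto simp: cauchy_mass_nonneg arc_const_def)
  also have "\<dots> = major_const * R ^ (2 * d - 5) / (real q)\<^sup>2"
    by (simp add: major_const_def algebra_simps add_divide_distrib)
  finally show ?thesis by (simp add: T_def y_def)
qed

lemma finite_arcs: "finite arcs" by (simp add: arcs_def)

lemma minor_integral:
  "norm (LINT x:({left_end..left_end + 1} - (\<Union>(q, h)\<in>arcs. arc q h))|lborel. theta_integrand d lam p a (Complex x (1 / real lam))) \<le> exp (2 * pi) * (7 * R) ^ d"
proof -
  define B where "B = exp (2 * pi) * (7 * R) ^ d"
  define E where "E = {left_end..left_end + 1} - (\<Union>(q, h)\<in>arcs. arc q h)"
  define T where "T = (\<lambda>x. theta_integrand d lam p a (Complex x (1 / real lam)))"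
  have B: "B \<ge> 0" using R_pos by (simp add: B_def)
  have y: "1 / real lam > 0" using lam by simp
  have "open (\<Union>(q, h)\<in>arcs. arc q h)" by (auto simp: arc_def)
  then have E: "E \<in> sets lborel" unfolding E_def by auto
  have Tint: "set_integrable lborel E T"
    unfolding T_def by (rule set_integrable_subset[OF class_count_integral(1)[OF p y, of left_end] E]) (auto simp: E_def)
  have Bint: "integrable lborel (\<lambda>x. indicator {left_end..left_end + 1} x * B)"
    using integrable_real_indicator[of "{left_end..left_end + 1}" lborel] by simp
  have "norm (LINT x:E|lborel. T x) \<le> (LINT x|lborel. norm (indicator E x *\<^sub>R T x))"
    unfolding set_lebesgue_integral_def by (rule integral_norm_bound)
  also have "\<dots> \<le> (LINT x|lborel. indicator {left_end..left_end + 1} x * B)"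
  proof (rule integral_mono[OF _ Bint])
    show "integrable lborel (\<lambda>x. norm (indicator E x *\<^sub>R T x))" by (rule integrable_norm[OF Tint[unfolded set_integrable_def]])
    fix x
    show "norm (indicator E x *\<^sub>R T x) \<le> indicator {left_end..left_end + 1} x * B"
    proof (cases "x \<in> E")
      case True
      then show ?thesis using minor_bound[of x] by (simp add: E_def T_def B_def)
    next
      case False
      then show ?thesis using B by (simp add: indicator_def)
    qed
  qed
  also have "\<dots> = B" by simp
  finally show ?thesis by (simp add: E_def T_def B_def)
qed

lemma sum_coeff: "(\<Sum>(q, h)\<in>arcs. coeff q h) = (\<Sum>q=1..Q. local_term d p q lam a)"
  unfolding arcs_def local_term_def coeff_def by (subst sum.Sigma[symmetric]) auto

definition harmonic_const :: real where "harmonic_const = (\<Sum>n. real n powr (-5/4))"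

text \<open>
  The logarithm coming from the sum of \<open>1/q\<close> is absorbed by \<open>1/q \<le> q powr (-5/4) * Q powr (1/4)\<close>.
\<close>

lemma sum_inverse_squares_arcs:
  "(\<Sum>(q, h)\<in>arcs. 1 / (real q)\<^sup>2) \<le> harmonic_const * sqrt R"
proof -
  have "(\<Sum>(q, h)\<in>arcs. 1 / (real q)\<^sup>2) = (\<Sum>q=1..Q. \<Sum>h\<in>unit_residues q. 1 / (real q)\<^sup>2)"
    unfolding arcs_def by (subst sum.Sigma) auto
  also have "\<dots> = (\<Sum>q=1..Q. real (card (unit_residues q)) / (real q)\<^sup>2)" by simp
  also have "\<dots> \<le> (\<Sum>q=1..Q. real q powr (-5/4) * sqrt R)"
  proof (rule sum_mono)
    fix q assume q: "q \<in> {1..Q}"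
    have "real (card (unit_residues q)) / (real q)\<^sup>2 \<le> real q / (real q)\<^sup>2"
      using card_unit_residues_le[of q] by (intro divide_right_mono) auto
    also have "\<dots> = real q powr (-1)" using q by (simp add: power2_eq_square powr_minus_divide)
    also have "\<dots> = real q powr (-5/4) * real q powr (1/4)" by (simp flip: powr_add)
    also have "real q powr (1/4) \<le> sqrt R"
    proof -
      have "real q \<le> R\<^sup>2" using q Q_bounds(2) by (meson atLeastAtMost_iff of_nat_mono order_trans)
      then have "real q powr (1/4) \<le> (R\<^sup>2) powr (1/4)" using q by (intro powr_mono2) auto
      also have "\<dots> = sqrt R" using R_pos by (simp add: powr_powr powr_half_sqrt[symmetric] flip: powr_numeral)
      finally show ?thesis .
    qed
    then have "real q powr (-5/4) * real q powr (1/4) \<le> real q powr (-5/4) * sqrt R" by (intro mult_left_mono) auto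
    finally show "real (card (unit_residues q)) / (real q)\<^sup>2 \<le> real q powr (-5/4) * sqrt R" .
  qed
  also have "\<dots> = (\<Sum>q=1..Q. real q powr (-5/4)) * sqrt R" by (rule sum_distrib_right[symmetric])
  also have "\<dots> \<le> harmonic_const * sqrt R"
    unfolding harmonic_const_def using R_pos
    by (intro mult_right_mono sum_le_suminf) (auto simp: summable_real_powr_iff)
  finally show ?thesis .
qed

lemma circle_method_estimate:
  "norm (of_nat (class_count d lam p a) - main_value * (\<Sum>q=1..Q. local_term d p q lam a))
     \<le> (major_const * harmonic_const + exp (2 * pi) * 7 ^ d) * (R ^ (2 * d - 5) * sqrt R)"
proof -
  define T where "T = (\<lambda>x. theta_integrand d lam p a (Complex x (1 / real lam)))"
  define I where "I = {left_end..left_end + 1}"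
  define U where "U = (\<Union>(q, h)\<in>arcs. arc q h)"
  have y: "1 / real lam > 0" using lam by simp
  have int: "set_integrable lborel I T" unfolding T_def I_def by (rule class_count_integral(1)[OF p y])
  have UI: "U \<subseteq> I" unfolding U_def I_def using arc_subset by (force simp: arcs_def)
  have "open U" unfolding U_def by (auto simp: arc_def)
  then have Us: "U \<in> sets lborel" by simp
  have Is: "I - U \<in> sets lborel" using Us by (auto simp: I_def)
  have intU: "set_integrable lborel U T" by (rule set_integrable_subset[OF int Us UI])
  have intIU: "set_integrable lborel (I - U) T" by (rule set_integrable_subset[OF int Is]) auto
  have arcs_int: "set_integrable lborel (case z of (q, h) \<Rightarrow> arc q h) T" if "z \<in> arcs" for z
  proof (rule set_integrable_subset[OF intU])
    show "(case z of (q, h) \<Rightarrow> arc q h) \<in> sets lborel" by (cases z) (simp add: arc_def)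
    show "(case z of (q, h) \<Rightarrow> arc q h) \<subseteq> U" using that by (auto simp: U_def)
  qed
  have "of_nat (class_count d lam p a) = (LINT x:I|lborel. T x)"
    unfolding T_def I_def by (rule class_count_integral(2)[OF p y, symmetric])
  also have "I = U \<union> (I - U)" using UI by auto
  also have "(LINT x:U \<union> (I - U)|lborel. T x) = (LINT x:U|lborel. T x) + (LINT x:I - U|lborel. T x)"
    by (rule set_integral_Un[OF _ intU intIU]) auto
  also have "(LINT x:U|lborel. T x) = (\<Sum>z\<in>arcs. LINT x:(case z of (q, h) \<Rightarrow> arc q h)|lborel. T x)"
    unfolding U_def
  proof (rule set_integral_finite_Union)
    show "disjoint_family_on (\<lambda>z. case z of (q, h) \<Rightarrow> arc q h) arcs"
      unfolding disjoint_family_on_def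
    proof (intro ballI impI)
      fix z z' assume z: "z \<in> arcs" "z' \<in> arcs" "z \<noteq> z'"
      obtain q h q' h' where zz: "z = (q, h)" "z' = (q', h')" by (cases z, cases z') auto
      have "x \<notin> arc q' h'" if "x \<in> arc q h" for x
        using arc_disjoint[of q q' h h' x] z zz that by (auto simp: arcs_def)
      then show "(case z of (q, h) \<Rightarrow> arc q h) \<inter> (case z' of (q, h) \<Rightarrow> arc q h) = {}" using zz by auto
    qed
  qed (use finite_arcs arcs_int in \<open>auto simp: arc_def\<close>)
  finally have N: "of_nat (class_count d lam p a) = (\<Sum>(q, h)\<in>arcs. LINT x:arc q h|lborel. T x) + (LINT x:I - U|lborel. T x)"
    by (simp add: case_prod_beta)
  have "norm (of_nat (class_count d lam p a) - main_value * (\<Sum>q=1..Q. local_term d p q lam a)) =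
     norm ((\<Sum>(q, h)\<in>arcs. (LINT x:arc q h|lborel. T x) - coeff q h * main_value) + (LINT x:I - U|lborel. T x))"
    unfolding N sum_coeff[symmetric]
    by (simp add: case_prod_beta sum_subtractf sum_distrib_left mult.commute) (simp add: algebra_simps)
  also have "\<dots> \<le> norm (\<Sum>(q, h)\<in>arcs. (LINT x:arc q h|lborel. T x) - coeff q h * main_value) + norm (LINT x:I - U|lborel. T x)"
    by (rule norm_triangle_ineq)
  also have "\<dots> \<le> (\<Sum>(q, h)\<in>arcs. major_const * R ^ (2 * d - 5) * (1 / (real q)\<^sup>2)) + exp (2 * pi) * (7 * R) ^ d"
  proof (rule add_mono)
    show "norm (\<Sum>(q, h)\<in>arcs. (LINT x:arc q h|lborel. T x) - coeff q h * main_value) \<le> (\<Sum>(q, h)\<in>arcs. major_const * R ^ (2 * d - 5) * (1 / (real q)\<^sup>2))"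
      by (rule order_trans[OF norm_sum sum_mono]) (use arc_integral in \<open>auto simp: T_def arcs_def\<close>)
    show "norm (LINT x:I - U|lborel. T x) \<le> exp (2 * pi) * (7 * R) ^ d"
      unfolding I_def U_def T_def by (rule minor_integral)
  qed
  also have "(\<Sum>(q, h)\<in>arcs. major_const * R ^ (2 * d - 5) * (1 / (real q)\<^sup>2)) = major_const * R ^ (2 * d - 5) * (\<Sum>(q, h)\<in>arcs. 1 / (real q)\<^sup>2)"
    by (simp add: case_prod_beta sum_distrib_left)
  also have "\<dots> \<le> major_const * R ^ (2 * d - 5) * (harmonic_const * sqrt R)"
  proof (rule mult_left_mono[OF sum_inverse_squares_arcs])
    show "0 \<le> major_const * R ^ (2 * d - 5)"
      unfolding major_const_def arc_const_def using R_pos cauchy_mass_nonneg by auto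
  qed
  \<comment> \<open>The minor arcs fit under the major arc error because
    \<open>d \<le> 2 * d - 5\<close>, which is again the condition \<open>d \<ge> 5\<close>.\<close>
  also have "exp (2 * pi) * (7 * R) ^ d \<le> exp (2 * pi) * 7 ^ d * (R ^ (2 * d - 5) * sqrt R)"
  proof -
    have "R ^ d * 1 \<le> R ^ (2 * d - 5) * sqrt R"
      using R_ge_1 d by (intro mult_mono power_increasing) auto
    then show ?thesis unfolding power_mult_distrib by (simp add: mult.assoc)
  qed
  finally show ?thesis by (simp add: algebra_simps)
qed

text \<open>Origin of the exponent \<open>1/8\<close>: relative to
  \<open>lam powr (d / 2 - 1) = R ^ (2 * d - 4)\<close> the arcs save a factor
  \<open>R = lam powr (1/4)\<close>, and the sum over \<open>q\<close> gives back
  \<open>sqrt R\<close>.\<close>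

lemma R_power_scale: "R ^ (2 * d - 5) * sqrt R = real lam powr (real d / 2 - 1 - 1/8)"
proof -
  have "R ^ (2 * d - 5) = real lam powr (1/4 * real (2 * d - 5))"
    unfolding R_def using lam by (simp add: powr_power)
  moreover have "sqrt R = real lam powr (1/8)"
    unfolding R_def using lam by (simp add: powr_half_sqrt[symmetric] powr_powr)
  ultimately have "R ^ (2 * d - 5) * sqrt R = real lam powr (1/4 * real (2 * d - 5) + 1/8)"
    by (simp only: powr_add)
  also have "1/4 * real (2 * d - 5) + 1/8 = real d / 2 - 1 - 1/8" using d by (simp add: of_nat_diff field_simps)
  finally show ?thesis .
qed

end

section \<open>Asymptotic counts\<close>

text \<open>Leaving the locale fixes the order of quantifiers: \<open>major_const\<close> and
  \<open>harmonic_const\<close> involve neither \<open>lam\<close> nor \<open>p\<close> nor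
  \<open>a\<close>, so one \<open>C\<close> serves all of them. Modulus \<open>p = 1\<close> is
  included for the count of the whole sphere.\<close>

theorem class_count_asymptotic:
  assumes d: "d \<ge> 5"
  obtains C where "C \<ge> 0" "\<And>lam p a. lam > 0 \<Longrightarrow> p > 0 \<Longrightarrow>
    norm (of_nat (class_count d lam p a) - of_real (sphere_const d * real lam powr (real d / 2 - 1)) *
        (\<Sum>q=1..nat \<lfloor>sqrt (real lam)\<rfloor>. local_term d p q lam a)) \<le> C * real lam powr (real d / 2 - 1 - 1/8)"
proof -
  define C where "C = circle_method.major_const d * circle_method.harmonic_const + exp (2 * pi) * 7 ^ d"
  have est: "norm (of_nat (class_count d lam p a) - of_real (sphere_const d * real lam powr (real d / 2 - 1)) *
        (\<Sum>q=1..nat \<lfloor>sqrt (real lam)\<rfloor>. local_term d p q lam a)) \<le> C * real lam powr (real d / 2 - 1 - 1/8)"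
    if "lam > 0" "p > 0" for lam p a
  proof -
    interpret circle_method d p lam a by unfold_locales (use d that in auto)
    show ?thesis using circle_method_estimate unfolding R_power_scale main_value_def Q_def C_def .
  qed
  have "C \<ge> 0" using order_trans[OF norm_ge_zero est[of 1 1]] by simp
  then show ?thesis using est that by blast
qed

section \<open>Truncation of the singular series\<close>

definition QR_tail_const :: "nat \<Rightarrow> real" where
  "QR_tail_const d = sqrt 2 ^ d * (\<Sum>\<^sub>\<infinity>r::nat. real r powr (-7/6))"

text \<open>Split \<open>r powr (-3/2)\<close> as \<open>r powr (-1/3) * r powr (-7/6)\<close>: the
  second factor is still summable, and the first is at most \<open>lam powr (-1/8)\<close> when
  \<open>r \<ge> lam powr (3/8)\<close>.\<close>

lemma QR_tail:
  assumes d: "d \<ge> 5" and lam: "lam > 0" and A: "\<And>r. r \<in> A \<Longrightarrow> real r \<ge> real lam powr (3/8)"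
  shows "norm (\<Sum>\<^sub>\<infinity>r\<in>A. QR d r lam) \<le> QR_tail_const d * real lam powr (-1/8)"
proof -
  define g where "g = (\<lambda>r::nat. real r powr (-7/6))"
  have g: "g summable_on UNIV" unfolding g_def
    by (subst summable_on_UNIV_nonneg_real_iff) (auto simp: summable_real_powr_iff)
  then have gA: "g summable_on A" by (rule summable_on_subset) auto
  define c where "c = sqrt 2 ^ d * real lam powr (-1/8)"
  have "((\<lambda>r. c * g r) has_sum (c * infsum g A)) A"
    by (intro has_sum_cmult_right has_sum_infsum gA)
  then have "norm (\<Sum>\<^sub>\<infinity>r\<in>A. QR d r lam) \<le> c * infsum g A"
  proof (rule norm_infsum_le_has_sum)
    fix r assume "r \<in> A"
    then have r: "real r \<ge> real lam powr (3/8)" by (rule A)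
    moreover have l0: "real lam powr (3/8) > 0" using lam by simp
    ultimately have r0: "r > 0" using of_nat_0_less_iff[of r, where ?'a=real] by linarith
    have "real r powr (-3/2) = real r powr (-1/3) * real r powr (-7/6)" by (simp flip: powr_add)
    also have "real r powr (-1/3) \<le> (real lam powr (3/8)) powr (-1/3)"
      using r l0 by (intro powr_mono2') auto
    also have "(real lam powr (3/8)) powr (-1/3) = real lam powr (-1/8)" by (simp add: powr_powr)
    finally have "real r powr (-3/2) \<le> real lam powr (-1/8) * real r powr (-7/6)" by (simp add: mult_right_mono)
    then have "sqrt 2 ^ d * real r powr (-3/2) \<le> sqrt 2 ^ d * (real lam powr (-1/8) * real r powr (-7/6))"
      by (intro mult_left_mono) auto
    from order_trans[OF norm_QR_bound[OF d r0] this]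
    show "norm (QR d r lam) \<le> c * g r" by (simp only: c_def g_def mult.assoc)
  qed
  also have "\<dots> \<le> c * infsum g UNIV"
    by (intro mult_left_mono infsum_mono2 g gA) (auto simp: c_def g_def)
  finally show ?thesis by (simp add: c_def g_def QR_tail_const_def mult_ac)
qed

lemma QR_truncation:
  assumes d: "d \<ge> 5" and lam: "lam > 0" and P: "P \<subseteq> {1..}"
    and B: "\<And>r. r > B \<Longrightarrow> real r \<ge> real lam powr (3/8)"
  shows "norm ((\<Sum>\<^sub>\<infinity>r\<in>P. QR d r lam) - (\<Sum>r\<in>{r \<in> P. r \<le> B}. QR d r lam)) \<le> QR_tail_const d * real lam powr (-1/8)"
proof -
  have sum: "(\<lambda>r. QR d r lam) summable_on A" if "A \<subseteq> {1..}" for A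
    using abs_summable_summable[OF QR_abs_summable[OF d]] that by (rule summable_on_subset)
  have "P = {r \<in> P. r \<le> B} \<union> {r \<in> P. r > B}" by auto
  then have "(\<Sum>\<^sub>\<infinity>r\<in>P. QR d r lam) = (\<Sum>\<^sub>\<infinity>r\<in>{r \<in> P. r \<le> B} \<union> {r \<in> P. r > B}. QR d r lam)" by simp
  also have "\<dots> = (\<Sum>\<^sub>\<infinity>r\<in>{r \<in> P. r \<le> B}. QR d r lam) + (\<Sum>\<^sub>\<infinity>r\<in>{r \<in> P. r > B}. QR d r lam)"
    by (rule infsum_Un_disjoint) (use P in \<open>auto intro!: sum\<close>)
  also have "(\<Sum>\<^sub>\<infinity>r\<in>{r \<in> P. r \<le> B}. QR d r lam) = (\<Sum>r\<in>{r \<in> P. r \<le> B}. QR d r lam)"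
    by (rule infsum_finite) (rule finite_subset[of _ "{..B}"], auto)
  finally have "(\<Sum>\<^sub>\<infinity>r\<in>P. QR d r lam) - (\<Sum>r\<in>{r \<in> P. r \<le> B}. QR d r lam) = (\<Sum>\<^sub>\<infinity>r\<in>{r \<in> P. r > B}. QR d r lam)" by simp
  then show ?thesis using QR_tail[OF d lam, of "{r \<in> P. r > B}"] B by simp
qed

lemma sqrt_floor_tail:
  assumes "lam > 0" "r > nat \<lfloor>sqrt (real lam)\<rfloor>"
  shows "real r \<ge> real lam powr (3/8)"
proof -
  have "real lam powr (3/8) \<le> real lam powr (1/2)" using assms(1) by (intro powr_mono) auto
  also have "\<dots> = sqrt (real lam)" by (simp add: powr_half_sqrt)
  also have "\<dots> \<le> real r" using assms(2) by linarith
  finally show ?thesis .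
qed

text \<open>The multiples \<open>q = r * p\<close> stop at \<open>r \<le> Q div p\<close>, so the
  same series occurs with two different truncations.\<close>

lemma sum_local_term_prime:
  assumes p: "prime p" "odd p" and a: "[norm_sq d a = int lam] (mod int p)" and lam: "\<not> p dvd lam"
  shows "(\<Sum>q=1..Q. local_term d p q lam a) =
    ((\<Sum>r\<in>{r \<in> {r. r \<ge> 1 \<and> coprime p r}. r \<le> Q}. QR d r lam) + of_nat (p - 1) * (\<Sum>r\<in>{r \<in> {r. r \<ge> 1 \<and> coprime p r}. r \<le> Q div p}. QR d r lam)) / of_nat p ^ d"
proof -
  define A1 where "A1 = {r \<in> {r. r \<ge> 1 \<and> coprime p r}. r \<le> Q}"
  define B where "B = {r \<in> {r. r \<ge> 1 \<and> coprime p r}. r \<le> Q div p}"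
  define A2 where "A2 = (\<lambda>r. r * p) ` B"
  define A3 where "A3 = {q \<in> {1..Q}. p ^ 2 dvd q}"
  have p1: "p > 1" using p(1) by (rule prime_gt_1_nat)
  have fin: "finite A1" "finite B" "finite A2" "finite A3"
    unfolding A2_def A3_def by (auto simp: A1_def B_def)
  have split: "{1..Q} = A1 \<union> (A2 \<union> A3)"
  proof (intro equalityI subsetI)
    fix q assume q: "q \<in> {1..Q}"
    show "q \<in> A1 \<union> (A2 \<union> A3)"
    proof (cases "coprime p q")
      case True
      then show ?thesis using q by (auto simp: A1_def)
    next
      case False
      then have "p dvd q" using p(1) prime_imp_coprime by blast
      then obtain r where r: "q = r * p" by (metis dvd_def mult.commute)
      show ?thesis
      proof (cases "coprime p r")
        case True
        have "r \<ge> 1" using q r by (cases r) auto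
        moreover have "r \<le> Q div p" using q r p1 by (simp add: less_eq_div_iff_mult_less_eq)
        ultimately have "r \<in> B" using True by (simp add: B_def)
        then show ?thesis using r by (auto simp: A2_def)
      next
        case False
        then have "p dvd r" using p(1) prime_imp_coprime by blast
        then have "p ^ 2 dvd q" unfolding r power2_eq_square by (intro mult_dvd_mono) auto
        then show ?thesis using q by (simp add: A3_def)
      qed
    qed
  next
    fix q assume "q \<in> A1 \<union> (A2 \<union> A3)"
    then show "q \<in> {1..Q}" using p1
      by (auto simp: A1_def A2_def A3_def B_def less_eq_div_iff_mult_less_eq Suc_le_eq)
  qed
  have disj: "A1 \<inter> (A2 \<union> A3) = {}" "A2 \<inter> A3 = {}"
  proof -
    have "\<not> coprime p q" if "q \<in> A2 \<union> A3" for q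
    proof -
      have "p dvd q" using that by (auto simp: A2_def A3_def power2_eq_square dest: dvd_mult_left)
      then show ?thesis using p1 by (auto simp: coprime_absorb_left)
    qed
    then show "A1 \<inter> (A2 \<union> A3) = {}" by (auto simp: A1_def)
    have "\<not> p ^ 2 dvd r * p" if "r \<in> B" for r
    proof
      assume "p ^ 2 dvd r * p"
      then have "p dvd r" using p1 by (simp add: power2_eq_square)
      then show False using that p1 by (auto simp: B_def coprime_absorb_left)
    qed
    then show "A2 \<inter> A3 = {}" by (auto simp: A2_def A3_def)
  qed
  have "(\<Sum>q=1..Q. local_term d p q lam a) = (\<Sum>q\<in>A1. local_term d p q lam a) + ((\<Sum>q\<in>A2. local_term d p q lam a) + (\<Sum>q\<in>A3. local_term d p q lam a))"
    unfolding split using fin disj by (simp add: sum.union_disjoint)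
  also have "(\<Sum>q\<in>A1. local_term d p q lam a) = (\<Sum>q\<in>A1. QR d q lam / of_nat p ^ d)"
    using p1 by (intro sum.cong refl local_term_coprime) (auto simp: A1_def)
  also have "(\<Sum>q\<in>A2. local_term d p q lam a) = (\<Sum>r\<in>B. local_term d p (r * p) lam a)"
    unfolding A2_def using p1 by (subst sum.reindex) (auto simp: inj_on_def)
  also have "\<dots> = (\<Sum>r\<in>B. of_nat (p - 1) * QR d r lam / of_nat p ^ d)"
    by (intro sum.cong refl local_term_prime_factor[OF p(1) _ _ a]) (auto simp: B_def)
  also have "(\<Sum>q\<in>A3. local_term d p q lam a) = 0"
    by (intro sum.neutral ballI local_term_square_factor[OF p _ _ a lam]) (auto simp: A3_def)
  finally show ?thesis
    unfolding A1_def[symmetric] B_def[symmetric]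
    by (simp add: sum_divide_distrib sum_distrib_left add_divide_distrib)
qed

text \<open>The two truncations have total weight \<open>1 + (p - 1) = p\<close>, which after
  division by \<open>p ^ d\<close> is the factor \<open>p powi (1 - d)\<close> of the main term; as
  it is at most 1, the error does not grow with \<open>p\<close>.\<close>

lemma sum_local_term_asymptotic:
  assumes d: "d \<ge> 5" and lam: "lam > 0" "\<not> p dvd lam" "lam \<ge> p ^ 8"
    and p: "prime p" "odd p" and a: "[norm_sq d a = int lam] (mod int p)"
  shows "norm ((\<Sum>q=1..nat \<lfloor>sqrt (real lam)\<rfloor>. local_term d p q lam a) - of_real (real p powi (1 - int d)) * (\<Sum>\<^sub>\<infinity>r\<in>{r. r \<ge> 1 \<and> coprime p r}. QR d r lam))
     \<le> QR_tail_const d * real lam powr (-1/8)"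
proof -
  define P where "P = {r::nat. r \<ge> 1 \<and> coprime p r}"
  define Q where "Q = nat \<lfloor>sqrt (real lam)\<rfloor>"
  define S where "S = (\<Sum>\<^sub>\<infinity>r\<in>P. QR d r lam)"
  define S1 where "S1 = (\<Sum>r\<in>{r \<in> P. r \<le> Q}. QR d r lam)"
  define S2 where "S2 = (\<Sum>r\<in>{r \<in> P. r \<le> Q div p}. QR d r lam)"
  define t where "t = QR_tail_const d * real lam powr (-1/8)"
  have p1: "p > 1" using p(1) by (rule prime_gt_1_nat)
  have P: "P \<subseteq> {1..}" by (auto simp: P_def)
  have S1: "norm (S - S1) \<le> t"
    unfolding S_def S1_def t_def by (rule QR_truncation[OF d lam(1) P]) (simp add: Q_def sqrt_floor_tail[OF lam(1)])
  have S2: "norm (S - S2) \<le> t"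
    unfolding S_def S2_def t_def
  proof (rule QR_truncation[OF d lam(1) P])
    \<comment> \<open>Here \<open>lam \<ge> p ^ 8\<close> is used: \<open>r > Q div p\<close> gives
      \<open>r * p \<ge> sqrt lam\<close>, and \<open>p \<le> lam powr (1/8)\<close> turns this into
      \<open>r \<ge> lam powr (3/8)\<close>.\<close>
    fix r assume "r > Q div p"
    then have "Q < r * p" using p1 by (simp add: div_less_iff_less_mult)
    then have "sqrt (real lam) \<le> real (r * p)" unfolding Q_def by linarith
    then have 1: "real lam powr (1/2) \<le> real r * real p" by (simp add: powr_half_sqrt)
    have "real p powr 8 = real p ^ 8" using p1 by simp
    moreover have "(real p powr 8) powr (1/8) = real p" using p1 by (subst powr_powr) simp
    ultimately have "real p = (real p ^ 8) powr (1/8)" by (simp only:)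
    also have "\<dots> \<le> real lam powr (1/8)" using lam(3) by (intro powr_mono2) (auto simp flip: of_nat_power)
    finally have "real r * real p \<le> real r * real lam powr (1/8)" by (intro mult_left_mono) auto
    then have "real lam powr (1/2) \<le> real r * real lam powr (1/8)" using 1 by linarith
    moreover have "real lam powr (1/2) = real lam powr (3/8) * real lam powr (1/8)" by (simp flip: powr_add)
    ultimately show "real lam powr (3/8) \<le> real r" using lam(1) by simp
  qed
  have pw: "real p powi (1 - int d) = real p / real p ^ d"
    using p1 by (simp add: power_int_diff)
  have "(\<Sum>q=1..Q. local_term d p q lam a) - of_real (real p powi (1 - int d)) * S = ((S1 - S) + of_nat (p - 1) * (S2 - S)) / of_nat p ^ d"
  proof -
    have "(\<Sum>q=1..Q. local_term d p q lam a) = (S1 + of_nat (p - 1) * S2) / of_nat p ^ d"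
      unfolding S1_def S2_def P_def by (rule sum_local_term_prime[OF p a lam(2)])
    moreover have "complex_of_real (real p powi (1 - int d)) * S = (S + of_nat (p - 1) * S) / of_nat p ^ d"
      unfolding pw using p1 by (simp add: of_nat_diff algebra_simps)
    ultimately show ?thesis by (simp add: diff_divide_distrib[symmetric] algebra_simps)
  qed
  also have "norm \<dots> = norm ((S1 - S) + of_nat (p - 1) * (S2 - S)) / real p ^ d"
    by (simp add: norm_divide norm_power)
  also have "\<dots> \<le> (t + real (p - 1) * t) / real p ^ d"
  proof (rule divide_right_mono)
    have "norm ((S1 - S) + of_nat (p - 1) * (S2 - S)) \<le> norm (S1 - S) + real (p - 1) * norm (S2 - S)"
      by (metis norm_triangle_ineq norm_mult norm_of_nat)
    also have "\<dots> \<le> t + real (p - 1) * t"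
      using S1 S2 by (intro add_mono mult_left_mono) (auto simp: norm_minus_commute)
    finally show "norm ((S1 - S) + of_nat (p - 1) * (S2 - S)) \<le> t + real (p - 1) * t" .
  qed auto
  also have "\<dots> = t * (real p / real p ^ d)" using p1 by (simp add: of_nat_diff field_simps)
  also have "\<dots> \<le> t * 1"
  proof (rule mult_left_mono)
    have "real p ^ 1 \<le> real p ^ d" using p1 d by (intro power_increasing) auto
    then show "real p / real p ^ d \<le> 1" using p1 by simp
    show "t \<ge> 0" using S1 norm_ge_zero order_trans by blast
  qed
  finally show ?thesis by (simp add: S_def P_def Q_def t_def)
qed

section \<open>From counts to normalised densities\<close>

lemma powr_minus_eighth: "(x::real) powr (e - 1/8) = x powr e * x powr (-1/8)"
  using powr_add[of x e "-1/8"] by simp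

lemma sphere_count_eq_class_count: "sphere_count d lam = class_count d lam 1 a"
  by (simp add: sphere_count_def class_count_def)

lemma sphere_const_pos: "d > 0 \<Longrightarrow> sphere_const d > 0"
  by (simp add: sphere_const_def Gamma_real_pos)

text \<open>Modulus 1: every denominator is coprime to it, so the local terms are the
  \<open>QR\<close> themselves and the truncation at \<open>sqrt lam\<close> is the only
  one.\<close>

lemma sphere_count_asymptotic:
  assumes d: "d \<ge> 5"
  obtains C where "C \<ge> 0" "\<And>lam. lam > 0 \<Longrightarrow>
    norm (of_nat (sphere_count d lam) - of_real (sphere_const d * real lam powr (real d / 2 - 1)) * (\<Sum>\<^sub>\<infinity>r\<in>{1..}. QR d r lam))
      \<le> C * real lam powr (real d / 2 - 1 - 1/8)"
proof -
  obtain C where C: "C \<ge> 0" "\<And>lam p a. lam > 0 \<Longrightarrow> p > 0 \<Longrightarrow>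
    norm (of_nat (class_count d lam p a) - of_real (sphere_const d * real lam powr (real d / 2 - 1)) *
        (\<Sum>q=1..nat \<lfloor>sqrt (real lam)\<rfloor>. local_term d p q lam a)) \<le> C * real lam powr (real d / 2 - 1 - 1/8)"
    using class_count_asymptotic[OF d] by metis
  define c where "c = sphere_const d"
  have c: "c > 0" unfolding c_def using d by (intro sphere_const_pos) auto
  show ?thesis
  proof (rule that)
    have "QR_tail_const d * real 1 powr (-1/8) \<ge> 0"
      by (rule order_trans[OF norm_ge_zero QR_tail[OF d, of 1 "{}"]]) auto
    then have t: "QR_tail_const d \<ge> 0" by simp
    then show "C + c * QR_tail_const d \<ge> 0" using C(1) c by simp
    fix lam :: nat assume lam: "lam > 0"
    define X where "X = c * real lam powr (real d / 2 - 1)"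
    define S where "S = (\<Sum>\<^sub>\<infinity>r\<in>{1..}. QR d r lam)"
    define S1 where "S1 = (\<Sum>r=1..nat \<lfloor>sqrt (real lam)\<rfloor>. QR d r lam)"
    have "(\<Sum>q=1..nat \<lfloor>sqrt (real lam)\<rfloor>. local_term d 1 q lam (\<lambda>_. 0)) = S1"
      unfolding S1_def by (intro sum.cong refl) (subst local_term_coprime, auto)
    then have 1: "norm (of_nat (sphere_count d lam) - of_real X * S1) \<le> C * real lam powr (real d / 2 - 1 - 1/8)"
      using C(2)[OF lam, of 1 "\<lambda>_. 0"] by (simp add: sphere_count_eq_class_count[of d lam "\<lambda>_. 0"] X_def c_def)
    have "{r \<in> {1..}. r \<le> nat \<lfloor>sqrt (real lam)\<rfloor>} = {1..nat \<lfloor>sqrt (real lam)\<rfloor>}" by auto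
    then have 2: "norm (S - S1) \<le> QR_tail_const d * real lam powr (-1/8)"
      using QR_truncation[OF d lam, of "{1..}" "nat \<lfloor>sqrt (real lam)\<rfloor>"] sqrt_floor_tail[OF lam] by (simp add: S_def S1_def)
    have "norm (of_real X * S1 - of_real X * S) = \<bar>X\<bar> * norm (S - S1)"
      by (simp add: norm_mult norm_minus_commute flip: right_diff_distrib)
    also have "\<dots> \<le> X * (QR_tail_const d * real lam powr (-1/8))"
      using 2 c by (intro mult_mono) (auto simp: X_def)
    also have "\<dots> = c * QR_tail_const d * real lam powr (real d / 2 - 1 - 1/8)"
      unfolding powr_minus_eighth X_def by (simp only: mult_ac)
    finally have 3: "norm (of_real X * S1 - of_real X * S) \<le> c * QR_tail_const d * real lam powr (real d / 2 - 1 - 1/8)" .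
    have "norm (of_nat (sphere_count d lam) - of_real X * S) \<le> norm (of_nat (sphere_count d lam) - of_real X * S1) + norm (of_real X * S1 - of_real X * S)"
      using norm_triangle_ineq[of "of_nat (sphere_count d lam) - of_real X * S1" "of_real X * S1 - of_real X * S"] by simp
    also have "\<dots> \<le> (C + c * QR_tail_const d) * real lam powr (real d / 2 - 1 - 1/8)"
      using 1 3 by (simp add: distrib_right)
    finally show "norm (of_nat (sphere_count d lam) - of_real (sphere_const d * real lam powr (real d / 2 - 1)) * (\<Sum>\<^sub>\<infinity>r\<in>{1..}. QR d r lam))
      \<le> (C + c * QR_tail_const d) * real lam powr (real d / 2 - 1 - 1/8)"
      by (simp only: X_def c_def S_def)
  qed
qed

text \<open>For \<open>lam > M\<close> the error is at most half of the lower bound that the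
  singular series gives for the main term. For the remaining \<open>lam\<close> the trivial count 1
  suffices, and it is there that nonemptiness of the sphere enters.\<close>

lemma sphere_count_lower_bound:
  assumes d: "d \<ge> 5"
  obtains c where "c > 0" "\<And>lam. lam > 0 \<Longrightarrow> sphere_count d lam > 0 \<Longrightarrow> real (sphere_count d lam) \<ge> c * real lam powr (real d / 2 - 1)"
proof -
  obtain C where C: "C \<ge> 0" "\<And>lam. lam > 0 \<Longrightarrow>
    norm (of_nat (sphere_count d lam) - of_real (sphere_const d * real lam powr (real d / 2 - 1)) * (\<Sum>\<^sub>\<infinity>r\<in>{1..}. QR d r lam))
      \<le> C * real lam powr (real d / 2 - 1 - 1/8)"
    using sphere_count_asymptotic[OF d] by metis
  define k where "k = sphere_const d / 25"
  define e where "e = real d / 2 - 1"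
  have e: "e > 0" using d by (simp add: e_def)
  have k: "k > 0" unfolding k_def using sphere_const_pos[of d] d by simp
  \<comment> \<open>Chosen so that \<open>lam > M\<close> implies
    \<open>C * lam powr (-1/8) \<le> k / 2\<close>; the \<open>+ 1\<close> keeps \<open>M\<close>
    positive when \<open>C = 0\<close>.\<close>
  define M where "M = (2 * (C + 1) / k) powr 8"
  have M: "M > 0" using C(1) k by (simp add: M_def)
  define c where "c = min (k / 2) (M powr (- e))"
  show ?thesis
  proof (rule that)
    show "c > 0" using k M by (simp add: c_def)
    fix lam :: nat assume lam: "lam > 0" and pos: "sphere_count d lam > 0"
    define L where "L = real lam powr e"
    have L: "L > 0" using lam by (simp add: L_def)
    show "real (sphere_count d lam) \<ge> c * real lam powr (real d / 2 - 1)"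
    proof (cases "real lam \<le> M")
      case True
      have "c * L \<le> M powr (- e) * L" using L by (intro mult_right_mono) (auto simp: c_def)
      also have "\<dots> \<le> M powr (- e) * M powr e"
        unfolding L_def using True e by (intro mult_left_mono powr_mono2) auto
      also have "\<dots> = 1" using M by (simp add: powr_minus)
      also have "1 \<le> real (sphere_count d lam)" using pos by simp
      finally show ?thesis by (simp add: L_def e_def)
    next
      case False
      define S where "S = (\<Sum>\<^sub>\<infinity>r\<in>{1..}. QR d r lam)"
      have S: "norm S \<ge> 1 / 25" unfolding S_def by (rule norm_singular_series_ge[OF d])
      have "2 * (C + 1) / k = M powr (1/8)" using C(1) k by (simp add: M_def powr_powr del: powr_numeral)
      also have "\<dots> \<le> real lam powr (1/8)" using False M by (intro powr_mono2) auto
      finally have "2 * (C + 1) / k * real lam powr (-1/8) \<le> real lam powr (1/8) * real lam powr (-1/8)"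
        by (intro mult_right_mono) auto
      also have "\<dots> = 1" using lam by (simp flip: powr_add)
      finally have "(C + 1) * real lam powr (-1/8) \<le> k / 2" using k by (simp add: field_simps)
      then have Ck: "C * real lam powr (-1/8) \<le> k / 2"
        using mult_right_mono[of C "C + 1" "real lam powr (-1/8)"] by simp
      have "k * L \<le> norm (of_real (sphere_const d * L) * S)"
      proof -
        have "sphere_const d * L * (1 / 25) \<le> sphere_const d * L * norm S"
          using S L k by (intro mult_left_mono) (auto simp: k_def)
        then show ?thesis using L k by (simp add: norm_mult k_def abs_mult)
      qed
      also have "\<dots> \<le> norm (of_nat (sphere_count d lam) :: complex) + norm (of_nat (sphere_count d lam) - of_real (sphere_const d * L) * S)"
        by (metis norm_minus_commute norm_triangle_sub)
      also have "\<dots> \<le> real (sphere_count d lam) + C * real lam powr (e - 1/8)"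
        using C(2)[OF lam] by (simp add: L_def e_def S_def)
      also have "C * real lam powr (e - 1/8) = C * real lam powr (-1/8) * L"
        unfolding powr_minus_eighth L_def by (simp only: mult_ac)
      also have "\<dots> \<le> k / 2 * L" using Ck L by (intro mult_right_mono) auto
      finally have "k / 2 * L \<le> real (sphere_count d lam)" by simp
      moreover have "c * L \<le> k / 2 * L" using L by (intro mult_right_mono) (auto simp: c_def)
      ultimately show ?thesis by (simp add: L_def e_def)
    qed
  qed
qed

lemma class_count_eq_0:
  assumes "\<not> [norm_sq d a = int lam] (mod int p)"
  shows "class_count d lam p a = 0"
proof -
  have "\<not> (\<forall>i<d. [n i = a i] (mod int p))" if n: "n \<in> sphere_points d lam" for n
  proof
    assume "\<forall>i<d. [n i = a i] (mod int p)"
    then have "[norm_sq d n = norm_sq d a] (mod int p)"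
      unfolding norm_sq_def by (intro cong_sum cong_pow) auto
    then show False using n assms by (simp add: sphere_points_def cong_sym)
  qed
  then have "{n \<in> sphere_points d lam. \<forall>i<d. [n i = a i] (mod int p)} = {}" by auto
  then show ?thesis unfolding class_count_def by (simp only: card.empty)
qed

theorem theorem1p6:
  fixes d :: nat
  assumes "d \<ge> 5"
  shows "\<exists>C::real. \<forall>(lam::nat) (p::nat).
           lam > 0 \<longrightarrow> prime p \<longrightarrow> odd p \<longrightarrow> \<not> p dvd lam \<longrightarrow> lam \<ge> p ^ 8 \<longrightarrow>
           (\<forall>a \<in> residue_vectors d p.
              norm (complex_of_real (nu d lam p a)
                - complex_of_real (rho d lam * sphere_const d * real p powi (1 - int d)
                    * of_bool [norm_sq d a = int lam] (mod int p))
                  * (\<Sum>\<^sub>\<infinity>r\<in>{r::nat. r \<ge> 1 \<and> coprime p r}. QR d r lam))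
              \<le> C * real lam powr (-1/8))"
proof -
  note d = assms
  obtain C where C: "C \<ge> 0" "\<And>lam p a. lam > 0 \<Longrightarrow> p > 0 \<Longrightarrow>
    norm (of_nat (class_count d lam p a) - of_real (sphere_const d * real lam powr (real d / 2 - 1)) *
        (\<Sum>q=1..nat \<lfloor>sqrt (real lam)\<rfloor>. local_term d p q lam a)) \<le> C * real lam powr (real d / 2 - 1 - 1/8)"
    using class_count_asymptotic[OF d] by metis
  obtain c where c: "c > 0" "\<And>lam. lam > 0 \<Longrightarrow> sphere_count d lam > 0 \<Longrightarrow> real (sphere_count d lam) \<ge> c * real lam powr (real d / 2 - 1)"
    using sphere_count_lower_bound[OF d] by metis
  define k where "k = sphere_const d"
  define t where "t = QR_tail_const d"
  have k: "k > 0" unfolding k_def using d by (intro sphere_const_pos) auto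
  have "t * real 1 powr (-1/8) \<ge> 0"
    unfolding t_def by (rule order_trans[OF norm_ge_zero QR_tail[OF d, of 1 "{}"]]) auto
  then have t: "t \<ge> 0" by simp
  \<comment> \<open>A count with error \<open>(C + k * t) * L * lam powr (-1/8)\<close> will be
    divided by a sphere count of at least \<open>c * L\<close>.\<close>
  define D where "D = (C + k * t) / c"
  have D: "D \<ge> 0" using C(1) c(1) k t by (simp add: D_def)
  have "norm (complex_of_real (nu d lam p a) - complex_of_real (rho d lam * sphere_const d * real p powi (1 - int d) * of_bool [norm_sq d a = int lam] (mod int p))
                  * (\<Sum>\<^sub>\<infinity>r\<in>{r::nat. r \<ge> 1 \<and> coprime p r}. QR d r lam)) \<le> D * real lam powr (-1/8)"
    if lam: "lam > 0" "\<not> p dvd lam" "lam \<ge> p ^ 8" and p: "prime p" "odd p" for lam p :: nat and a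
  proof -
    define s where "s = real (sphere_count d lam)"
    define N where "N = real (class_count d lam p a)"
    define L where "L = real lam powr (real d / 2 - 1)"
    define w where "w = real p powi (1 - int d)"
    define S where "S = (\<Sum>\<^sub>\<infinity>r\<in>{r::nat. r \<ge> 1 \<and> coprime p r}. QR d r lam)"
    have nu: "nu d lam p a = N / s" by (simp add: nu_def N_def s_def class_count_def)
    have rho: "rho d lam = L / s" by (simp add: rho_def L_def s_def)
    have rhs: "D * real lam powr (-1/8) \<ge> 0" using D by simp
    consider "sphere_count d lam = 0" | "\<not> [norm_sq d a = int lam] (mod int p)" |
      "sphere_count d lam > 0" "[norm_sq d a = int lam] (mod int p)" by blast
    then show ?thesis
    proof cases
      case 1
      then show ?thesis unfolding nu rho using rhs by (simp add: s_def)
    next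
      case 2
      then show ?thesis unfolding nu using rhs class_count_eq_0[OF 2] by (simp add: N_def)
    next
      case 3
      have L: "L > 0" using lam by (simp add: L_def)
      have s: "s \<ge> c * L" "s > 0" using c(2)[OF lam(1) 3(1)] 3(1) by (simp_all add: s_def L_def)
      define T where "T = (\<Sum>q=1..nat \<lfloor>sqrt (real lam)\<rfloor>. local_term d p q lam a)"
      have scale: "real lam powr (real d / 2 - 1 - 1/8) = L * real lam powr (-1/8)"
        unfolding powr_minus_eighth L_def ..
      have e1: "norm (of_real N - of_real (k * L) * T) \<le> C * (L * real lam powr (-1/8))"
        using C(2)[OF lam(1), of p a] prime_gt_0_nat[OF p(1)] unfolding scale by (simp add: N_def k_def L_def T_def)
      have e2: "norm (T - of_real w * S) \<le> t * real lam powr (-1/8)"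
        unfolding T_def w_def S_def t_def by (rule sum_local_term_asymptotic[OF d lam p 3(2)])
      have "norm (of_real N - of_real (k * L) * (of_real w * S)) \<le> norm (of_real N - of_real (k * L) * T) + norm (of_real (k * L) * (T - of_real w * S))"
        using norm_triangle_ineq[of "of_real N - of_real (k * L) * T" "of_real (k * L) * (T - of_real w * S)"] by (simp add: algebra_simps)
      also have "\<dots> \<le> C * (L * real lam powr (-1/8)) + (k * L) * (t * real lam powr (-1/8))"
      proof (rule add_mono[OF e1])
        show "norm (of_real (k * L) * (T - of_real w * S)) \<le> (k * L) * (t * real lam powr (-1/8))"
          unfolding norm_mult norm_of_real using e2 k L by (intro mult_mono) auto
      qed
      also have "\<dots> = (C + k * t) * L * real lam powr (-1/8)" by (simp add: algebra_simps)
      finally have e3: "norm (of_real N - of_real (k * L) * (of_real w * S)) \<le> (C + k * t) * L * real lam powr (-1/8)" .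
      have "complex_of_real (nu d lam p a) - complex_of_real (rho d lam * sphere_const d * real p powi (1 - int d) * of_bool [norm_sq d a = int lam] (mod int p)) * S
         = (of_real N - of_real (k * L) * (of_real w * S)) / of_real s"
        unfolding nu rho using 3(2) s(2) by (simp add: k_def w_def field_simps)
      then have "norm (complex_of_real (nu d lam p a) - complex_of_real (rho d lam * sphere_const d * real p powi (1 - int d) * of_bool [norm_sq d a = int lam] (mod int p)) * S)
         = norm (of_real N - of_real (k * L) * (of_real w * S)) / s"
        using s(2) by (simp add: norm_divide)
      also have "\<dots> \<le> ((C + k * t) * L * real lam powr (-1/8)) / (c * L)"
        using e3 s c(1) L C(1) k t by (intro frac_le) auto
      also have "\<dots> = D * real lam powr (-1/8)" using L c(1) by (simp add: D_def)
      finally show ?thesis unfolding S_def .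
    qed
  qed
  then show ?thesis by blast
qed

end
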